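(* Let $(\mathbb{E},A)$ be a $\widehat{G}$-equivariant Manin pair over $M$, and let $P$ be a Hamiltonian $G$-space for $(\mathbb{E},A)$, with moment map $\Phi\colon P\to M$ and morphism $L\colon(\mathbb{T}P,TP)\dashrightarrow(\mathbb{E},A)$. Let $\alpha=(\mathsf{a}_{\mathbb{E}},-\mathrm{pr}_{A^*})\colon\mathbb{E}\to TM\oplus A^*$. (a) For $y\in\mathbb{T}P$ and $\zeta\in\mathbb{E}$: $\ y\sim_L\zeta\ \Rightarrow\ \Phi_{\mathbb{T}P}(y)=\alpha(\zeta)$. (b) $L$ is a module morphism with respect to the canonical morphism $R\colon\mathbb{T}G\dashrightarrow\mathrm{Pair}(\mathbb{E})$: for $x\in\mathbb{T}G$, $y\in\mathbb{T}P$ with $\mathsf{s}_{\mathbb{T}G}(x)=\Phi_{\mathbb{T}P}(y)$, and $(\zeta',\zeta)\in\mathbb{E}\times\overline{\mathbb{E}}$, \[ x\sim_R(\zeta',\zeta),\quad y\sim_L\zeta\quad\Rightarrow\quad x\cdot y\sim_L\zeta'. \]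
   Context: **Groupoids.** For a Lie groupoid $G\rightrightarrows M$ with source $\mathsf{s}$ and target $\mathsf{t}$, $g\circ h$ is defined if $\mathsf{s}(g)=\mathsf{t}(h)$. Its Lie algebroid is $A=TG|_M/TM\cong\ker(T\mathsf{t})|_M$, with anchor $\mathsf{a}_A$ induced by $T\mathsf{s}-T\mathsf{t}$ and bracket from left-invariant vector fields. $TG\rightrightarrows TM$ is the tangent groupoid; $T^*G\rightrightarrows A^*$ is the cotangent groupoid, with the unique groupoid structure making the pairing $T^*G\oplus TG\to\mathbb{R}$ a groupoid morphism; $\mathbb{T}G=TG\oplus T^*G\rightrightarrows TM\oplus A^*$, with source and target $\mathsf{s}_{\mathbb{T}G},\mathsf{t}_{\mathbb{T}G}$ and $\mathrm{core}(\mathbb{T}G)=\mathbb{T}G|_M/(TM\oplus A^* )\cong A\oplus T^*M$. **Jet groupoid.** $\widehat{G}=J^1(G)\rightrightarrows M$ consists of subspaces $\widehat{g}\subset T_gG$ complementary to both $\ker(T\mathsf{t})_g$ and $\ker(T\mathsf{s})_g$, with composition induced from $TG$. It acts on $TG$ by $l_{\widehat{g}}(x)=v\circ x$ with the unique $v\in\widehat{g}$ composable with $x$, and $r_{\widehat{g}^{-1}}(x)=x\circ w$ with the unique composable $w\in\widehat g^{-1}$; on $T^*G$ likewise using annihilators; hence on $\mathbb{T}G$. $\mathrm{Ad}_{\widehat{g}}=l_{\widehat{g}}r_{\widehat{g}^{-1}}$ acts on $\mathbb{T}G|_M$, its units and its core (so on $TM,A,A^*,T^*M$). **Courant algebroids.**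 $\mathbb{E}\to M$ is a Courant algebroid with metric, anchor $\mathsf{a}_{\mathbb{E}}$, Dorfman bracket $[\![\cdot,\cdot]\!]$; $\overline{\mathbb{E}}$ has the opposite metric; $\mathsf{a}_{\mathbb{E}}^*\colon T^*M\to\mathbb{E}^*\cong\mathbb{E}$. A Manin pair $(\mathbb{E},A)$ has $A\subset\mathbb{E}$ a Dirac structure (Lagrangian, $\Gamma(A)$ closed under bracket). $\iota_A$ is the inclusion, $\mathrm{pr}_{A^*}\colon\mathbb{E}\to\mathbb{E}/A\cong A^*$. $\mathbb{T}N=TN\oplus T^*N$ is the standard Courant algebroid, with bracket $[X_1,X_2]+\mathcal{L}_{X_1}\mu_2-\iota_{X_2}d\mu_1$. A Courant morphism $R\colon\mathbb{E}_1\dashrightarrow\mathbb{E}_2$ with base map $\Phi$ is a Lagrangian subbundle $R\subset\mathbb{E}_2\times\overline{\mathbb{E}_1}$ along $\mathrm{gr}(\Phi)$, with anchor image tangent to $\mathrm{gr}(\Phi)$, whose extending sections are closed under the bracket; $x_1\sim_Rx_2$ means $(x_2,x_1)\in R$. A morphism of Manin pairs $(\mathbb{E}_1,A_1)\dashrightarrow(\mathbb{E}_2,A_2)$ is a Courant morphism for which each $a_2\in A_2|_{\Phi(m)}$ is $R$-related to a unique $a_1\in A_1|_m$ (for every $m\in M_1$); equivalently $R(A_1)\subseteq A_2$ and $R^{-1}(0)\cap A_1=0$. **Equivariant Manin pairs.** The kernel of $\widehat{G}\to G$ is the bundle of groups $K_m=\{f\in\mathrm{Hom}(T_mM,A_m):\mathrm{id}+\mathsf{a}_Af\text{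 invertible}\}$ ($f$ corresponding to its graph in $T_mM\oplus\ker(T\mathsf{t})_m$); it acts on $\mathbb{E}$ by $\mathrm{Ad}^{\mathbb{E}}_f=(\mathrm{id}+\iota_Af\mathsf{a}_{\mathbb{E}})^{-1}(\mathrm{id}+\mathsf{a}_{\mathbb{E}}^*f^*\mathrm{pr}_{A^*})$. $\widehat{A}=J^1(A)$ is represented on $\mathbb{E}$ by $\nabla_{j^1(\xi)}\zeta=[\![\xi,\zeta]\!]$. A $\widehat{G}$-equivariant Manin pair is a Manin pair with a Lie groupoid $G$ integrating $A$ and an extension of the $\widehat{G}$-action on $A$ to an action $\mathrm{Ad}$ on $\mathbb{E}$ that differentiates to the $\widehat{A}$-action, restricts to the $K$-action, preserves the metric, makes $\mathsf{a}_{\mathbb{E}}$ equivariant, and such that local bisections of $G$ preserve the bracket. **The morphism $R$.** It is the morphism of Manin pairs $R\colon(\mathbb{T}G,TG)\dashrightarrow(\mathbb{E}\times\overline{\mathbb{E}},A\times A)$ with base map $(\mathsf{t},\mathsf{s})$, given for $x\in\mathbb{T}G|_g$ by $x\sim_R(\zeta',\zeta)\Leftrightarrow\mathsf{t}_{\mathbb{T}G}(x)=\alpha(\zeta'),\ \beta([l_{\widehat{g}^{-1}}(x)])=\zeta-\mathrm{Ad}_{\widehat{g}^{-1}}\zeta'$ for any lift $\widehat{g}$ of $g$, where $\beta(a,\nu)=\iota_A(a)-\mathsf{a}_{\mathbb{E}}^*(\nu)$ on $\mathrm{core}(\mathbb{T}G)=A\oplus T^*M$. **Hamiltonian spaces.**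 A Hamiltonian $G$-space for $(\mathbb{E},A)$ is a manifold $P$ with a (left) $G$-action along $\Phi\colon P\to M$, together with a $\widehat{G}$-equivariant morphism of Manin pairs $L\colon(\mathbb{T}P,TP)\dashrightarrow(\mathbb{E},A)$ with base map $\Phi$, such that the $G$-action differentiates to the $A$-action determined by $L$: for $\xi\in A_{\Phi(p)}$, the unique $\xi_P|_p\in T_pP$ with $\xi_P|_p\sim_L\xi$ equals $v^{-1}\cdot0_p$, where $v\in\ker(T\mathsf{t})|_{\Phi(p)}$ represents $\xi$, $v^{-1}$ is its inverse in $TG$, and $\cdot$ is the tangent action. Here $\widehat{g}\in\widehat{G}$ acts on $TP$ by $\widehat{g}\cdot w=v\cdot w$ with the unique $v\in\widehat{g}$ satisfying $T\mathsf{s}(v)=T\Phi(w)$, on $T^*P$ by the dual action, hence on $\mathbb{T}P$. **Action of $\mathbb{T}G$ on $\mathbb{T}P$.** $TG$ acts on $TP$ along $\Phi_{TP}=T\Phi$. $T^*G\rightrightarrows A^*$ acts on $T^*P$ along $\Phi_{T^*P}\colon T^*P\to A^*$, $\langle\Phi_{T^*P}(\mu),\xi\rangle=-\langle\mu,\xi_P|_p\rangle$ for $\mu\in T^*_pP$, by: $\nu'=\mu\cdot\nu$ iff $\langle\nu',w'\rangle=\langle\mu,v\rangle+\langle\nu,w\rangle$ whenever $w'=v\cdot w$ (same base points, $T\mathsf{s}(v)=T\Phi(w)$). Together these give the action of $\mathbb{T}G$ on $\mathbb{T}P$ along $\Phi_{\mathbb{T}P}=(\Phi_{TP},\Phi_{T^*P})$.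 *)

theory Defs
  imports "HOL-Analysis.Analysis"
begin

section \<open>Manifolds\<close>

text \<open>
  All points of a manifold form a type, and every point \<open>p\<close> carries a preferred chart
  \<open>chart M p\<close> with domain \<open>cdom M p\<close>; together these charts are the atlas.
  The tangent space at \<open>p\<close> is identified with the model vector space through the preferred chart
  at \<open>p\<close>, so a tangent vector is a pair of a base point and an element of the model space;
  base points are passed around explicitly.
  Model spaces are finite-dimensional normed spaces (completeness, required by the sort
  \<open>banach\<close>, is then automatic).  The class \<open>euclidean_space\<close> is avoided on purpose, since it
  excludes dimension zero, and with it Lie groups viewed as groupoids over a point.
\<close>

fun Ck_on :: "nat \<Rightarrow> 'a::real_normed_vector set \<Rightarrow> ('a \<Rightarrow> 'b::real_normed_vector) \<Rightarrow> bool" where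
  "Ck_on 0 S f \<longleftrightarrow> continuous_on S f"
| "Ck_on (Suc k) S f \<longleftrightarrow>
     (\<forall>x\<in>S. f differentiable (at x)) \<and> (\<forall>v. Ck_on k S (\<lambda>x. frechet_derivative f (at x) v))"

definition smooth_on :: "'a::real_normed_vector set \<Rightarrow> ('a \<Rightarrow> 'b::real_normed_vector) \<Rightarrow> bool" where
  "smooth_on S f \<longleftrightarrow> (\<forall>k. Ck_on k S f)"

definition finite_dim :: "'a::real_vector itself \<Rightarrow> bool" where
  "finite_dim _ \<longleftrightarrow> (\<exists>B::'a set. finite B \<and> span B = UNIV)"

record ('p, 'a) charted =
  cdom :: "'p \<Rightarrow> 'p set"
  chart :: "'p \<Rightarrow> 'p \<Rightarrow> 'a"

definition chart_inv :: "('p, 'a) charted \<Rightarrow> 'p \<Rightarrow> 'a \<Rightarrow> 'p" where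
  "chart_inv M p = inv_into (cdom M p) (chart M p)"

definition manifold ::
  "('p::{t2_space,second_countable_topology}, 'a::banach) charted \<Rightarrow> bool" where
  "manifold M \<longleftrightarrow>
     finite_dim TYPE('a) \<and>
     (\<forall>p. p \<in> cdom M p \<and> open (cdom M p) \<and> open (chart M p ` cdom M p) \<and>
          homeomorphism (cdom M p) (chart M p ` cdom M p) (chart M p) (chart_inv M p)) \<and>
     (\<forall>p q. smooth_on (chart M p ` (cdom M p \<inter> cdom M q)) (chart M q \<circ> chart_inv M p))"

definition prod_mfd :: "('p, 'a) charted \<Rightarrow> ('q, 'b) charted \<Rightarrow> ('p \<times> 'q, 'a \<times> 'b) charted" where
  "prod_mfd M N = \<lparr>cdom = (\<lambda>(p, q). cdom M p \<times> cdom N q),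
                   chart = (\<lambda>(p, q) (x, y). (chart M p x, chart N q y))\<rparr>"

definition vec_mfd :: "('a, 'a) charted" where
  "vec_mfd = \<lparr>cdom = (\<lambda>_. UNIV), chart = (\<lambda>_ x. x)\<rparr>"

text \<open>
  Smoothness on an arbitrary subset means existence of local smooth extensions.  On open subsets
  and on embedded submanifolds this is the usual notion; it is used for the submanifolds
  \<open>{(g, h). s g = t h}\<close> and \<open>{(g, p). s g = \<Phi> p}\<close>, on which multiplication and action are defined.
\<close>

definition smooth_map_on ::
  "('p::topological_space, 'a::real_normed_vector) charted \<Rightarrow>
   ('q::topological_space, 'b::real_normed_vector) charted \<Rightarrow> 'p set \<Rightarrow> ('p \<Rightarrow> 'q) \<Rightarrow> bool" where
  "smooth_map_on M N S f \<longleftrightarrow>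
     (\<forall>p\<in>S. \<exists>V F. open V \<and> p \<in> V \<and> V \<subseteq> cdom M p \<and> F ` V \<subseteq> cdom N (f p) \<and>
        (\<forall>q\<in>S \<inter> V. F q = f q) \<and>
        smooth_on (chart M p ` V) (chart N (f p) \<circ> F \<circ> chart_inv M p))"

definition has_velocity ::
  "('p::topological_space, 'a::real_normed_vector) charted \<Rightarrow> (real \<Rightarrow> 'p) \<Rightarrow> 'a \<Rightarrow> bool" where
  "has_velocity M \<gamma> v \<longleftrightarrow>
     isCont \<gamma> 0 \<and> (chart M (\<gamma> 0) \<circ> \<gamma> has_vector_derivative v) (at 0)"

text \<open>
  Tangent map of \<open>f : S \<rightarrow> N\<close> for a submanifold \<open>S\<close> of \<open>M\<close>, applied to a vector \<open>v\<close> at \<open>p\<close> that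
  is tangent to \<open>S\<close>.
\<close>

definition tmap_on ::
  "('p::topological_space, 'a::real_normed_vector) charted \<Rightarrow>
   ('q::topological_space, 'b::real_normed_vector) charted \<Rightarrow> 'p set \<Rightarrow> ('p \<Rightarrow> 'q) \<Rightarrow> 'p \<Rightarrow> 'a \<Rightarrow> 'b"
  where
  "tmap_on M N S f p v =
     (THE u. \<exists>\<gamma>. \<gamma> 0 = p \<and> range \<gamma> \<subseteq> S \<and> has_velocity M \<gamma> v \<and> has_velocity N (f \<circ> \<gamma>) u)"

abbreviation "smooth_map M N \<equiv> smooth_map_on M N UNIV"
abbreviation "tmap M N \<equiv> tmap_on M N UNIV"

definition dirv ::
  "('p::topological_space, 'a::real_normed_vector) charted \<Rightarrow> ('p \<Rightarrow> 'b::real_normed_vector) \<Rightarrow>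
   'p \<Rightarrow> 'a \<Rightarrow> 'b" where
  "dirv M f p v = tmap M vec_mfd f p v"

definition submersion where
  "submersion M N f \<longleftrightarrow> smooth_map M N f \<and> (\<forall>p. surj (tmap M N f p))"

section \<open>Vector bundles\<close>

text \<open>
  As a vector space, each fibre is identified with the type \<open>'e\<close> (an arbitrary choice of linear
  isomorphism with the model fibre at each point).  The smooth structure is given by the local
  trivializations \<open>triv V m\<close> over the neighbourhood \<open>tdom V m\<close> of \<open>m\<close>, where \<open>triv V m x\<close> is a
  linear isomorphism from the fibre at \<open>x\<close> to the model fibre.
\<close>

record ('m, 'e) vbundle =
  tdom :: "'m \<Rightarrow> 'm set"
  triv :: "'m \<Rightarrow> 'm \<Rightarrow> 'e \<Rightarrow> 'e"

definition vector_bundle ::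
  "('m::topological_space, 'a::real_normed_vector) charted \<Rightarrow> ('m, 'e::banach) vbundle \<Rightarrow> bool" where
  "vector_bundle M V \<longleftrightarrow>
     finite_dim TYPE('e) \<and>
     (\<forall>m. open (tdom V m) \<and> m \<in> tdom V m \<and>
          (\<forall>x\<in>tdom V m. linear (triv V m x) \<and> bij (triv V m x))) \<and>
     (\<forall>m n e. smooth_map_on M vec_mfd (tdom V m \<inter> tdom V n)
                (\<lambda>x. triv V n x (inv (triv V m x) e)))"

definition smooth_section ::
  "('m::topological_space, 'a::real_normed_vector) charted \<Rightarrow> ('m, 'e::real_normed_vector) vbundle \<Rightarrow>
   'm set \<Rightarrow> ('m \<Rightarrow> 'e) \<Rightarrow> bool" where
  "smooth_section M V U \<sigma> \<longleftrightarrow>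
     (\<forall>m. smooth_map_on M vec_mfd (U \<inter> tdom V m) (\<lambda>x. triv V m x (\<sigma> x)))"

definition pull_bundle :: "('n \<Rightarrow> 'm) \<Rightarrow> ('m, 'e) vbundle \<Rightarrow> ('n, 'e) vbundle" where
  "pull_bundle f V = \<lparr>tdom = (\<lambda>n. f -` tdom V (f n)), triv = (\<lambda>n x. triv V (f n) (f x))\<rparr>"

definition prod_bundle :: "('m, 'e) vbundle \<Rightarrow> ('n, 'f) vbundle \<Rightarrow> ('m \<times> 'n, 'e \<times> 'f) vbundle" where
  "prod_bundle V W = \<lparr>tdom = (\<lambda>(m, n). tdom V m \<times> tdom W n),
                      triv = (\<lambda>(m, n) (x, y) (e, f). (triv V m x e, triv W n y f))\<rparr>"

definition subbundle_along ::
  "('m::topological_space, 'a::real_normed_vector) charted \<Rightarrow> ('m, 'e::real_normed_vector) vbundle \<Rightarrow>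
   'm set \<Rightarrow> ('m \<Rightarrow> 'e set) \<Rightarrow> bool" where
  "subbundle_along M V S R \<longleftrightarrow>
     (\<forall>n\<in>S. \<exists>U (k::nat) \<sigma>. open U \<and> n \<in> U \<and> (\<forall>i<k. smooth_section M V U (\<sigma> i)) \<and>
        (\<forall>x\<in>U \<inter> S. inj_on (\<lambda>i. \<sigma> i x) {..<k} \<and> independent ((\<lambda>i. \<sigma> i x) ` {..<k}) \<and>
                   span ((\<lambda>i. \<sigma> i x) ` {..<k}) = R x))"

definition chart_deriv ::
  "('p::topological_space, 'a::real_normed_vector) charted \<Rightarrow> 'p \<Rightarrow> 'p \<Rightarrow> 'a \<Rightarrow> 'a" where
  "chart_deriv M p q = tmap_on M vec_mfd (cdom M p) (chart M p) q"

definition tangent_bundle ::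
  "('p::topological_space, 'a::real_normed_vector) charted \<Rightarrow> ('p, 'a) vbundle" where
  "tangent_bundle M = \<lparr>tdom = cdom M, triv = chart_deriv M\<rparr>"

type_synonym 'a dual = "'a \<Rightarrow>\<^sub>L real"

definition cov_push :: "('a \<Rightarrow> 'b) \<Rightarrow> 'a::real_normed_vector dual \<Rightarrow> 'b::real_normed_vector dual" where
  "cov_push T \<mu> = (THE \<kappa>. \<forall>v. blinfun_apply \<kappa> (T v) = blinfun_apply \<mu> v)"

definition gen_tangent_bundle ::
  "('p::topological_space, 'a::real_normed_vector) charted \<Rightarrow> ('p, 'a \<times> 'a dual) vbundle" where
  "gen_tangent_bundle M =
     \<lparr>tdom = cdom M,
      triv = (\<lambda>p q (v, \<mu>). (chart_deriv M p q v, cov_push (chart_deriv M p q) \<mu>))\<rparr>"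

section \<open>Courant algebroids\<close>

text \<open>The bracket is only meaningful on smooth (global) sections.\<close>

record ('m, 'v, 'e) courant =
  base :: "('m, 'v) charted"
  vbun :: "('m, 'e) vbundle"
  cmetric :: "'m \<Rightarrow> 'e \<Rightarrow> 'e \<Rightarrow> real"
  canchor :: "'m \<Rightarrow> 'e \<Rightarrow> 'v"
  cbracket :: "('m \<Rightarrow> 'e) \<Rightarrow> ('m \<Rightarrow> 'e) \<Rightarrow> ('m \<Rightarrow> 'e)"

abbreviation csection ::
  "('m::topological_space, 'v::real_normed_vector, 'e::real_normed_vector) courant \<Rightarrow>
   ('m \<Rightarrow> 'e) \<Rightarrow> bool" where
  "csection E \<equiv> smooth_section (base E) (vbun E) UNIV"

text \<open>\<open>coanchor E m\<close> is the map \<open>a\<^sub>E\<^sup>*\<close> from covectors at \<open>m\<close> to the fibre \<open>E\<^sub>m\<close>.\<close>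

definition coanchor :: "('m, 'v, 'e) courant \<Rightarrow> 'm \<Rightarrow> ('v \<Rightarrow> real) \<Rightarrow> 'e" where
  "coanchor E m \<nu> = (THE e. \<forall>e'. cmetric E m e e' = \<nu> (canchor E m e'))"

text \<open>
  The Leibniz rule for the bracket and the fact that the anchor preserves brackets are
  consequences of the axioms below.
\<close>

definition courant_algebroid ::
  "('m::{t2_space,second_countable_topology}, 'v::banach, 'e::banach) courant \<Rightarrow> bool" where
  "courant_algebroid E \<longleftrightarrow>
     manifold (base E) \<and> vector_bundle (base E) (vbun E) \<and>
     (\<forall>m. bilinear (cmetric E m) \<and> (\<forall>x y. cmetric E m x y = cmetric E m y x) \<and>
          (\<forall>x. (\<forall>y. cmetric E m x y = 0) \<longrightarrow> x = 0) \<and> linear (canchor E m)) \<and>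
     (\<forall>\<sigma> \<tau>. csection E \<sigma> \<and> csection E \<tau> \<longrightarrow>
        smooth_map (base E) vec_mfd (\<lambda>m. cmetric E m (\<sigma> m) (\<tau> m)) \<and>
        csection E (cbracket E \<sigma> \<tau>)) \<and>
     (\<forall>\<sigma>. csection E \<sigma> \<longrightarrow>
        smooth_section (base E) (tangent_bundle (base E)) UNIV (\<lambda>m. canchor E m (\<sigma> m))) \<and>
     (\<forall>\<sigma> \<tau> \<upsilon> a b. csection E \<sigma> \<and> csection E \<tau> \<and> csection E \<upsilon> \<longrightarrow>
        cbracket E (\<lambda>m. a *\<^sub>R \<sigma> m + b *\<^sub>R \<tau> m) \<upsilon> =
          (\<lambda>m. a *\<^sub>R cbracket E \<sigma> \<upsilon> m + b *\<^sub>R cbracket E \<tau> \<upsilon> m) \<and>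
        cbracket E \<upsilon> (\<lambda>m. a *\<^sub>R \<sigma> m + b *\<^sub>R \<tau> m) =
          (\<lambda>m. a *\<^sub>R cbracket E \<upsilon> \<sigma> m + b *\<^sub>R cbracket E \<upsilon> \<tau> m)) \<and>
     (\<forall>\<sigma> \<tau> \<upsilon> m. csection E \<sigma> \<and> csection E \<tau> \<and> csection E \<upsilon> \<longrightarrow>
        cbracket E \<sigma> (cbracket E \<tau> \<upsilon>) m =
          cbracket E (cbracket E \<sigma> \<tau>) \<upsilon> m + cbracket E \<tau> (cbracket E \<sigma> \<upsilon>) m \<and>
        dirv (base E) (\<lambda>x. cmetric E x (\<tau> x) (\<upsilon> x)) m (canchor E m (\<sigma> m)) =
          cmetric E m (cbracket E \<sigma> \<tau> m) (\<upsilon> m) + cmetric E m (\<tau> m) (cbracket E \<sigma> \<upsilon> m) \<and>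
        cbracket E \<sigma> \<tau> m + cbracket E \<tau> \<sigma> m =
          coanchor E m (dirv (base E) (\<lambda>x. cmetric E x (\<sigma> x) (\<tau> x)) m))"

definition courant_opp :: "('m, 'v, 'e) courant \<Rightarrow> ('m, 'v, 'e) courant" where
  "courant_opp E = E\<lparr>cmetric := (\<lambda>m x y. - cmetric E m x y)\<rparr>"

text \<open>
  The bracket of the product \<open>E \<times> F\<close> is the unique Courant bracket that is componentwise on
  sections pulled back from the factors.  For sections \<open>\<sigma> = (\<sigma>\<^sub>1, \<sigma>\<^sub>2)\<close> and \<open>\<tau> = (\<tau>\<^sub>1, \<tau>\<^sub>2)\<close>
  depending on both variables, the rules \<open>[\<sigma>, f \<tau>] = f [\<sigma>, \<tau>] + (a(\<sigma>) f) \<tau>\<close> and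
  \<open>[f \<sigma>, \<tau>] = f [\<sigma>, \<tau>] - (a(\<tau>) f) \<sigma> + \<langle>\<sigma>, \<tau>\<rangle> a\<^sup>* df\<close> produce the terms below; for instance
  \<open>\<sigma>\<^sub>1(m, \<cdot>)\<close> is a function with values in the fixed vector space \<open>E\<^sub>m\<close>, which is differentiated
  along the anchor of \<open>F\<close>.
\<close>

definition courant_prod ::
  "('m::topological_space, 'v::real_normed_vector, 'e::real_normed_vector) courant \<Rightarrow>
   ('n::topological_space, 'w::real_normed_vector, 'f::real_normed_vector) courant \<Rightarrow>
   ('m \<times> 'n, 'v \<times> 'w, 'e \<times> 'f) courant" where
  "courant_prod E F =
     \<lparr>base = prod_mfd (base E) (base F),
      vbun = prod_bundle (vbun E) (vbun F),
      cmetric = (\<lambda>(m, n) (x, y) (x', y'). cmetric E m x x' + cmetric F n y y'),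
      canchor = (\<lambda>(m, n) (x, y). (canchor E m x, canchor F n y)),
      cbracket = (\<lambda>\<sigma> \<tau> (m, n).
        (cbracket E (\<lambda>m'. fst (\<sigma> (m', n))) (\<lambda>m'. fst (\<tau> (m', n))) m
           + dirv (base F) (\<lambda>n'. fst (\<tau> (m, n'))) n (canchor F n (snd (\<sigma> (m, n))))
           - dirv (base F) (\<lambda>n'. fst (\<sigma> (m, n'))) n (canchor F n (snd (\<tau> (m, n))))
           + coanchor E m (\<lambda>v. cmetric F n (dirv (base E) (\<lambda>m'. snd (\<sigma> (m', n))) m v)
                                 (snd (\<tau> (m, n)))),
         cbracket F (\<lambda>n'. snd (\<sigma> (m, n'))) (\<lambda>n'. snd (\<tau> (m, n'))) n
           + dirv (base E) (\<lambda>m'. snd (\<tau> (m', n))) m (canchor E m (fst (\<sigma> (m, n))))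
           - dirv (base E) (\<lambda>m'. snd (\<sigma> (m', n))) m (canchor E m (fst (\<tau> (m, n))))
           + coanchor F n (\<lambda>w. cmetric E m (dirv (base F) (\<lambda>n'. fst (\<sigma> (m, n'))) n w)
                                 (fst (\<tau> (m, n))))))\<rparr>"

subsection \<open>The standard Courant algebroid\<close>

text \<open>
  Lie bracket, Lie derivative of one-forms and contraction of the exterior derivative are
  evaluated at \<open>p\<close> by their coordinate formulas in the preferred chart at \<open>p\<close>, in which the
  tangent space at \<open>p\<close> is the model space itself.
\<close>

definition vf_rep ::
  "('p::topological_space, 'a::real_normed_vector) charted \<Rightarrow> 'p \<Rightarrow> ('p \<Rightarrow> 'a) \<Rightarrow> 'a \<Rightarrow> 'a" where
  "vf_rep M p X x = chart_deriv M p (chart_inv M p x) (X (chart_inv M p x))"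

definition form_rep ::
  "('p::topological_space, 'a::real_normed_vector) charted \<Rightarrow> 'p \<Rightarrow> ('p \<Rightarrow> 'a dual) \<Rightarrow> 'a \<Rightarrow> 'a dual"
  where
  "form_rep M p \<mu> x = cov_push (chart_deriv M p (chart_inv M p x)) (\<mu> (chart_inv M p x))"

definition vf_deriv where
  "vf_deriv M p X v = frechet_derivative (vf_rep M p X) (at (chart M p p)) v"

definition form_deriv where
  "form_deriv M p \<mu> v = frechet_derivative (form_rep M p \<mu>) (at (chart M p p)) v"

definition lie_bracket ::
  "('p::topological_space, 'a::real_normed_vector) charted \<Rightarrow> ('p \<Rightarrow> 'a) \<Rightarrow> ('p \<Rightarrow> 'a) \<Rightarrow> 'p \<Rightarrow> 'a"
  where
  "lie_bracket M X Y p = vf_deriv M p Y (X p) - vf_deriv M p X (Y p)"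

definition lie_derivative ::
  "('p::topological_space, 'a::real_normed_vector) charted \<Rightarrow> ('p \<Rightarrow> 'a) \<Rightarrow> ('p \<Rightarrow> 'a dual) \<Rightarrow>
   'p \<Rightarrow> 'a dual" where
  "lie_derivative M X \<mu> p =
     (THE \<kappa>. \<forall>z. blinfun_apply \<kappa> z =
        blinfun_apply (form_deriv M p \<mu> (X p)) z + blinfun_apply (\<mu> p) (vf_deriv M p X z))"

definition contract_d ::
  "('p::topological_space, 'a::real_normed_vector) charted \<Rightarrow> ('p \<Rightarrow> 'a) \<Rightarrow> ('p \<Rightarrow> 'a dual) \<Rightarrow>
   'p \<Rightarrow> 'a dual" where
  "contract_d M X \<mu> p =
     (THE \<kappa>. \<forall>z. blinfun_apply \<kappa> z =
        blinfun_apply (form_deriv M p \<mu> (X p)) z - blinfun_apply (form_deriv M p \<mu> z) (X p))"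

definition std_courant ::
  "('p::topological_space, 'a::real_normed_vector) charted \<Rightarrow> ('p, 'a, 'a \<times> 'a dual) courant" where
  "std_courant M =
     \<lparr>base = M,
      vbun = gen_tangent_bundle M,
      cmetric = (\<lambda>_ (v, \<mu>) (w, \<nu>). blinfun_apply \<mu> w + blinfun_apply \<nu> v),
      canchor = (\<lambda>_. fst),
      cbracket = (\<lambda>\<sigma> \<tau> p.
        (lie_bracket M (fst \<circ> \<sigma>) (fst \<circ> \<tau>) p,
         lie_derivative M (fst \<circ> \<sigma>) (snd \<circ> \<tau>) p - contract_d M (fst \<circ> \<tau>) (snd \<circ> \<sigma>) p))\<rparr>"

subsection \<open>Manin pairs and their morphisms\<close>

definition lagrangian :: "('m, 'v, 'e::real_vector) courant \<Rightarrow> 'm \<Rightarrow> 'e set \<Rightarrow> bool" where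
  "lagrangian E m L \<longleftrightarrow> subspace L \<and> L = {x. \<forall>y\<in>L. cmetric E m x y = 0}"

definition dirac ::
  "('m::topological_space, 'v::real_normed_vector, 'e::real_normed_vector) courant \<Rightarrow>
   ('m \<Rightarrow> 'e set) \<Rightarrow> bool" where
  "dirac E A \<longleftrightarrow>
     subbundle_along (base E) (vbun E) UNIV A \<and> (\<forall>m. lagrangian E m (A m)) \<and>
     (\<forall>\<sigma> \<tau>. csection E \<sigma> \<and> csection E \<tau> \<and> (\<forall>m. \<sigma> m \<in> A m) \<and> (\<forall>m. \<tau> m \<in> A m) \<longrightarrow>
        (\<forall>m. cbracket E \<sigma> \<tau> m \<in> A m))"

definition manin_pair where
  "manin_pair E A \<longleftrightarrow> courant_algebroid E \<and> dirac E A"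

text \<open>
  A Courant morphism from \<open>E\<^sub>1\<close> to \<open>E\<^sub>2\<close> is given by its fibres \<open>R m \<subseteq> E\<^sub>2 \<times> E\<^sub>1\<close> over the points
  \<open>(\<Phi> m, m)\<close> of the graph of \<open>\<Phi>\<close>.
\<close>

definition courant_morphism ::
  "('m::topological_space, 'v::real_normed_vector, 'e::real_normed_vector) courant \<Rightarrow>
   ('n::topological_space, 'w::real_normed_vector, 'f::real_normed_vector) courant \<Rightarrow>
   ('m \<Rightarrow> 'n) \<Rightarrow> ('m \<Rightarrow> ('f \<times> 'e) set) \<Rightarrow> bool" where
  "courant_morphism E1 E2 \<Phi> R \<longleftrightarrow>
     smooth_map (base E1) (base E2) \<Phi> \<and>
     (let V = courant_prod E2 (courant_opp E1) in
        subbundle_along (base V) (vbun V) (range (\<lambda>m. (\<Phi> m, m))) (\<lambda>n. R (snd n)) \<and>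
        (\<forall>m. lagrangian V (\<Phi> m, m) (R m)) \<and>
        (\<forall>m. \<forall>x\<in>R m. \<exists>v. canchor V (\<Phi> m, m) x = (tmap (base E1) (base E2) \<Phi> m v, v)) \<and>
        (\<forall>\<sigma> \<tau>. csection V \<sigma> \<and> csection V \<tau> \<and>
           (\<forall>m. \<sigma> (\<Phi> m, m) \<in> R m) \<and> (\<forall>m. \<tau> (\<Phi> m, m) \<in> R m) \<longrightarrow>
           (\<forall>m. cbracket V \<sigma> \<tau> (\<Phi> m, m) \<in> R m)))"

definition manin_morphism where
  "manin_morphism E1 A1 E2 A2 \<Phi> R \<longleftrightarrow>
     courant_morphism E1 E2 \<Phi> R \<and>
     (\<forall>m. \<forall>a2\<in>A2 (\<Phi> m). \<exists>!a1. a1 \<in> A1 m \<and> (a2, a1) \<in> R m)"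

section \<open>Lie groupoids\<close>

record ('g, 'u, 'm, 'v) groupoid =
  arrows :: "('g, 'u) charted"
  objects :: "('m, 'v) charted"
  src :: "'g \<Rightarrow> 'm"
  tgt :: "'g \<Rightarrow> 'm"
  mul :: "'g \<Rightarrow> 'g \<Rightarrow> 'g"
  one :: "'m \<Rightarrow> 'g"
  ginv :: "'g \<Rightarrow> 'g"

definition composable :: "('g, 'u, 'm, 'v) groupoid \<Rightarrow> ('g \<times> 'g) set" where
  "composable G = {(g, h). src G g = tgt G h}"

definition lie_groupoid ::
  "('g::{t2_space,second_countable_topology}, 'u::banach,
    'm::{t2_space,second_countable_topology}, 'v::banach) groupoid \<Rightarrow> bool" where
  "lie_groupoid G \<longleftrightarrow>
     manifold (arrows G) \<and> manifold (objects G) \<and>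
     submersion (arrows G) (objects G) (src G) \<and> submersion (arrows G) (objects G) (tgt G) \<and>
     smooth_map (objects G) (arrows G) (one G) \<and> smooth_map (arrows G) (arrows G) (ginv G) \<and>
     smooth_map_on (prod_mfd (arrows G) (arrows G)) (arrows G) (composable G)
       (\<lambda>(g, h). mul G g h) \<and>
     (\<forall>m. src G (one G m) = m \<and> tgt G (one G m) = m) \<and>
     (\<forall>g h. src G g = tgt G h \<longrightarrow>
        src G (mul G g h) = src G h \<and> tgt G (mul G g h) = tgt G g) \<and>
     (\<forall>g h k. src G g = tgt G h \<and> src G h = tgt G k \<longrightarrow>
        mul G (mul G g h) k = mul G g (mul G h k)) \<and>
     (\<forall>g. mul G (one G (tgt G g)) g = g \<and> mul G g (one G (src G g)) = g) \<and>
     (\<forall>g. src G (ginv G g) = tgt G g \<and> tgt G (ginv G g) = src G g \<and>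
        mul G g (ginv G g) = one G (tgt G g) \<and> mul G (ginv G g) g = one G (src G g))"

subsection \<open>The tangent groupoid and the Lie algebroid\<close>

definition tsrc where "tsrc G g v = tmap (arrows G) (objects G) (src G) g v"
definition ttgt where "ttgt G g v = tmap (arrows G) (objects G) (tgt G) g v"
definition tone where "tone G m v = tmap (objects G) (arrows G) (one G) m v"
definition tinv where "tinv G g v = tmap (arrows G) (arrows G) (ginv G) g v"

text \<open>Composition of \<open>v \<in> T\<^sub>gG\<close> and \<open>w \<in> T\<^sub>hG\<close>, the result being tangent at \<open>g \<circ> h\<close>.\<close>

definition tmul ::
  "('g::topological_space, 'u::real_normed_vector, 'm, 'v) groupoid \<Rightarrow> 'g \<Rightarrow> 'u \<Rightarrow> 'g \<Rightarrow> 'u \<Rightarrow> 'u" where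
  "tmul G g v h w =
     tmap_on (prod_mfd (arrows G) (arrows G)) (arrows G) (composable G)
       (\<lambda>(g, h). mul G g h) (g, h) (v, w)"

definition LieA ::
  "('g::topological_space, 'u::real_normed_vector, 'm::topological_space, 'v::real_normed_vector)
   groupoid \<Rightarrow> 'm \<Rightarrow> 'u set" where
  "LieA G m = {v. ttgt G (one G m) v = 0}"

text \<open>On \<open>ker (Tt)\<close> the anchor \<open>Ts - Tt\<close> is \<open>Ts\<close>.\<close>

definition lie_anchor where "lie_anchor G m \<xi> = tsrc G (one G m) \<xi>"

text \<open>The representative in \<open>ker (Tt)\<close> of the class of \<open>v \<in> TG|\<^sub>M\<close> modulo \<open>TM\<close>.\<close>

definition lie_class where "lie_class G m v = v - tone G m (ttgt G (one G m) v)"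

definition lie_section ::
  "('g::topological_space, 'u::real_normed_vector, 'm::topological_space, 'v::real_normed_vector)
   groupoid \<Rightarrow> ('m \<Rightarrow> 'u) \<Rightarrow> bool" where
  "lie_section G \<xi> \<longleftrightarrow>
     (\<forall>m. \<xi> m \<in> LieA G m) \<and>
     smooth_section (objects G) (pull_bundle (one G) (tangent_bundle (arrows G))) UNIV \<xi>"

definition left_inv where "left_inv G \<xi> g = tmul G g 0 (one G (src G g)) (\<xi> (src G g))"

definition lieA_bracket where
  "lieA_bracket G \<xi> \<eta> m = lie_bracket (arrows G) (left_inv G \<xi>) (left_inv G \<eta>) (one G m)"

subsection \<open>The cotangent groupoid\<close>

text \<open>
  The fibre of \<open>A\<^sup>*\<close> at \<open>m\<close> is the annihilator of \<open>TM\<close> in \<open>T\<^sup>*G|\<^sub>M\<close>, i.e. the dual of \<open>TG|\<^sub>M/TM\<close>;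
  these covectors are the units of the cotangent groupoid.  Source, target and composition are
  determined by \<open>\<langle>\<mu> \<circ> \<nu>, v \<circ> w\<rangle> = \<langle>\<mu>, v\<rangle> + \<langle>\<nu>, w\<rangle>\<close> for composable \<open>v, w\<close>.
\<close>

definition A_dual ::
  "('g::topological_space, 'u::real_normed_vector, 'm::topological_space, 'v::real_normed_vector)
   groupoid \<Rightarrow> 'm \<Rightarrow> 'u dual set" where
  "A_dual G m = {\<phi>. \<forall>w. blinfun_apply \<phi> (tone G m w) = 0}"

definition csrc where
  "csrc G g \<mu> = (THE \<phi>. \<phi> \<in> A_dual G (src G g) \<and>
     (\<forall>v w. tsrc G g v = ttgt G (one G (src G g)) w \<longrightarrow>
        blinfun_apply \<mu> (tmul G g v (one G (src G g)) w) = blinfun_apply \<mu> v + blinfun_apply \<phi> w))"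

definition ctgt where
  "ctgt G g \<mu> = (THE \<phi>. \<phi> \<in> A_dual G (tgt G g) \<and>
     (\<forall>v w. tsrc G (one G (tgt G g)) w = ttgt G g v \<longrightarrow>
        blinfun_apply \<mu> (tmul G (one G (tgt G g)) w g v) = blinfun_apply \<phi> w + blinfun_apply \<mu> v))"

definition cmul where
  "cmul G g \<mu> h \<nu> = (THE \<kappa>. \<forall>v w. tsrc G g v = ttgt G h w \<longrightarrow>
     blinfun_apply \<kappa> (tmul G g v h w) = blinfun_apply \<mu> v + blinfun_apply \<nu> w)"

text \<open>The element of \<open>A\<^sup>*\<close> with prescribed values on \<open>ker (Tt)|\<^sub>M\<close>.\<close>

definition A_dual_of where
  "A_dual_of G m F =
     (THE \<phi>. \<phi> \<in> A_dual G m \<and> (\<forall>\<xi>\<in>LieA G m. blinfun_apply \<phi> \<xi> = F \<xi>))"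

definition TTsrc where "TTsrc G g x = (tsrc G g (fst x), csrc G g (snd x))"
definition TTtgt where "TTtgt G g x = (ttgt G g (fst x), ctgt G g (snd x))"

text \<open>
  The class of \<open>x \<in> \<T>G|\<^sub>m\<close> in \<open>core(\<T>G) = A \<oplus> T\<^sup>*M\<close>; the covector part is the restriction to
  \<open>TM\<close>, whose kernel is \<open>A\<^sup>*\<close>.
\<close>

definition core_class ::
  "('g::topological_space, 'u::real_normed_vector, 'm::topological_space, 'v::real_normed_vector)
   groupoid \<Rightarrow> 'm \<Rightarrow> 'u \<times> 'u dual \<Rightarrow> 'u \<times> ('v \<Rightarrow> real)" where
  "core_class G m x = (lie_class G m (fst x), (\<lambda>w. blinfun_apply (snd x) (tone G m w)))"

subsection \<open>The jet groupoid\<close>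

definition complementary :: "'a::real_vector set \<Rightarrow> 'a set \<Rightarrow> bool" where
  "complementary H K \<longleftrightarrow> H \<inter> K = {0} \<and> (\<forall>x. \<exists>h\<in>H. \<exists>k\<in>K. x = h + k)"

text \<open>\<open>jet G g H\<close>: the subspace \<open>H \<subseteq> T\<^sub>gG\<close> is an element of \<open>J\<^sup>1(G)\<close> lying over \<open>g\<close>.\<close>

definition jet ::
  "('g::topological_space, 'u::real_normed_vector, 'm::topological_space, 'v::real_normed_vector)
   groupoid \<Rightarrow> 'g \<Rightarrow> 'u set \<Rightarrow> bool" where
  "jet G g H \<longleftrightarrow> subspace H \<and> complementary H {v. ttgt G g v = 0} \<and>
     complementary H {v. tsrc G g v = 0}"

definition jmul where
  "jmul G g H h K = {tmul G g v h w |v w. v \<in> H \<and> w \<in> K \<and> tsrc G g v = ttgt G h w}"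

definition jone where "jone G m = range (tone G m)"

definition jinv where "jinv G g H = tinv G g ` H"

definition ann :: "'a::real_normed_vector set \<Rightarrow> 'a dual set" where
  "ann H = {\<mu>. \<forall>v\<in>H. blinfun_apply \<mu> v = 0}"

definition jleft_T where
  "jleft_T G g H h x = tmul G g (THE v. v \<in> H \<and> tsrc G g v = ttgt G h x) h x"

definition jright_T where
  "jright_T G k W h x = tmul G h x k (THE w. w \<in> W \<and> tsrc G h x = ttgt G k w)"

definition jleft_C where
  "jleft_C G g H h \<mu> = cmul G g (THE \<nu>. \<nu> \<in> ann H \<and> csrc G g \<nu> = ctgt G h \<mu>) h \<mu>"

definition jleft_TT where
  "jleft_TT G g H h x = (jleft_T G g H h (fst x), jleft_C G g H h (snd x))"

text \<open>\<open>Ad\<close> of a jet \<open>H\<close> over \<open>g\<close> on \<open>TG|\<^sub>M\<close>, and the induced action on the units \<open>TM\<close>.\<close>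

definition jAd_T where
  "jAd_T G g H x =
     jleft_T G g H (mul G (one G (src G g)) (ginv G g))
       (jright_T G (ginv G g) (jinv G g H) (one G (src G g)) x)"

definition jAd_TM where
  "jAd_TM G g H v = (THE v'. tone G (tgt G g) v' = jAd_T G g H (tone G (src G g) v))"

definition jAd_A where
  "jAd_A G g H \<xi> = lie_class G (tgt G g) (jAd_T G g H \<xi>)"

definition local_bisection where
  "local_bisection G U b \<longleftrightarrow>
     open U \<and> smooth_map_on (objects G) (arrows G) U b \<and> (\<forall>m\<in>U. tgt G (b m) = m) \<and>
     inj_on (src G \<circ> b) U \<and>
     (\<forall>m\<in>U. jet G (b m) (range (tmap_on (objects G) (arrows G) U b m)))"

section \<open>Equivariant Manin pairs\<close>

text \<open>
  The isomorphism of the Lie algebroid of \<open>G\<close> with \<open>A\<close> is recorded as the map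
  \<open>\<iota> m : ker (Tt) at 1\<^sub>m \<rightarrow> E\<^sub>m\<close> with image \<open>A m\<close>; it plays the role of \<open>\<iota>\<^sub>A\<close>.
\<close>

definition integrates ::
  "('m::topological_space, 'v::real_normed_vector, 'e::real_normed_vector) courant \<Rightarrow>
   ('m \<Rightarrow> 'e set) \<Rightarrow> ('g::topological_space, 'u::real_normed_vector, 'm, 'v) groupoid \<Rightarrow>
   ('m \<Rightarrow> 'u \<Rightarrow> 'e) \<Rightarrow> bool" where
  "integrates E A G \<iota> \<longleftrightarrow>
     objects G = base E \<and>
     (\<forall>m. bij_betw (\<iota> m) (LieA G m) (A m) \<and>
       (\<forall>\<xi>\<in>LieA G m. \<forall>\<eta>\<in>LieA G m. \<forall>a b. \<iota> m (a *\<^sub>R \<xi> + b *\<^sub>R \<eta>) = a *\<^sub>R \<iota> m \<xi> + b *\<^sub>R \<iota> m \<eta>) \<and>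
       (\<forall>\<xi>\<in>LieA G m. canchor E m (\<iota> m \<xi>) = lie_anchor G m \<xi>)) \<and>
     (\<forall>\<xi>. (\<forall>m. \<xi> m \<in> LieA G m) \<longrightarrow> (lie_section G \<xi> \<longleftrightarrow> csection E (\<lambda>m. \<iota> m (\<xi> m)))) \<and>
     (\<forall>\<xi> \<eta> m. lie_section G \<xi> \<and> lie_section G \<eta> \<longrightarrow>
        \<iota> m (lieA_bracket G \<xi> \<eta> m) = cbracket E (\<lambda>x. \<iota> x (\<xi> x)) (\<lambda>x. \<iota> x (\<eta> x)) m)"

definition pr_A_dual where
  "pr_A_dual E G \<iota> m \<zeta> = A_dual_of G m (\<lambda>\<xi>. cmetric E m \<zeta> (\<iota> m \<xi>))"

text \<open>\<open>Ad g H : E\<^sub>s\<^sub>(\<^sub>g\<^sub>) \<rightarrow> E\<^sub>t\<^sub>(\<^sub>g\<^sub>)\<close> for a jet \<open>H\<close> over \<open>g\<close>; other arguments are irrelevant.\<close>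

definition jet_action ::
  "('m::topological_space, 'v::real_normed_vector, 'e::real_normed_vector) courant \<Rightarrow>
   ('g::topological_space, 'u::real_normed_vector, 'm, 'v) groupoid \<Rightarrow>
   ('g \<Rightarrow> 'u set \<Rightarrow> 'e \<Rightarrow> 'e) \<Rightarrow> bool" where
  "jet_action E G Ad \<longleftrightarrow>
     (\<forall>g H. jet G g H \<longrightarrow> linear (Ad g H)) \<and>
     (\<forall>m \<zeta>. Ad (one G m) (jone G m) \<zeta> = \<zeta>) \<and>
     (\<forall>g H h K \<zeta>. jet G g H \<and> jet G h K \<and> src G g = tgt G h \<longrightarrow>
        Ad (mul G g h) (jmul G g H h K) \<zeta> = Ad g H (Ad h K \<zeta>))"

text \<open>
  Smoothness of the action map.  Near \<open>g\<^sub>0\<close>, jets over \<open>g\<close> are ranges of linear maps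
  \<open>k\<close> from the model of \<open>M\<close> to that of \<open>G\<close>, in the trivialization of \<open>TG\<close> at \<open>g\<^sub>0\<close>; the pairs
  \<open>(g, k)\<close> whose range is a jet form an open set, which submerses onto an open subset of \<open>J\<^sup>1(G)\<close>.
\<close>

definition framed_jet where
  "framed_jet G g0 g k = range (\<lambda>w. inv (chart_deriv (arrows G) g0 g) (blinfun_apply k w))"

definition jet_action_smooth ::
  "('m::topological_space, 'v::real_normed_vector, 'e::real_normed_vector) courant \<Rightarrow>
   ('g::topological_space, 'u::real_normed_vector, 'm, 'v) groupoid \<Rightarrow>
   ('g \<Rightarrow> 'u set \<Rightarrow> 'e \<Rightarrow> 'e) \<Rightarrow> bool" where
  "jet_action_smooth E G Ad \<longleftrightarrow>
     (\<forall>g0 \<zeta>. smooth_map_on (prod_mfd (arrows G) (vec_mfd :: ('v \<Rightarrow>\<^sub>L 'u, 'v \<Rightarrow>\<^sub>L 'u) charted)) vec_mfd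
        {(g, k). g \<in> cdom (arrows G) g0 \<and> tgt G g \<in> tdom (vbun E) (tgt G g0) \<and>
                 src G g \<in> tdom (vbun E) (src G g0) \<and> jet G g (framed_jet G g0 g k)}
        (\<lambda>(g, k). triv (vbun E) (tgt G g0) (tgt G g)
           (Ad g (framed_jet G g0 g k) (inv (triv (vbun E) (src G g0) (src G g)) \<zeta>))))"

text \<open>
  The \<open>J\<^sup>1(G)\<close>-action differentiates to \<open>\<nabla>\<^bsub>j\<^sup>1(\<xi>)\<^esub> \<zeta> = [\<xi>, \<zeta>]\<close>: if \<open>b\<^sub>\<tau>\<close> is a smooth family of sections
  of the target map with \<open>b\<^sub>0\<close> the units and \<open>d/d\<tau> b\<^sub>\<tau> = \<xi>\<close> at \<open>\<tau> = 0\<close>, then \<open>j\<^sup>1\<^sub>m(b\<^sub>\<tau>)\<close> is a curve in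
  the target fibre of \<open>J\<^sup>1(G)\<close> over \<open>m\<close> whose velocity is the element \<open>j\<^sup>1\<^sub>m(\<xi>)\<close> of the Lie algebroid
  \<open>J\<^sup>1(A)\<close>.
\<close>

definition differentiates_to_bracket ::
  "('m::topological_space, 'v::real_normed_vector, 'e::real_normed_vector) courant \<Rightarrow>
   ('g::topological_space, 'u::real_normed_vector, 'm, 'v) groupoid \<Rightarrow>
   ('m \<Rightarrow> 'u \<Rightarrow> 'e) \<Rightarrow> ('g \<Rightarrow> 'u set \<Rightarrow> 'e \<Rightarrow> 'e) \<Rightarrow> bool" where
  "differentiates_to_bracket E G \<iota> Ad \<longleftrightarrow>
     (\<forall>\<xi> U \<epsilon> (b :: real \<Rightarrow> 'm \<Rightarrow> 'g) \<zeta>.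
        lie_section G \<xi> \<and> open U \<and> \<epsilon> > 0 \<and>
        smooth_map_on (prod_mfd vec_mfd (objects G)) (arrows G) ({-\<epsilon><..<\<epsilon>} \<times> U)
          (\<lambda>(\<tau>, m). b \<tau> m) \<and>
        (\<forall>\<tau>\<in>{-\<epsilon><..<\<epsilon>}. \<forall>m\<in>U. tgt G (b \<tau> m) = m) \<and>
        (\<forall>m\<in>U. b 0 m = one G m \<and> has_velocity (arrows G) (\<lambda>\<tau>. b \<tau> m) (\<xi> m)) \<and>
        csection E \<zeta> \<longrightarrow>
        (\<forall>m\<in>U. ((\<lambda>\<tau>. Ad (b \<tau> m) (range (tmap_on (objects G) (arrows G) U (b \<tau>) m))
                         (\<zeta> (src G (b \<tau> m))))
            has_vector_derivative cbracket E (\<lambda>x. \<iota> x (\<xi> x)) \<zeta> m) (at 0)))"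

text \<open>
  \<open>(id + \<iota>\<^sub>A f a\<^sub>E)\<^sup>-\<^sup>1 (id + a\<^sub>E\<^sup>* f\<^sup>* pr)\<close>, where \<open>f\<close> is an element of \<open>K\<^sub>m\<close>.
\<close>

definition K_group where
  "K_group G m = {f. linear f \<and> range f \<subseteq> LieA G m \<and> bij (\<lambda>w. w + lie_anchor G m (f w))}"

definition K_action where
  "K_action E G \<iota> m f \<zeta> =
     inv (\<lambda>\<eta>. \<eta> + \<iota> m (f (canchor E m \<eta>)))
       (\<zeta> + coanchor E m (\<lambda>w. blinfun_apply (pr_A_dual E G \<iota> m \<zeta>) (f w)))"

text \<open>
  Preservation of the bracket by a local bisection \<open>b\<close> is stated for global sections that are
  related by \<open>b\<close> over its domain \<open>U\<close>; brackets are local, and germs of sections extend globally.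
\<close>

definition bisections_preserve_bracket ::
  "('m::topological_space, 'v::real_normed_vector, 'e::real_normed_vector) courant \<Rightarrow>
   ('g::topological_space, 'u::real_normed_vector, 'm, 'v) groupoid \<Rightarrow>
   ('g \<Rightarrow> 'u set \<Rightarrow> 'e \<Rightarrow> 'e) \<Rightarrow> bool" where
  "bisections_preserve_bracket E G Ad \<longleftrightarrow>
     (\<forall>U b \<sigma> \<tau> \<sigma>' \<tau>'.
        let AdU = (\<lambda>\<rho> m. Ad (b m) (range (tmap_on (objects G) (arrows G) U b m)) (\<rho> (src G (b m))))
        in local_bisection G U b \<and>
           csection E \<sigma> \<and> csection E \<tau> \<and> csection E \<sigma>' \<and> csection E \<tau>' \<and>
           (\<forall>m\<in>U. \<sigma>' m = AdU \<sigma> m \<and> \<tau>' m = AdU \<tau> m) \<longrightarrow>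
           (\<forall>m\<in>U. cbracket E \<sigma>' \<tau>' m = AdU (cbracket E \<sigma> \<tau>) m))"

definition equivariant_manin_pair ::
  "('m::{t2_space,second_countable_topology}, 'v::banach, 'e::banach) courant \<Rightarrow> ('m \<Rightarrow> 'e set) \<Rightarrow>
   ('g::{t2_space,second_countable_topology}, 'u::banach, 'm, 'v) groupoid \<Rightarrow>
   ('m \<Rightarrow> 'u \<Rightarrow> 'e) \<Rightarrow> ('g \<Rightarrow> 'u set \<Rightarrow> 'e \<Rightarrow> 'e) \<Rightarrow> bool" where
  "equivariant_manin_pair E A G \<iota> Ad \<longleftrightarrow>
     manin_pair E A \<and> lie_groupoid G \<and> integrates E A G \<iota> \<and>
     jet_action E G Ad \<and> jet_action_smooth E G Ad \<and>
     (\<forall>g H. jet G g H \<longrightarrow>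
        (\<forall>\<xi>\<in>LieA G (src G g). Ad g H (\<iota> (src G g) \<xi>) = \<iota> (tgt G g) (jAd_A G g H \<xi>)) \<and>
        (\<forall>\<zeta> \<eta>. cmetric E (tgt G g) (Ad g H \<zeta>) (Ad g H \<eta>) = cmetric E (src G g) \<zeta> \<eta>) \<and>
        (\<forall>\<zeta>. canchor E (tgt G g) (Ad g H \<zeta>) = jAd_TM G g H (canchor E (src G g) \<zeta>))) \<and>
     differentiates_to_bracket E G \<iota> Ad \<and>
     (\<forall>m. \<forall>f\<in>K_group G m. \<forall>\<zeta>.
        Ad (one G m) (range (\<lambda>w. tone G m w + f w)) \<zeta> = K_action E G \<iota> m f \<zeta>) \<and>
     bisections_preserve_bracket E G Ad"

definition alpha where
  "alpha E G \<iota> m \<zeta> = (canchor E m \<zeta>, - pr_A_dual E G \<iota> m \<zeta>)"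

definition beta where
  "beta E \<iota> m c = \<iota> m (fst c) - coanchor E m (snd c)"

text \<open>
  The relation \<open>x \<sim>\<^sub>R (\<zeta>', \<zeta>)\<close> for \<open>x \<in> \<T>G|\<^sub>g\<close>.  The condition does not depend on the choice of the
  lift \<open>H\<close> of \<open>g\<close>.
\<close>

definition rel_R where
  "rel_R E G \<iota> Ad g x \<zeta>' \<zeta> \<longleftrightarrow>
     TTtgt G g x = alpha E G \<iota> (tgt G g) \<zeta>' \<and>
     (\<exists>H. jet G g H \<and>
        beta E \<iota> (src G g) (core_class G (src G g) (jleft_TT G (ginv G g) (jinv G g H) g x)) =
          \<zeta> - Ad (ginv G g) (jinv G g H) \<zeta>')"

section \<open>Hamiltonian spaces\<close>

record ('p, 'w, 'g, 'm) gspace =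
  pmfd :: "('p, 'w) charted"
  gact :: "'g \<Rightarrow> 'p \<Rightarrow> 'p"
  mom :: "'p \<Rightarrow> 'm"

definition act_dom where
  "act_dom G P = {(g, p). src G g = mom P p}"

definition groupoid_action ::
  "('g::topological_space, 'u::real_normed_vector, 'm::topological_space, 'v::real_normed_vector)
   groupoid \<Rightarrow>
   ('p::{t2_space,second_countable_topology}, 'w::banach, 'g, 'm) gspace \<Rightarrow> bool" where
  "groupoid_action G P \<longleftrightarrow>
     manifold (pmfd P) \<and> smooth_map (pmfd P) (objects G) (mom P) \<and>
     smooth_map_on (prod_mfd (arrows G) (pmfd P)) (pmfd P) (act_dom G P) (\<lambda>(g, p). gact P g p) \<and>
     (\<forall>g p. src G g = mom P p \<longrightarrow> mom P (gact P g p) = tgt G g) \<and>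
     (\<forall>p. gact P (one G (mom P p)) p = p) \<and>
     (\<forall>g h p. src G g = tgt G h \<and> src G h = mom P p \<longrightarrow>
        gact P (mul G g h) p = gact P g (gact P h p))"

definition tmom where "tmom G P p w = tmap (pmfd P) (objects G) (mom P) p w"

definition tact where
  "tact G P g v p w =
     tmap_on (prod_mfd (arrows G) (pmfd P)) (pmfd P) (act_dom G P) (\<lambda>(g, p). gact P g p)
       (g, p) (v, w)"

definition jact_T where
  "jact_T G P g H p w = tact G P g (THE v. v \<in> H \<and> tsrc G g v = tmom G P p w) p w"

definition jact_TT where
  "jact_TT G P g H p y = (jact_T G P g H p (fst y), cov_push (jact_T G P g H p) (snd y))"

text \<open>The generator \<open>\<xi>\<^sub>P|\<^sub>p\<close>, determined by \<open>L\<close>.\<close>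

definition generator where
  "generator \<iota> P L p \<xi> = (THE v. (\<iota> (mom P p) \<xi>, (v, 0)) \<in> L p)"

definition hamiltonian_space ::
  "('m::{t2_space,second_countable_topology}, 'v::banach, 'e::banach) courant \<Rightarrow> ('m \<Rightarrow> 'e set) \<Rightarrow>
   ('g::{t2_space,second_countable_topology}, 'u::banach, 'm, 'v) groupoid \<Rightarrow>
   ('m \<Rightarrow> 'u \<Rightarrow> 'e) \<Rightarrow> ('g \<Rightarrow> 'u set \<Rightarrow> 'e \<Rightarrow> 'e) \<Rightarrow>
   ('p::{t2_space,second_countable_topology}, 'w::banach, 'g, 'm) gspace \<Rightarrow>
   ('p \<Rightarrow> ('e \<times> ('w \<times> 'w dual)) set) \<Rightarrow> bool" where
  "hamiltonian_space E A G \<iota> Ad P L \<longleftrightarrow>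
     groupoid_action G P \<and>
     manin_morphism (std_courant (pmfd P)) (\<lambda>_. {(v, \<mu>). \<mu> = 0}) E A (mom P) L \<and>
     (\<forall>g H p y \<zeta>. jet G g H \<and> src G g = mom P p \<and> (\<zeta>, y) \<in> L p \<longrightarrow>
        (Ad g H \<zeta>, jact_TT G P g H p y) \<in> L (gact P g p)) \<and>
     (\<forall>p. \<forall>\<xi>\<in>LieA G (mom P p).
        generator \<iota> P L p \<xi> =
          tact G P (ginv G (one G (mom P p))) (tinv G (one G (mom P p)) \<xi>) p 0)"

subsection \<open>The action of \<open>\<T>G\<close> on \<open>\<T>P\<close>\<close>

definition cmom where
  "cmom G \<iota> P L p \<mu> = A_dual_of G (mom P p) (\<lambda>\<xi>. - blinfun_apply \<mu> (generator \<iota> P L p \<xi>))"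

definition TTmom where
  "TTmom G \<iota> P L p y = (tmom G P p (fst y), cmom G \<iota> P L p (snd y))"

definition cact where
  "cact G P g \<mu> p \<nu> = (THE \<kappa>. \<forall>v w. tsrc G g v = tmom G P p w \<longrightarrow>
     blinfun_apply \<kappa> (tact G P g v p w) = blinfun_apply \<mu> v + blinfun_apply \<nu> w)"

definition TTact where
  "TTact G P g x p y = (tact G P g (fst x) p (fst y), cact G P g (snd x) p (snd y))"

end

theory Submission
  imports Defs
begin

text \<open>
  Part (a) combines the tangency of the anchor of \<open>L\<close> to the graph of the moment map with the fact
  that \<open>L\<close> is isotropic and contains \<open>(\<xi>, (\<xi>\<^sub>P, 0))\<close> for \<open>\<xi> \<in> A\<close>.

  For part (b), let \<open>x = (v, \<mu>)\<close>, \<open>y = (w, \<nu>)\<close>, choose a jet \<open>H\<close> over \<open>g\<close>, move \<open>x\<close> back along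
  \<open>H\<close> to a unit, and let \<open>(a, \<theta>)\<close> be the core class of the result. Adding the elements
  \<open>(\<zeta>, (w, \<nu>))\<close>, \<open>- (a, (a\<^sub>P, 0))\<close> and \<open>(a\<^sub>E\<^sup>* \<theta>, (0, \<Phi>\<^sup>* \<theta>))\<close> of \<open>L\<close> gives an element whose
  first component is \<open>\<zeta>'\<close> moved back along \<open>H\<close>; equivariance of \<open>L\<close> under \<open>H\<close> takes it to
  \<open>(\<zeta>', x \<cdot> y)\<close>.

  Tangent maps are defined through curves, so identities in \<open>TG\<close> and \<open>TP\<close> are obtained by
  evaluating the groupoid identities on composable curves. Such curves with prescribed velocities exist
  because curves lift along submersions.
\<close>

section \<open>Finite-dimensional normed spaces\<close>

text \<open>Many operations in the statement are definite descriptions: \<open>tmap_on\<close>,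
  \<open>csrc\<close>, \<open>cmul\<close>, \<open>coanchor\<close>, \<open>cov_push\<close>,
  \<open>cact\<close>, \<open>generator\<close>. Each means something only where existence and
  uniqueness are known, and most of the work supplies these facts. For \<open>cmul\<close> and
  \<open>cact\<close> the obstacle is that a tangent vector factors in many ways. A covector is
  defined through one linear choice of factors; any other factorization differs from it by a tangent
  vector z at a unit, and the matching of source covector with target or moment covector is exactly
  what cancels z. The same z drives part (b). If h in H has the target of v, then v = h o z, so v .
  w = h . (z . w), and z . w is w minus the generator of the class of z. On covectors, elements of H
  have the form \<sigma>(T\<Phi> u), and pairing with their action on u produces \<theta>(T\<Phi> u)
  with \<theta> = \<mu> o \<sigma>. Model spaces are known only to be spanned by a finite set,
  possibly empty, so norm estimates and the lifting of curves are derived from a chosen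
  basis.\<close>

text \<open>The lower bound makes the coordinates of a Cauchy sequence in \<open>span B\<close>
  Cauchy themselves. Hence the span is closed, and a point outside it keeps a positive
  distance.\<close>

lemma independent_positive_distance:
  fixes B :: "'a::real_normed_vector set"
  assumes "finite B" and c: "c > 0" "\<And>u. c * (\<Sum>b\<in>B. \<bar>u b\<bar>) \<le> norm (\<Sum>b\<in>B. u b *\<^sub>R b)"
    and x: "x \<notin> span B"
  shows "\<exists>d>0. \<forall>s\<in>span B. d \<le> norm (x - s)"
proof (rule ccontr)
  assume "\<not> ?thesis"
  then have "\<forall>n. \<exists>s\<in>span B. norm (x - s) < 1 / Suc n"
    by (metis linorder_not_le of_nat_0_less_iff zero_less_Suc zero_less_divide_1_iff)
  then have "\<forall>n. \<exists>u. norm (x - (\<Sum>b\<in>B. u b *\<^sub>R b)) < 1 / Suc n"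
    using \<open>finite B\<close> by (auto simp: span_finite)
  then obtain u where u: "\<And>n. norm (x - (\<Sum>b\<in>B. u n b *\<^sub>R b)) < 1 / Suc n"
    by metis
  define s where "s n = (\<Sum>b\<in>B. u n b *\<^sub>R b)" for n
  have "(\<lambda>n. s n - x) \<longlonglongrightarrow> 0"
  proof (rule LIMSEQ_norm_0)
    show "norm (s n - x) < 1 / real (Suc n)" for n
      using u[of n] by (simp add: s_def norm_minus_commute)
  qed
  then have lim: "s \<longlonglongrightarrow> x" by (simp add: LIM_zero_iff)
  have diff: "c * \<bar>u n b - u m b\<bar> \<le> norm (s n - s m)" if "b \<in> B" for n m b
  proof -
    have "\<bar>u n b - u m b\<bar> \<le> (\<Sum>b\<in>B. \<bar>u n b - u m b\<bar>)"
      using \<open>finite B\<close> that by (intro member_le_sum) auto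
    then have "c * \<bar>u n b - u m b\<bar> \<le> c * (\<Sum>b\<in>B. \<bar>u n b - u m b\<bar>)"
      using c by simp
    also have "\<dots> \<le> norm (s n - s m)"
      using c(2)[of "\<lambda>b. u n b - u m b"] by (simp add: s_def algebra_simps sum_subtractf)
    finally show ?thesis .
  qed
  have "Cauchy (\<lambda>n. u n b)" if "b \<in> B" for b
  proof (rule CauchyI)
    fix e :: real assume "e > 0"
    have "Cauchy s" using lim LIMSEQ_imp_Cauchy by blast
    then obtain N where N: "\<And>m n. m \<ge> N \<Longrightarrow> n \<ge> N \<Longrightarrow> norm (s m - s n) < c * e"
      using \<open>e > 0\<close> c by (meson CauchyD mult_pos_pos)
    show "\<exists>M. \<forall>m\<ge>M. \<forall>n\<ge>M. norm (u m b - u n b) < e"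
    proof (intro exI[of _ N] allI impI)
      fix m n assume "m \<ge> N" "n \<ge> N"
      then have "c * \<bar>u m b - u n b\<bar> < c * e"
        using diff[OF that, of m n] N[of m n] by linarith
      then show "norm (u m b - u n b) < e" using c by simp
    qed
  qed
  then have "\<forall>b\<in>B. \<exists>l. (\<lambda>n. u n b) \<longlonglongrightarrow> l"
    by (meson Cauchy_convergent convergent_def)
  then obtain l where l: "\<And>b. b \<in> B \<Longrightarrow> (\<lambda>n. u n b) \<longlonglongrightarrow> l b"
    by metis
  have "s \<longlonglongrightarrow> (\<Sum>b\<in>B. l b *\<^sub>R b)"
    unfolding s_def by (intro tendsto_intros l)
  then have "x = (\<Sum>b\<in>B. l b *\<^sub>R b)"
    using lim LIMSEQ_unique by blast
  moreover have "(\<Sum>b\<in>B. l b *\<^sub>R b) \<in> span B"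
    by (intro span_sum span_scale span_base)
  ultimately show False using x by simp
qed

text \<open>Equivalence of the norm with the sum of absolute coordinates. In the induction, the
  distance of the new vector from the old span controls its coefficient, and the triangle inequality
  then controls the others.\<close>

lemma independent_norm_lower_bound:
  fixes B :: "'a::real_normed_vector set"
  assumes "finite B" "independent B"
  shows "\<exists>c>0. \<forall>u. c * (\<Sum>b\<in>B. \<bar>u b\<bar>) \<le> norm (\<Sum>b\<in>B. u b *\<^sub>R b)"
  using assms
proof (induction B rule: finite_induct)
  case empty
  then show ?case by (auto intro: exI[of _ 1])
next
  case (insert x B)
  then have "independent B" and x: "x \<notin> span B"
    by (simp_all add: independent_insert)
  with insert obtain c where c: "c > 0" "\<And>u. c * (\<Sum>b\<in>B. \<bar>u b\<bar>) \<le> norm (\<Sum>b\<in>B. u b *\<^sub>R b)"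
    by blast
  obtain d where d: "d > 0" "\<And>s. s \<in> span B \<Longrightarrow> d \<le> norm (x - s)"
    using independent_positive_distance[OF insert(1) c x] by blast
  \<comment> \<open>With \<open>N\<close> the norm of the combination, the coefficient of
    \<open>x\<close> is at most \<open>N / d\<close>, and the remaining ones sum to at most
    \<open>(N + N / d * norm x) / c\<close>. The total is \<open>k * N\<close>.\<close>
  define k where "k = 1 / d + (1 + norm x / d) / c"
  have "k > 0" using c(1) d(1) by (simp add: k_def add_pos_nonneg)
  have "1 / k * (\<Sum>b\<in>insert x B. \<bar>u b\<bar>) \<le> norm (\<Sum>b\<in>insert x B. u b *\<^sub>R b)" for u
  proof -
    define s where "s = (\<Sum>b\<in>B. u b *\<^sub>R b)"
    define N where "N = norm (u x *\<^sub>R x + s)"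
    have s: "s \<in> span B" unfolding s_def by (intro span_sum span_scale span_base)
    have ux: "\<bar>u x\<bar> * d \<le> N"
    proof (cases "u x = 0")
      case False
      have "d \<le> norm (x - (- (1 / u x)) *\<^sub>R s)"
        by (intro d span_scale s)
      then have "\<bar>u x\<bar> * d \<le> norm (u x *\<^sub>R (x - (- (1 / u x)) *\<^sub>R s))"
        by (simp add: mult_left_mono)
      also have "u x *\<^sub>R (x - (- (1 / u x)) *\<^sub>R s) = u x *\<^sub>R x + s"
        using False by (simp add: scaleR_right_distrib)
      finally show ?thesis by (simp add: N_def)
    qed (simp add: N_def)
    then have ux': "\<bar>u x\<bar> \<le> N / d" using d(1) by (simp add: field_simps)
    have "c * (\<Sum>b\<in>B. \<bar>u b\<bar>) \<le> norm s" using c(2) by (simp add: s_def)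
    also have "norm s \<le> N + \<bar>u x\<bar> * norm x"
      unfolding N_def using norm_triangle_ineq4[of "u x *\<^sub>R x + s" "u x *\<^sub>R x"] by simp
    also have "\<dots> \<le> N + N / d * norm x"
      using ux' by (intro add_left_mono mult_right_mono) auto
    finally have "(\<Sum>b\<in>B. \<bar>u b\<bar>) \<le> (N + N / d * norm x) / c"
      using c(1) by (simp add: field_simps)
    then have "(\<Sum>b\<in>insert x B. \<bar>u b\<bar>) \<le> N / d + (N + N / d * norm x) / c"
      using ux' insert(1,2) by simp
    also have "\<dots> = k * N" by (simp add: k_def algebra_simps add_divide_distrib)
    finally show ?thesis
      using \<open>k > 0\<close> insert(1,2) by (simp add: N_def s_def field_simps)
  qed
  then show ?case using \<open>k > 0\<close> by (intro exI[of _ "1 / k"]) auto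
qed

lemma finite_dim_coordinates:
  assumes "finite_dim (t :: 'a::real_normed_vector itself)"
  obtains B :: "'a::real_normed_vector set" and u and K :: real where
    "finite B" "independent B" "span B = UNIV" "K \<ge> 0"
    "\<And>x. (\<Sum>b\<in>B. u x b *\<^sub>R b) = x" "\<And>x b. b \<in> B \<Longrightarrow> \<bar>u x b\<bar> \<le> K * norm x"
proof -
  obtain S :: "'a set" where S: "finite S" "span S = UNIV"
    using assms by (auto simp: finite_dim_def)
  obtain B where B: "B \<subseteq> S" "independent B" "S \<subseteq> span B"
    using maximal_independent_subset by metis
  have fin: "finite B" using B S finite_subset by blast
  have sp: "span B = UNIV" using B S by (metis span_mono span_span top.extremum_uniqueI)
  have "\<forall>x. \<exists>u. (\<Sum>b\<in>B. u b *\<^sub>R b) = x"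
    using span_finite[OF fin] sp by (metis (no_types, lifting) UNIV_I imageE)
  then obtain u where u: "\<And>x. (\<Sum>b\<in>B. u x b *\<^sub>R b) = x" by metis
  obtain c where c: "c > 0" "\<And>u. c * (\<Sum>b\<in>B. \<bar>u b\<bar>) \<le> norm (\<Sum>b\<in>B. u b *\<^sub>R b)"
    using independent_norm_lower_bound[OF fin B(2)] by blast
  have bd: "\<bar>u x b\<bar> \<le> 1 / c * norm x" if "b \<in> B" for x b
  proof -
    have "\<bar>u x b\<bar> \<le> (\<Sum>b\<in>B. \<bar>u x b\<bar>)"
      using fin that by (intro member_le_sum) auto
    then have "c * \<bar>u x b\<bar> \<le> c * (\<Sum>b\<in>B. \<bar>u x b\<bar>)"
      using c by simp
    also have "\<dots> \<le> norm x" using c(2)[of "u x"] u[of x] by simp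
    finally show ?thesis using c(1) by (simp add: field_simps)
  qed
  show thesis
    by (rule that[of B "1 / c" u]) (use fin B(2) sp c(1) bd u in auto)
qed

text \<open>The bounds \<open>e b\<close> are kept separate from \<open>norm (f b)\<close> so that
  the lemma also yields a uniform estimate when \<open>f\<close> is a small difference of two
  derivatives.\<close>

lemma linear_bounded_on_basis:
  assumes f: "linear f" and x: "x = (\<Sum>b\<in>B. u b *\<^sub>R b)"
    and u: "\<And>b. b \<in> B \<Longrightarrow> \<bar>u b\<bar> \<le> K * norm x"
    and e: "\<And>b. b \<in> B \<Longrightarrow> norm (f b) \<le> e b"
  shows "norm (f x) \<le> (K * (\<Sum>b\<in>B. e b)) * norm x"
proof -
  have "f x = (\<Sum>b\<in>B. u b *\<^sub>R f b)"
    using f by (subst x) (simp add: linear_sum linear_scale)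
  then have "norm (f x) \<le> (\<Sum>b\<in>B. \<bar>u b\<bar> * norm (f b))"
    using norm_sum[of "\<lambda>b. u b *\<^sub>R f b" B] by simp
  also have "\<dots> \<le> (\<Sum>b\<in>B. (K * norm x) * e b)"
    by (intro sum_mono mult_mono u e) (auto intro: order_trans[OF abs_ge_zero u])
  also have "\<dots> = (K * (\<Sum>b\<in>B. e b)) * norm x"
    by (simp add: sum_distrib_left sum_distrib_right mult_ac)
  finally show ?thesis .
qed

lemma finite_dim_bounded_linear:
  fixes f :: "'a::real_normed_vector \<Rightarrow> 'b::real_normed_vector"
  assumes "finite_dim TYPE('a)" and f: "linear f"
  shows "bounded_linear f"
proof -
  obtain B :: "'a set" and u K where B: "finite B" "independent B" "span B = UNIV" "K \<ge> 0"
    "\<And>x. (\<Sum>b\<in>B. u x b *\<^sub>R b) = x" "\<And>x b. b \<in> B \<Longrightarrow> \<bar>u x b\<bar> \<le> K * norm x"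
    by (rule finite_dim_coordinates[OF assms(1)]) blast
  have "norm (f x) \<le> norm x * (K * (\<Sum>b\<in>B. norm (f b)))" for x
    using linear_bounded_on_basis[OF f B(5)[of x, symmetric] B(6), of "\<lambda>b. norm (f b)"] by (simp add: mult.commute)
  then show ?thesis
    using f by (auto intro!: bounded_linear_intro[where K="K * (\<Sum>b\<in>B. norm (f b))"] simp: linear_add linear_scale)
qed

text \<open>The functional \<open>q x\<close> is encoded by the vector \<open>T x\<close> whose
  coordinates are its values on the basis. Nondegeneracy makes the endomorphism \<open>T\<close>
  injective, hence surjective in finite dimension. This is what makes \<open>coanchor\<close> well
  defined.\<close>

lemma nondegenerate_representation:
  fixes q :: "'e::real_normed_vector \<Rightarrow> 'e \<Rightarrow> real"
  assumes "finite_dim TYPE('e)" "bilinear q" and nondeg: "\<And>x. (\<And>y. q x y = 0) \<Longrightarrow> x = 0"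
    and l: "linear l"
  shows "\<exists>!x. \<forall>y. q x y = l y"
proof -
  obtain B :: "'e set" where B: "finite B" "independent B" "span B = UNIV"
    using finite_dim_coordinates[OF assms(1)] by metis
  interpret fd: finite_dimensional_vector_space scaleR B
    by standard (use B in \<open>auto simp: dependent_raw_def span_raw_def\<close>)
  have lin: "linear (q x)" "linear (\<lambda>x. q x y)" for x y
    using assms(2) by (auto simp: bilinear_def)
  define T where "T x = (\<Sum>b\<in>B. q x b *\<^sub>R b)" for x
  have "linear T"
    unfolding T_def
    by (rule linearI) (simp_all add: linear_add[OF lin(2)] linear_scale[OF lin(2)]
        sum.distrib scaleR_add_left scaleR_sum_right)
  have ext: "f = g" if "linear f" "linear g" "\<And>b. b \<in> B \<Longrightarrow> f b = g b" for f g :: "'e \<Rightarrow> real"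
    by (rule ext, rule linear_eq_on[of f g _ B]) (use that B in auto)
  have zero: "linear (\<lambda>_::'e. 0::real)" by (rule linearI) auto
  have coeff: "f b = g b" if "(\<Sum>b\<in>B. f b *\<^sub>R b) = (\<Sum>b\<in>B. g b *\<^sub>R b)" "b \<in> B" for f g :: "'e \<Rightarrow> real" and b
  proof -
    have "(\<Sum>b\<in>B. (f b - g b) *\<^sub>R b) = 0"
      using that(1) by (simp add: scaleR_left_diff_distrib sum_subtractf)
    then have "f b - g b = 0"
      using B(1,2) that(2) by (intro independentD[OF B(2) B(1) subset_refl])
    then show ?thesis by simp
  qed
  have "inj T"
  proof (subst linear_injective_0[OF \<open>linear T\<close>], intro allI impI)
    fix x assume "T x = 0"
    then have "q x b = 0" if "b \<in> B" for b
      using coeff[of "q x" "\<lambda>_. 0" b] that by (simp add: T_def)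
    then have "q x = (\<lambda>_. 0)" by (intro ext lin zero) auto
    then show "x = 0" using nondeg[of x] by metis
  qed
  then have "surj T"
    using \<open>linear T\<close> by (intro fd.linear_inj_imp_surj) (auto simp: linear_def)
  then obtain x where "T x = (\<Sum>b\<in>B. l b *\<^sub>R b)" by (metis surj_def)
  then have "q x b = l b" if "b \<in> B" for b
    using coeff[of "q x" l b] that by (simp add: T_def)
  then have x: "q x = l" by (intro ext lin l) auto
  show ?thesis
  proof (rule ex1I[of _ x])
    show "\<forall>y. q x y = l y" using x by simp
    fix z assume z: "\<forall>y. q z y = l y"
    have "q (z - x) y = 0" for y
      using z x by (simp add: linear_diff[OF lin(2)])
    then have "z - x = 0" by (rule nondeg)
    then show "z = x" by simp
  qed
qed

section \<open>Lifting curves along submersions\<close>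

text \<open>\<open>Ck_on\<close> gives continuity of the derivative only in each fixed direction.
  Testing on a finite basis upgrades this to closeness in operator norm on a ball, and the mean
  value inequality is then applied to \<open>f - D\<close>.\<close>

lemma smooth_on_strict_derivative:
  fixes f :: "'a::real_normed_vector \<Rightarrow> 'b::real_normed_vector"
  assumes fd: "finite_dim TYPE('a)" and f: "smooth_on U f" and U: "open U" "x0 \<in> U" and e: "e > 0"
  defines "D \<equiv> frechet_derivative f (at x0)"
  shows "\<exists>d>0. ball x0 d \<subseteq> U \<and>
    (\<forall>x\<in>ball x0 d. \<forall>y\<in>ball x0 d. norm (f x - f y - D (x - y)) \<le> e * norm (x - y))"
proof -
  define Df where "Df x = frechet_derivative f (at x)" for x
  have "Ck_on (Suc 0) U f" using f unfolding smooth_on_def by blast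
  then have diff: "\<And>x. x \<in> U \<Longrightarrow> (f has_derivative Df x) (at x)"
    and cont: "\<And>v. continuous_on U (\<lambda>x. Df x v)"
    by (auto simp: Df_def frechet_derivative_works)
  have lin: "linear (Df x)" if "x \<in> U" for x
    using diff[OF that] has_derivative_linear by blast
  obtain B :: "'a set" and u K where B: "finite B" "independent B" "span B = UNIV" "K \<ge> 0"
    "\<And>x. (\<Sum>b\<in>B. u x b *\<^sub>R b) = x" "\<And>x b. b \<in> B \<Longrightarrow> \<bar>u x b\<bar> \<le> K * norm x"
    by (rule finite_dim_coordinates[OF fd]) blast
  \<comment> \<open>Closeness \<open>e'\<close> on every basis vector gives operator norm at most
    \<open>K * card B * e'\<close>, which is at most \<open>e\<close>. The summand 1 keeps the
    denominator positive when the basis is empty.\<close>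
  define e' where "e' = e / (K * card B + 1)"
  have K1: "K * card B + 1 > 0" using B(4) by (simp add: add_nonneg_pos)
  then have "e' > 0" using e by (simp add: e'_def)
  have "\<forall>\<^sub>F x in nhds x0. norm (Df x b - Df x0 b) \<le> e'" for b
  proof -
    have "isCont (\<lambda>x. Df x b) x0"
      using cont U continuous_on_eq_continuous_at by blast
    then have "((\<lambda>x. Df x b) \<longlongrightarrow> Df x0 b) (nhds x0)"
      using tendsto_at_iff_tendsto_nhds[of "\<lambda>x. Df x b" x0] by (simp add: isCont_def)
    from tendstoD[OF this \<open>e' > 0\<close>] show ?thesis
      by eventually_elim (simp add: dist_norm)
  qed
  then have "\<forall>\<^sub>F x in nhds x0. \<forall>b\<in>B. norm (Df x b - Df x0 b) \<le> e'"
    using B(1) by (simp add: eventually_ball_finite_distrib)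
  moreover have "\<forall>\<^sub>F x in nhds x0. x \<in> U"
    using U by (simp add: eventually_nhds_in_open)
  ultimately have "\<forall>\<^sub>F x in nhds x0. x \<in> U \<and> (\<forall>b\<in>B. norm (Df x b - Df x0 b) \<le> e')"
    by eventually_elim simp
  then obtain d where d: "d > 0"
    "\<And>x. x \<in> ball x0 d \<Longrightarrow> x \<in> U \<and> (\<forall>b\<in>B. norm (Df x b - Df x0 b) \<le> e')"
    by (auto simp: eventually_nhds_metric dist_commute)
  have bound: "norm (Df x v - D v) \<le> e * norm v" if x: "x \<in> ball x0 d" for x v
  proof -
    have "linear (\<lambda>v. Df x v - D v)"
      using lin d(2)[OF x] U(2) by (auto simp: D_def Df_def intro: linear_compose_sub)
    then have "norm (Df x v - D v) \<le> (K * (\<Sum>b\<in>B. e')) * norm v"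
      by (rule linear_bounded_on_basis[OF _ B(5)[symmetric] B(6)])
        (use d(2)[OF x] in \<open>auto simp: D_def Df_def\<close>)
    also have "\<dots> \<le> e * norm v"
    proof (rule mult_right_mono)
      have "K * (\<Sum>b\<in>B. e') = e * (K * card B / (K * card B + 1))"
        by (simp add: e'_def)
      also have "\<dots> \<le> e * 1" using e K1 by (intro mult_left_mono) auto
      finally show "K * (\<Sum>b\<in>B. e') \<le> e" by simp
    qed simp
    finally show ?thesis .
  qed
  have "norm ((f x - D x) - (f y - D y)) \<le> e * norm (x - y)"
    if "x \<in> ball x0 d" "y \<in> ball x0 d" for x y
  proof (rule differentiable_bound[where f'="\<lambda>x v. Df x v - D v"])
    have bD: "bounded_linear D" using diff[OF U(2)] by (auto simp: D_def Df_def has_derivative_bounded_linear)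
    show "((\<lambda>x. f x - D x) has_derivative (\<lambda>v. Df x v - D v)) (at x within ball x0 d)"
      if "x \<in> ball x0 d" for x
      by (rule has_derivative_diff[OF has_derivative_at_withinI[OF diff] bounded_linear_imp_has_derivative[OF bD]])
        (use d(2)[OF that] in blast)
    show "onorm (\<lambda>v. Df x v - D v) \<le> e" if "x \<in> ball x0 d" for x
      using bound[OF that] e by (intro onorm_bound) auto
  qed (use that in auto)
  moreover have "(f x - D x) - (f y - D y) = f x - f y - D (x - y)" for x y
    using linear_diff[OF lin[OF U(2)], of x y] by (simp add: D_def Df_def)
  ultimately have "norm (f x - f y - D (x - y)) \<le> e * norm (x - y)"
    if "x \<in> ball x0 d" "y \<in> ball x0 d" for x y
    using that by metis
  then show ?thesis
    using d by (intro exI[of _ d]) blast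
qed

text \<open>The lift is \<open>\<gamma> t = x0 + t v + A (z t)\<close> with \<open>A\<close> a right inverse of \<open>D\<close> and \<open>z t\<close> the fixed
  point of a contraction of a small ball.\<close>

lemma smooth_on_lift_curve:
  fixes f :: "'a::real_normed_vector \<Rightarrow> 'b::banach"
  assumes fda: "finite_dim TYPE('a)" and fdb: "finite_dim TYPE('b)"
    and f: "smooth_on U f" and U: "open U" "x0 \<in> U"
  defines "D \<equiv> frechet_derivative f (at x0)"
  assumes surj: "surj D" and c: "c 0 = f x0" "(c has_vector_derivative D v) (at 0)"
  shows "\<exists>\<gamma>. \<gamma> 0 = x0 \<and> (\<gamma> has_vector_derivative v) (at 0) \<and>
    (\<forall>\<^sub>F t::real in nhds 0. \<gamma> t \<in> U \<and> f (\<gamma> t) = c t)"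
proof -
  have "Ck_on (Suc 0) U f" using f unfolding smooth_on_def by blast
  then have D: "(f has_derivative D) (at x0)"
    using U by (auto simp: D_def frechet_derivative_works)
  then have linD: "linear D" using has_derivative_linear by blast
  obtain A where A: "linear A" "D \<circ> A = id"
    using real_vector.linear_surjective_right_inverse[of D] linD surj
    by (auto simp: linear_def)
  have DA: "D (A z) = z" for z using A(2) by (metis comp_apply id_apply)
  have "bounded_linear A" by (rule finite_dim_bounded_linear[OF fdb A(1)])
  then obtain K where K: "K > 0" "\<And>z. norm (A z) \<le> norm z * K"
    using bounded_linear.pos_bounded by blast
  \<comment> \<open>\<open>A\<close> has norm at most \<open>K\<close>, so the error
    \<open>1 / (2 * K)\<close> makes the map \<open>T\<close> below a contraction with factor
    1/2.\<close>
  obtain d where d: "d > 0" "ball x0 d \<subseteq> U"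
    "\<And>x y. x \<in> ball x0 d \<Longrightarrow> y \<in> ball x0 d \<Longrightarrow>
        norm (f x - f y - D (x - y)) \<le> 1 / (2 * K) * norm (x - y)"
    using smooth_on_strict_derivative[OF fda f U, of "1 / (2 * K)"] K(1)
    unfolding D_def by fastforce
  \<comment> \<open>\<open>A\<close> sends the ball of radius \<open>r\<close> into radius
    \<open>d / 4\<close>, leaving room for a displacement \<open>t *\<^sub>R v\<close> of length
    below \<open>d / 2\<close> inside the ball of radius \<open>d\<close>.\<close>
  define r where "r = d / (4 * K)"
  have r: "r > 0" using d K by (simp add: r_def)
  \<comment> \<open>The defect of the straight line. Both terms have velocity \<open>D v\<close>, so
    \<open>e\<close> vanishes to first order at 0; hence so does a correction bounded by a multiple
    of it, and the lift keeps velocity \<open>v\<close>.\<close>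
  define e where "e t = f (x0 + t *\<^sub>R v) - c t" for t
  have e0: "e 0 = 0" by (simp add: e_def c)
  have line: "((\<lambda>t. x0 + t *\<^sub>R v) has_vector_derivative v) (at 0)"
    by (auto intro!: derivative_eq_intros)
  have "(f \<circ> (\<lambda>t. x0 + t *\<^sub>R v) has_vector_derivative D v) (at 0)"
    by (rule vector_derivative_diff_chain_within[OF line]) (use D in \<open>auto intro: has_derivative_at_withinI\<close>)
  from has_vector_derivative_diff[OF this c(2)]
  have e_deriv: "(e has_vector_derivative 0) (at 0)" by (simp add: e_def[abs_def] o_def)
  have "isCont e 0" using e_deriv has_vector_derivative_continuous by blast
  then have "(e \<longlongrightarrow> e 0) (nhds 0)"
    by (simp only: isCont_def tendsto_at_iff_tendsto_nhds)
  then have "(e \<longlongrightarrow> 0) (nhds 0)" by (simp only: e0)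
  from tendstoD[OF this, of "r / 2"] have ev1: "\<forall>\<^sub>F t in nhds 0. norm (e t) < r / 2"
    using r by simp
  have "((\<lambda>t. t *\<^sub>R v) \<longlongrightarrow> 0 *\<^sub>R v) (nhds (0::real))"
    by (intro tendsto_scaleR tendsto_const filterlim_ident)
  from tendstoD[OF this, of "d / 2"] have ev2: "\<forall>\<^sub>F t in nhds (0::real). norm (t *\<^sub>R v) < d / 2"
    using d by simp
  have fix1: "\<exists>z. norm z \<le> 2 * norm (e t) \<and> x0 + t *\<^sub>R v + A z \<in> ball x0 d \<and> f (x0 + t *\<^sub>R v + A z) = c t"
    if t: "norm (e t) < r / 2" "norm (t *\<^sub>R v) < d / 2" for t
  proof -
    \<comment> \<open>Its fixed points are the solutions of
      \<open>f (x0 + t *\<^sub>R v + A z) = c t\<close>. Since \<open>D\<close> composed with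
      \<open>A\<close> is the identity, the linear part of \<open>T\<close> cancels.\<close>
    define T where "T z = z - (f (x0 + t *\<^sub>R v + A z) - c t)" for z
    have inball: "x0 + t *\<^sub>R v + A z \<in> ball x0 d" if "z \<in> cball 0 r" for z
    proof -
      have "norm (A z) \<le> norm z * K" by (rule K)
      also have "\<dots> \<le> r * K" using that K by (intro mult_right_mono) auto
      also have "\<dots> < d / 2" using K d by (simp add: r_def)
      finally have "norm (t *\<^sub>R v + A z) < d"
        using t(2) norm_triangle_ineq[of "t *\<^sub>R v" "A z"] by linarith
      then have "dist (x0 + t *\<^sub>R v + A z) x0 < d"
        by (simp add: dist_norm add.assoc)
      then show ?thesis by (metis mem_ball dist_commute)
    qed
    have lip: "norm (T z - T z') \<le> 1 / 2 * norm (z - z')" if "z \<in> cball 0 r" "z' \<in> cball 0 r" for z z'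
    proof -
      let ?x = "x0 + t *\<^sub>R v + A z" and ?y = "x0 + t *\<^sub>R v + A z'"
      have xy: "?x - ?y = A (z - z')" using A(1) by (simp add: linear_diff)
      have "T z - T z' = - (f ?x - f ?y - D (?x - ?y))"
        unfolding xy DA by (simp add: T_def)
      then have "norm (T z - T z') \<le> 1 / (2 * K) * norm (A (z - z'))"
        using d(3)[OF inball[OF that(1)] inball[OF that(2)]] by (simp only: norm_minus_cancel xy)
      also have "\<dots> \<le> 1 / (2 * K) * (norm (z - z') * K)"
        using K by (intro mult_left_mono) auto
      finally show ?thesis using K by simp
    qed
    have T0: "T 0 = - e t" using linear_0[OF A(1)] by (simp add: T_def e_def)
    have "T ` cball 0 r \<subseteq> cball 0 r"
    proof clarify
      fix z :: 'b assume z: "z \<in> cball 0 r"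
      have "norm (T z) \<le> norm (T z - T 0) + norm (T 0)"
        by (metis add.commute diff_add_cancel norm_triangle_ineq)
      also have "\<dots> \<le> 1 / 2 * norm z + r / 2"
        using lip[OF z, of 0] t(1) r by (intro add_mono) (auto simp: T0)
      also have "\<dots> \<le> r" using z by simp
      finally show "T z \<in> cball 0 r" by simp
    qed
    then have "\<exists>!z\<in>cball 0 r. T z = z"
      using r by (intro Banach_fix[of _ "1/2"]) (use lip in \<open>auto simp: dist_norm complete_eq_closed\<close>)
    then obtain z where z: "z \<in> cball 0 r" "T z = z" by blast
    have "norm z \<le> norm (T z - T 0) + norm (T 0)"
      by (metis add.commute diff_add_cancel norm_triangle_ineq z(2))
    also have "\<dots> \<le> 1 / 2 * norm z + norm (e t)"
      using lip[OF z(1), of 0] r by (simp add: T0)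
    finally have "norm z \<le> 2 * norm (e t)" by simp
    moreover have "f (x0 + t *\<^sub>R v + A z) = c t" using z(2) by (simp add: T_def)
    ultimately show ?thesis using inball[OF z(1)] by blast
  qed
  \<comment> \<open>The bound by \<open>2 * norm (e t)\<close> is part of the choice, and the
    default 0 where no solution exists satisfies it too. It therefore holds for every
    \<open>t\<close>, and \<open>z\<close> has derivative 0 at 0.\<close>
  define good where "good t z \<longleftrightarrow> norm z \<le> 2 * norm (e t) \<and> x0 + t *\<^sub>R v + A z \<in> ball x0 d \<and>
    f (x0 + t *\<^sub>R v + A z) = c t" for t z
  define z where "z t = (if \<exists>z. good t z then SOME z. good t z else 0)" for t
  have z_le: "norm (z t) \<le> 2 * norm (e t)" for t
    unfolding z_def by (auto intro: someI2 simp: good_def)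
  have z0: "z 0 = 0" using z_le[of 0] by (simp add: e0)
  have ev: "\<forall>\<^sub>F t in nhds 0. good t (z t)"
    using ev1 ev2
  proof eventually_elim
    case (elim t)
    then have "\<exists>z. good t z" using fix1 by (simp add: good_def)
    then show ?case by (simp add: z_def someI_ex)
  qed
  have "(z has_vector_derivative 0) (at 0)"
  proof -
    have "((\<lambda>t. norm (e t) / norm t) \<longlongrightarrow> 0) (at 0)"
      using e_deriv by (simp add: has_vector_derivative_def has_derivative_at e0)
    then have "((\<lambda>t. 2 * (norm (e t) / norm t)) \<longlongrightarrow> 0) (at 0)"
      by (rule tendsto_mult_right_zero)
    then have "((\<lambda>t. norm (z t) / norm t) \<longlongrightarrow> 0) (at 0)"
      by (rule Lim_null_comparison[rotated])
        (use z_le in \<open>auto simp: divide_right_mono intro!: always_eventually\<close>)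
    then show ?thesis by (simp add: has_vector_derivative_def has_derivative_at z0)
  qed
  then have "((\<lambda>t. x0 + t *\<^sub>R v + A (z t)) has_vector_derivative v + A 0) (at 0)"
    by (intro has_vector_derivative_add line bounded_linear.has_vector_derivative[OF \<open>bounded_linear A\<close>])
  moreover have "A 0 = 0" using A(1) linear_0 by blast
  moreover have "\<forall>\<^sub>F t in nhds 0. x0 + t *\<^sub>R v + A (z t) \<in> U \<and> f (x0 + t *\<^sub>R v + A (z t)) = c t"
    using ev by eventually_elim (use d(2) in \<open>auto simp: good_def\<close>)
  ultimately show ?thesis
    by (intro exI[of _ "\<lambda>t. x0 + t *\<^sub>R v + A (z t)"]) (simp add: z0)
qed

section \<open>Velocities and tangent maps\<close>

lemma manifoldD:
  assumes "manifold M"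
  shows manifold_cdom: "p \<in> cdom M p" "open (cdom M p)" "open (chart M p ` cdom M p)"
    and manifold_inj: "inj_on (chart M p) (cdom M p)"
    and manifold_cont: "continuous_on (chart M p ` cdom M p) (chart_inv M p)"
proof -
  have hom: "homeomorphism (cdom M p) (chart M p ` cdom M p) (chart M p) (chart_inv M p)"
    and "p \<in> cdom M p" "open (cdom M p)" "open (chart M p ` cdom M p)"
    using assms by (auto simp: manifold_def)
  then show "p \<in> cdom M p" "open (cdom M p)" "open (chart M p ` cdom M p)"
    "continuous_on (chart M p ` cdom M p) (chart_inv M p)"
    by (auto simp: homeomorphism_def)
  show "inj_on (chart M p) (cdom M p)"
    by (rule inj_on_inverseI[of _ "chart_inv M p"]) (rule homeomorphism_apply1[OF hom])
qed

lemma chart_inv_chart: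
  "inj_on (chart M p) (cdom M p) \<Longrightarrow> q \<in> cdom M p \<Longrightarrow> chart_inv M p (chart M p q) = q"
  by (simp add: chart_inv_def)

lemma chart_chart_inv:
  "x \<in> chart M p ` cdom M p \<Longrightarrow> chart M p (chart_inv M p x) = x \<and> chart_inv M p x \<in> cdom M p"
  by (simp add: chart_inv_def f_inv_into_f inv_into_into)

lemma has_velocity_unique:
  "has_velocity M \<gamma> v \<Longrightarrow> has_velocity M \<gamma> w \<Longrightarrow> v = w"
  unfolding has_velocity_def using vector_derivative_unique_at by blast

lemma has_vector_derivative_eventually_cong:
  assumes "(f has_vector_derivative v) (at a)" "\<forall>\<^sub>F t in nhds a. f t = g t"
  shows "(g has_vector_derivative v) (at a)"
proof -
  obtain S where "open S" "a \<in> S" "\<And>t. t \<in> S \<Longrightarrow> f t = g t"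
    using assms(2) unfolding eventually_nhds by blast
  then show ?thesis
    using has_vector_derivative_transform_within_open[OF assms(1)] by blast
qed

lemma isCont_eventually_in:
  assumes "isCont f a" "open V" "f a \<in> V"
  shows "\<forall>\<^sub>F t in nhds a. f t \<in> V"
  using assms by (simp add: continuous_at_open eventually_nhds)

lemma exists_curve:
  assumes M: "manifold M"
  shows "\<exists>\<gamma>. \<gamma> 0 = p \<and> has_velocity M \<gamma> v"
proof -
  let ?l = "\<lambda>t. chart M p p + t *\<^sub>R v"
  \<comment> \<open>A straight line in the preferred chart. Outside the chart image the value is
    arbitrary, since a velocity depends only on the germ at 0.\<close>
  define \<gamma> where "\<gamma> t = (if ?l t \<in> chart M p ` cdom M p then chart_inv M p (?l t) else p)" for t
  note c = manifoldD[OF M, of p]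
  have g0: "\<gamma> 0 = p" using c by (simp add: \<gamma>_def chart_inv_chart)
  have l: "isCont ?l 0" by (intro continuous_intros)
  have ev: "\<forall>\<^sub>F t in nhds 0. ?l t \<in> chart M p ` cdom M p"
    by (rule isCont_eventually_in[OF l c(3)]) (use c(1) in simp)
  have "isCont (chart_inv M p) (?l 0)"
    using c(1,3,5) by (simp add: continuous_on_eq_continuous_at)
  then have "isCont (\<lambda>t. chart_inv M p (?l t)) 0"
    by (rule isCont_o2[OF l])
  moreover have eq: "\<forall>\<^sub>F t in nhds 0. chart_inv M p (?l t) = \<gamma> t"
    using ev by eventually_elim (simp add: \<gamma>_def)
  ultimately have "isCont \<gamma> 0" by (simp only: isCont_cong[OF eq])
  moreover have "(chart M p \<circ> \<gamma> has_vector_derivative v) (at 0)"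
  proof (rule has_vector_derivative_eventually_cong)
    show "(?l has_vector_derivative v) (at 0)" by (auto intro!: derivative_eq_intros)
    show "\<forall>\<^sub>F t in nhds 0. ?l t = (chart M p \<circ> \<gamma>) t"
      using ev by eventually_elim (simp add: \<gamma>_def chart_chart_inv)
  qed
  ultimately show ?thesis using g0 by (auto simp: has_velocity_def)
qed

lemma has_velocity_prod:
  assumes "has_velocity M \<gamma> v" "has_velocity N \<delta> w"
  shows "has_velocity (prod_mfd M N) (\<lambda>t. (\<gamma> t, \<delta> t)) (v, w)"
  using assms has_vector_derivative_Pair[of "chart M (\<gamma> 0) \<circ> \<gamma>" v 0 UNIV "chart N (\<delta> 0) \<circ> \<delta>" w]
  by (auto simp: has_velocity_def prod_mfd_def o_def intro: isCont_Pair)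

lemma inj_on_chart_prod:
  assumes "inj_on (chart M (fst p)) (cdom M (fst p))" "inj_on (chart N (snd p)) (cdom N (snd p))"
  shows "inj_on (chart (prod_mfd M N) p) (cdom (prod_mfd M N) p)"
  using assms by (auto simp: inj_on_def prod_mfd_def split: prod.splits)

text \<open>The chain rule is applied to the smooth extension \<open>F\<close>, which agrees with
  \<open>f\<close> along a curve staying in \<open>S\<close>. Continuity of
  \<open>f \<circ> \<gamma>\<close> at 0, a part of \<open>has_velocity\<close>, is recovered by
  applying the inverse chart to the differentiable chart expression.\<close>

lemma local_representative_velocity:
  assumes V: "open V" "p \<in> V" "V \<subseteq> cdom M p" "F ` V \<subseteq> cdom N (f p)" "\<forall>q\<in>S \<inter> V. F q = f q"
    and smooth: "smooth_on (chart M p ` V) (chart N (f p) \<circ> F \<circ> chart_inv M p)"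
    and inj: "inj_on (chart M p) (cdom M p)" and N: "manifold N"
    and \<gamma>: "\<gamma> 0 = p" "range \<gamma> \<subseteq> S" "has_velocity M \<gamma> v"
  shows "has_velocity N (f \<circ> \<gamma>)
    (frechet_derivative (chart N (f p) \<circ> F \<circ> chart_inv M p) (at (chart M p p)) v)"
proof -
  define \<Phi> where "\<Phi> = chart N (f p) \<circ> F \<circ> chart_inv M p"
  define D where "D = frechet_derivative \<Phi> (at (chart M p p))"
  note c = manifoldD[OF N, of "f p"]
  have "Ck_on (Suc 0) (chart M p ` V) \<Phi>" using smooth unfolding smooth_on_def \<Phi>_def by blast
  then have D: "(\<Phi> has_derivative D) (at (chart M p p))"
    using V(2) by (auto simp: D_def frechet_derivative_works)
  have \<gamma>': "isCont \<gamma> 0" "(chart M p \<circ> \<gamma> has_vector_derivative v) (at 0)"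
    using \<gamma> by (auto simp: has_velocity_def)
  have ev: "\<forall>\<^sub>F t in nhds 0. \<gamma> t \<in> V"
    by (rule isCont_eventually_in[OF \<gamma>'(1) V(1)]) (simp add: \<gamma>(1) V(2))
  have f: "F (\<gamma> t) = f (\<gamma> t)" if "\<gamma> t \<in> V" for t
    using that \<gamma>(2) V(5) by blast
  have "(\<Phi> has_derivative D) (at ((chart M p \<circ> \<gamma>) 0) within (chart M p \<circ> \<gamma>) ` UNIV)"
    using D \<gamma>(1) by (simp add: has_derivative_at_withinI)
  with \<gamma>'(2) have deriv: "(\<Phi> \<circ> (chart M p \<circ> \<gamma>) has_vector_derivative D v) (at 0)"
    by (rule vector_derivative_diff_chain_within)
  have eq: "\<forall>\<^sub>F t in nhds 0. (\<Phi> \<circ> (chart M p \<circ> \<gamma>)) t = (chart N (f p) \<circ> (f \<circ> \<gamma>)) t"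
    using ev by eventually_elim (use V(3) f chart_inv_chart[OF inj] in \<open>auto simp: \<Phi>_def\<close>)
  have "isCont (\<Phi> \<circ> (chart M p \<circ> \<gamma>)) 0"
    using deriv has_vector_derivative_continuous by blast
  moreover have at0: "(\<Phi> \<circ> (chart M p \<circ> \<gamma>)) 0 = chart N (f p) (f p)"
    using V \<gamma>(1) f[of 0] chart_inv_chart[OF inj, of p] by (auto simp: \<Phi>_def)
  moreover have "isCont (chart_inv N (f p)) (chart N (f p) (f p))"
    using c(1,3,5) by (simp add: continuous_on_eq_continuous_at)
  ultimately have "isCont (chart_inv N (f p) \<circ> (\<Phi> \<circ> (chart M p \<circ> \<gamma>))) 0"
    by (intro continuous_at_compose[of 0 "\<Phi> \<circ> (chart M p \<circ> \<gamma>)"]) (simp_all only:)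
  moreover have eq2: "\<forall>\<^sub>F t in nhds 0. (chart_inv N (f p) \<circ> (\<Phi> \<circ> (chart M p \<circ> \<gamma>))) t = (f \<circ> \<gamma>) t"
    using ev
  proof eventually_elim
    case (elim t)
    then have "chart_inv M p (chart M p (\<gamma> t)) = \<gamma> t" "F (\<gamma> t) = f (\<gamma> t)" "f (\<gamma> t) \<in> cdom N (f p)"
      using V(3,4) f[OF elim] chart_inv_chart[OF inj] by (blast, blast, metis image_subset_iff)
    then show ?case using chart_inv_chart[OF c(4)] by (simp add: \<Phi>_def)
  qed
  ultimately have "isCont (f \<circ> \<gamma>) 0" by (simp only: isCont_cong[OF eq2])
  then have "has_velocity N (f \<circ> \<gamma>) (D v)"
    using has_vector_derivative_eventually_cong[OF deriv eq] \<gamma>(1)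
    by (simp add: has_velocity_def o_def)
  then show ?thesis unfolding D_def \<Phi>_def .
qed

lemma tmap_on_eqI:
  assumes "\<gamma> 0 = p" "range \<gamma> \<subseteq> S" "has_velocity M \<gamma> v"
    and "\<And>\<delta>. \<delta> 0 = p \<Longrightarrow> range \<delta> \<subseteq> S \<Longrightarrow> has_velocity M \<delta> v \<Longrightarrow> has_velocity N (f \<circ> \<delta>) u"
  shows "tmap_on M N S f p v = u"
  unfolding tmap_on_def
proof (rule the_equality)
  show "\<exists>\<gamma>. \<gamma> 0 = p \<and> range \<gamma> \<subseteq> S \<and> has_velocity M \<gamma> v \<and> has_velocity N (f \<circ> \<gamma>) u"
    using assms by blast
  show "w = u" if "\<exists>\<gamma>. \<gamma> 0 = p \<and> range \<gamma> \<subseteq> S \<and> has_velocity M \<gamma> v \<and> has_velocity N (f \<circ> \<gamma>) w" for w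
    using that assms(4) has_velocity_unique by blast
qed

text \<open>All velocities of curves in \<open>S\<close> are mapped by the derivative of one fixed
  extension. On other vectors \<open>tmap_on\<close> is unspecified, so linearity is expressed
  through an auxiliary map \<open>D\<close> on the whole model space.\<close>

lemma tmap_on_bounded_linear:
  assumes f: "smooth_map_on M N S f" and p: "p \<in> S"
    and inj: "inj_on (chart M p) (cdom M p)" and N: "manifold N"
  shows "\<exists>D. bounded_linear D \<and> (\<forall>\<gamma> v. \<gamma> 0 = p \<and> range \<gamma> \<subseteq> S \<and> has_velocity M \<gamma> v \<longrightarrow>
    tmap_on M N S f p v = D v \<and> has_velocity N (f \<circ> \<gamma>) (D v))"
proof -
  obtain V F where V: "open V" "p \<in> V" "V \<subseteq> cdom M p" "F ` V \<subseteq> cdom N (f p)" "\<forall>q\<in>S \<inter> V. F q = f q"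
    and smooth: "smooth_on (chart M p ` V) (chart N (f p) \<circ> F \<circ> chart_inv M p)"
    using bspec[OF f[unfolded smooth_map_on_def] p] by (elim exE conjE) (rule that)
  let ?D = "frechet_derivative (chart N (f p) \<circ> F \<circ> chart_inv M p) (at (chart M p p))"
  note vel = local_representative_velocity[OF V smooth inj N]
  have "Ck_on (Suc 0) (chart M p ` V) (chart N (f p) \<circ> F \<circ> chart_inv M p)"
    using smooth unfolding smooth_on_def by blast
  then have "(chart N (f p) \<circ> F \<circ> chart_inv M p has_derivative ?D) (at (chart M p p))"
    using V(2) by (auto simp: frechet_derivative_works)
  then have bl: "bounded_linear ?D" by (rule has_derivative_bounded_linear)
  have "\<forall>\<gamma> v. \<gamma> 0 = p \<and> range \<gamma> \<subseteq> S \<and> has_velocity M \<gamma> v \<longrightarrow>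
    tmap_on M N S f p v = ?D v \<and> has_velocity N (f \<circ> \<gamma>) (?D v)"
  proof (intro allI impI)
    fix \<gamma> v assume "\<gamma> 0 = p \<and> range \<gamma> \<subseteq> S \<and> has_velocity M \<gamma> v"
    then show "tmap_on M N S f p v = ?D v \<and> has_velocity N (f \<circ> \<gamma>) (?D v)"
      by (intro conjI vel tmap_on_eqI[of \<gamma>] vel) blast+
  qed
  with bl show ?thesis by (intro exI conjI)
qed

lemma tmap_on_velocity:
  assumes "smooth_map_on M N S f" "inj_on (chart M (\<gamma> 0)) (cdom M (\<gamma> 0))" "manifold N"
    and \<gamma>: "range \<gamma> \<subseteq> S" "has_velocity M \<gamma> v"
  shows "has_velocity N (f \<circ> \<gamma>) (tmap_on M N S f (\<gamma> 0) v)"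
proof -
  have "\<gamma> 0 \<in> S" using \<gamma> by blast
  from tmap_on_bounded_linear[OF assms(1) this assms(2,3)] show ?thesis using \<gamma> by auto
qed

lemma tmap_bounded_linear:
  assumes "smooth_map M N f" "manifold M" "manifold N"
  shows "bounded_linear (tmap M N f p)"
proof -
  obtain D where D: "bounded_linear D"
    "\<forall>\<gamma> v. \<gamma> 0 = p \<and> range \<gamma> \<subseteq> UNIV \<and> has_velocity M \<gamma> v \<longrightarrow>
       tmap M N f p v = D v \<and> has_velocity N (f \<circ> \<gamma>) (D v)"
    using tmap_on_bounded_linear[OF assms(1) UNIV_I manifold_inj[OF assms(2)] assms(3), of p]
    by (elim exE conjE) (rule that)
  have "tmap M N f p v = D v" for v
    using exists_curve[OF assms(2), of p v] D(2) by auto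
  then have "tmap M N f p = D" by (rule ext)
  then show ?thesis using D(1) by simp
qed

text \<open>Equality at all times, not only near 0, matters because \<open>tmap_on\<close> admits
  only curves lying entirely in \<open>S\<close>. Near 0 the lift comes from
  \<open>smooth_on_lift_curve\<close> in charts.\<close>

lemma submersion_lift_curve:
  fixes M :: "('p::{t2_space,second_countable_topology}, 'a::banach) charted"
    and N :: "('q::{t2_space,second_countable_topology}, 'b::banach) charted"
  assumes M: "manifold M" and N: "manifold N" and f: "submersion M N f" and "surj f"
    and c: "has_velocity N c (tmap M N f p v)" "c 0 = f p"
  shows "\<exists>\<gamma>. \<gamma> 0 = p \<and> has_velocity M \<gamma> v \<and> (\<forall>t. f (\<gamma> t) = c t)"
proof -
  note m = manifoldD[OF M, of p] and n = manifoldD[OF N, of "f p"]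
  have smooth_f: "smooth_map M N f" and surj: "surj (tmap M N f p)" using f by (auto simp: submersion_def)
  obtain V F where V: "open V" "p \<in> V" "V \<subseteq> cdom M p" "F ` V \<subseteq> cdom N (f p)" "\<forall>q\<in>UNIV \<inter> V. F q = f q"
    and smooth: "smooth_on (chart M p ` V) (chart N (f p) \<circ> F \<circ> chart_inv M p)"
    using bspec[OF smooth_f[unfolded smooth_map_on_def] UNIV_I[of p]] by (elim exE conjE) (rule that)
  let ?F = "chart N (f p) \<circ> F \<circ> chart_inv M p"
  have D: "tmap M N f p = frechet_derivative ?F (at (chart M p p))"
  proof (rule ext)
    fix v
    obtain \<gamma> where "\<gamma> 0 = p" "has_velocity M \<gamma> v" using exists_curve[OF M] by metis
    then show "tmap M N f p v = frechet_derivative ?F (at (chart M p p)) v"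
      using local_representative_velocity[OF V smooth m(4) N] by (intro tmap_on_eqI) auto
  qed
  have "open (chart M p ` V)"
  proof -
    have "chart M p ` V = chart_inv M p -` V \<inter> chart M p ` cdom M p"
      using V(3) chart_inv_chart[OF m(4)] by force
    then show ?thesis
      using continuous_on_open_vimage[OF m(3)] m(5) V(1) by metis
  qed
  moreover have "(chart N (f p) \<circ> c has_vector_derivative tmap M N f p v) (at 0)" and cc: "isCont c 0"
    using c by (auto simp: has_velocity_def)
  moreover have Fp: "(chart N (f p) \<circ> c) 0 = ?F (chart M p p)"
    using c(2) V chart_inv_chart[OF m(4) m(1)] by simp
  ultimately obtain \<delta> where \<delta>: "\<delta> 0 = chart M p p" "(\<delta> has_vector_derivative v) (at 0)"
    "\<forall>\<^sub>F t in nhds 0. \<delta> t \<in> chart M p ` V \<and> ?F (\<delta> t) = (chart N (f p) \<circ> c) t"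
    using smooth_on_lift_curve[OF _ _ smooth, of "chart M p p" "chart N (f p) \<circ> c" v] M N V(2) surj
    unfolding D manifold_def by blast
  have evc: "\<forall>\<^sub>F t in nhds 0. c t \<in> cdom N (f p)"
    by (rule isCont_eventually_in[OF cc n(2)]) (use c n in simp)
  define P where "P t \<longleftrightarrow> \<delta> t \<in> chart M p ` V \<and> f (chart_inv M p (\<delta> t)) = c t" for t
  have evP: "\<forall>\<^sub>F t in nhds 0. P t"
    using \<delta>(3) evc
  proof eventually_elim
    case (elim t)
    then obtain q where q: "q \<in> V" "\<delta> t = chart M p q" by blast
    then have [simp]: "chart_inv M p (\<delta> t) = q" using V(3) chart_inv_chart[OF m(4)] by auto
    have "F q = f q" "F q \<in> cdom N (f p)" using q V(4,5) by auto
    then have "chart N (f p) (f q) = chart N (f p) (c t)" "f q \<in> cdom N (f p)"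
      using elim(1) by auto
    then have "f q = c t" using n(4) elim(2) by (meson inj_onD)
    then show ?case using elim(1) by (simp add: P_def)
  qed
  \<comment> \<open>Away from 0, and wherever the chart construction fails, any preimage of
    \<open>c t\<close> will do; surjectivity provides one.\<close>
  define \<gamma> where "\<gamma> t = (if P t then chart_inv M p (\<delta> t) else inv f (c t))" for t
  have eq: "\<forall>\<^sub>F t in nhds 0. chart_inv M p (\<delta> t) = \<gamma> t"
    using evP by eventually_elim (simp add: \<gamma>_def)
  have "P 0" using evP eventually_nhds_x_imp_x by blast
  then have g0: "\<gamma> 0 = p" using \<delta>(1) m by (simp add: \<gamma>_def chart_inv_chart)
  have "isCont \<delta> 0" using \<delta>(2) has_vector_derivative_continuous by blast
  moreover have "isCont (chart_inv M p) (\<delta> 0)"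
    using m(1,3,5) \<delta>(1) by (simp add: continuous_on_eq_continuous_at)
  ultimately have "isCont (\<lambda>t. chart_inv M p (\<delta> t)) 0"
    by (rule isCont_o2)
  then have "isCont \<gamma> 0" by (simp only: isCont_cong[OF eq])
  moreover have "(chart M p \<circ> \<gamma> has_vector_derivative v) (at 0)"
  proof (rule has_vector_derivative_eventually_cong[OF \<delta>(2)])
    show "\<forall>\<^sub>F t in nhds 0. \<delta> t = (chart M p \<circ> \<gamma>) t"
      using evP by eventually_elim (use V(3) chart_chart_inv[of _ M p] in \<open>force simp: \<gamma>_def P_def\<close>)
  qed
  moreover have "f (\<gamma> t) = c t" for t
    using \<open>surj f\<close> by (simp add: \<gamma>_def P_def surj_f_inv_f)
  ultimately show ?thesis using g0 by (auto simp: has_velocity_def)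
qed

section \<open>The tangent groupoid\<close>

locale tangent_groupoid =
  fixes G :: "('g::{t2_space,second_countable_topology}, 'u::banach,
    'm::{t2_space,second_countable_topology}, 'v::banach) groupoid"
  assumes lie_groupoid: "lie_groupoid G"
begin

lemma manifolds: "manifold (arrows G)" "manifold (objects G)"
  and submersions: "submersion (arrows G) (objects G) (src G)" "submersion (arrows G) (objects G) (tgt G)"
  and smooth_maps: "smooth_map (objects G) (arrows G) (one G)" "smooth_map (arrows G) (arrows G) (ginv G)"
  and smooth_mul: "smooth_map_on (prod_mfd (arrows G) (arrows G)) (arrows G) (composable G) (\<lambda>(g, h). mul G g h)"
  and src_one [simp]: "src G (one G m) = m" and tgt_one [simp]: "tgt G (one G m) = m"
  and src_mul [simp]: "src G g = tgt G h \<Longrightarrow> src G (mul G g h) = src G h"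
  and tgt_mul [simp]: "src G g = tgt G h \<Longrightarrow> tgt G (mul G g h) = tgt G g"
  and mul_assoc: "src G g = tgt G h \<Longrightarrow> src G h = tgt G k \<Longrightarrow> mul G (mul G g h) k = mul G g (mul G h k)"
  and one_mul [simp]: "mul G (one G (tgt G g)) g = g" and mul_one [simp]: "mul G g (one G (src G g)) = g"
  and src_ginv [simp]: "src G (ginv G g) = tgt G g" and tgt_ginv [simp]: "tgt G (ginv G g) = src G g"
  and mul_ginv [simp]: "mul G g (ginv G g) = one G (tgt G g)"
  and ginv_mul [simp]: "mul G (ginv G g) g = one G (src G g)"
  using lie_groupoid unfolding lie_groupoid_def by blast+

lemma ginv_unique: "src G g = tgt G h \<Longrightarrow> src G h = tgt G g \<Longrightarrow> mul G g h = one G (tgt G g) \<Longrightarrow> h = ginv G g"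
  by (metis ginv_mul mul_assoc mul_one one_mul src_ginv)

lemma ginv_ginv [simp]: "ginv G (ginv G g) = g"
  using ginv_unique[of "ginv G g" g] by simp

lemma ginv_one [simp]: "ginv G (one G m) = one G m"
  using ginv_unique[of "one G m" "one G m"] mul_one[of "one G m"] by simp

lemma surj_src_tgt: "surj (src G)" "surj (tgt G)"
  by (metis src_one surj_def, metis tgt_one surj_def)

lemma inj_chart_prod: "inj_on (chart (prod_mfd (arrows G) (arrows G)) p) (cdom (prod_mfd (arrows G) (arrows G)) p)"
  by (intro inj_on_chart_prod manifold_inj manifolds)

lemma smooth_src_tgt: "smooth_map (arrows G) (objects G) (src G)" "smooth_map (arrows G) (objects G) (tgt G)"
  using submersions by (auto simp: submersion_def)

lemma has_velocity_src:
  "has_velocity (arrows G) \<gamma> v \<Longrightarrow> \<gamma> 0 = g \<Longrightarrow> has_velocity (objects G) (\<lambda>t. src G (\<gamma> t)) (tsrc G g v)"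
  using tmap_on_velocity[OF smooth_src_tgt(1) manifold_inj[OF manifolds(1)] manifolds(2), of \<gamma> v]
  by (simp add: tsrc_def o_def)

lemma has_velocity_tgt:
  "has_velocity (arrows G) \<gamma> v \<Longrightarrow> \<gamma> 0 = g \<Longrightarrow> has_velocity (objects G) (\<lambda>t. tgt G (\<gamma> t)) (ttgt G g v)"
  using tmap_on_velocity[OF smooth_src_tgt(2) manifold_inj[OF manifolds(1)] manifolds(2), of \<gamma> v]
  by (simp add: ttgt_def o_def)

lemma has_velocity_one:
  "has_velocity (objects G) \<gamma> v \<Longrightarrow> \<gamma> 0 = m \<Longrightarrow> has_velocity (arrows G) (\<lambda>t. one G (\<gamma> t)) (tone G m v)"
  using tmap_on_velocity[OF smooth_maps(1) manifold_inj[OF manifolds(2)] manifolds(1), of \<gamma> v]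
  by (simp add: tone_def o_def)

lemma has_velocity_ginv:
  "has_velocity (arrows G) \<gamma> v \<Longrightarrow> \<gamma> 0 = g \<Longrightarrow> has_velocity (arrows G) (\<lambda>t. ginv G (\<gamma> t)) (tinv G g v)"
  using tmap_on_velocity[OF smooth_maps(2) manifold_inj[OF manifolds(1)] manifolds(1), of \<gamma> v]
  by (simp add: tinv_def o_def)

lemma has_velocity_mul:
  assumes "has_velocity (arrows G) \<gamma> v" "has_velocity (arrows G) \<delta> w"
    and "\<gamma> 0 = g" "\<delta> 0 = h" "\<And>t. src G (\<gamma> t) = tgt G (\<delta> t)"
  shows "has_velocity (arrows G) (\<lambda>t. mul G (\<gamma> t) (\<delta> t)) (tmul G g v h w)"
  using tmap_on_velocity[OF smooth_mul inj_chart_prod manifolds(1) _ has_velocity_prod[OF assms(1,2)]] assms(3-)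
  by (auto simp: tmul_def o_def composable_def)

lemma exists_arrow_curve: "\<exists>\<gamma>. \<gamma> 0 = g \<and> has_velocity (arrows G) \<gamma> v"
  by (rule exists_curve[OF manifolds(1)])

lemma lift_src:
  assumes "has_velocity (objects G) c (tsrc G g v)" "c 0 = src G g"
  shows "\<exists>\<gamma>. \<gamma> 0 = g \<and> has_velocity (arrows G) \<gamma> v \<and> (\<forall>t. src G (\<gamma> t) = c t)"
  using submersion_lift_curve[OF manifolds submersions(1) surj_src_tgt(1)] assms
  by (simp add: tsrc_def)

text \<open>Lifting along the submersion \<open>src\<close> shows that every infinitesimally
  composable pair is the velocity of a curve of composable arrows. Hence \<open>tmul\<close> is
  meaningful on all such pairs.\<close>

lemma composable_curves:
  assumes "src G g = tgt G h" "tsrc G g v = ttgt G h w"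
  obtains \<gamma> \<delta> where "\<gamma> 0 = g" "\<delta> 0 = h" "has_velocity (arrows G) \<gamma> v" "has_velocity (arrows G) \<delta> w"
    "\<And>t. src G (\<gamma> t) = tgt G (\<delta> t)"
proof -
  obtain \<delta> where \<delta>: "\<delta> 0 = h" "has_velocity (arrows G) \<delta> w" using exists_arrow_curve by blast
  have "has_velocity (objects G) (\<lambda>t. tgt G (\<delta> t)) (tsrc G g v)"
    using has_velocity_tgt[OF \<delta>(2,1)] assms(2) by simp
  then obtain \<gamma> where "\<gamma> 0 = g" "has_velocity (arrows G) \<gamma> v" "\<forall>t. src G (\<gamma> t) = tgt G (\<delta> t)"
    using lift_src \<delta>(1) assms(1) by metis
  then show thesis using \<delta> that by blast
qed

lemma bounded_linear_tangent_maps: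
  "bounded_linear (tsrc G g)" "bounded_linear (ttgt G g)" "bounded_linear (tone G m)" "bounded_linear (tinv G g)"
proof -
  have "tsrc G g = tmap (arrows G) (objects G) (src G) g" "ttgt G g = tmap (arrows G) (objects G) (tgt G) g"
    "tone G m = tmap (objects G) (arrows G) (one G) m" "tinv G g = tmap (arrows G) (arrows G) (ginv G) g"
    by (simp_all add: fun_eq_iff tsrc_def ttgt_def tone_def tinv_def)
  then show "bounded_linear (tsrc G g)" "bounded_linear (ttgt G g)" "bounded_linear (tone G m)" "bounded_linear (tinv G g)"
    using tmap_bounded_linear manifolds smooth_maps smooth_src_tgt by metis+
qed

lemmas linear_tangent_maps = bounded_linear_tangent_maps[THEN bounded_linear.linear]

lemmas tangent_simps [simp] =
  linear_tangent_maps[THEN linear_add] linear_tangent_maps[THEN linear_diff]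
  linear_tangent_maps[THEN linear_scale] linear_tangent_maps[THEN linear_neg]
  linear_tangent_maps[THEN linear_0]

lemma surj_tsrc: "surj (tsrc G g)" and surj_ttgt: "surj (ttgt G g)"
proof -
  have "tsrc G g = tmap (arrows G) (objects G) (src G) g" "ttgt G g = tmap (arrows G) (objects G) (tgt G) g"
    by (simp_all add: fun_eq_iff tsrc_def ttgt_def)
  then show "surj (tsrc G g)" "surj (ttgt G g)" using submersions by (auto simp: submersion_def)
qed

lemma tsrc_tone [simp]: "tsrc G (one G m) (tone G m w) = w"
  and ttgt_tone [simp]: "ttgt G (one G m) (tone G m w) = w"
proof -
  obtain c where c: "c 0 = m" "has_velocity (objects G) c w" using exists_curve[OF manifolds(2)] by blast
  note v = has_velocity_one[OF c(2,1)]
  show "tsrc G (one G m) (tone G m w) = w" "ttgt G (one G m) (tone G m w) = w"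
    using has_velocity_src[OF v] has_velocity_tgt[OF v] c has_velocity_unique by auto
qed

lemma tsrc_tmul [simp]:
  "src G g = tgt G h \<Longrightarrow> tsrc G g v = ttgt G h w \<Longrightarrow> tsrc G (mul G g h) (tmul G g v h w) = tsrc G h w"
  and ttgt_tmul [simp]:
  "src G g = tgt G h \<Longrightarrow> tsrc G g v = ttgt G h w \<Longrightarrow> ttgt G (mul G g h) (tmul G g v h w) = ttgt G g v"
proof -
  assume A: "src G g = tgt G h" "tsrc G g v = ttgt G h w"
  obtain \<gamma> \<delta> where c: "\<gamma> 0 = g" "\<delta> 0 = h" "has_velocity (arrows G) \<gamma> v" "has_velocity (arrows G) \<delta> w"
    "\<And>t. src G (\<gamma> t) = tgt G (\<delta> t)"
    using composable_curves[OF A] by metis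
  note v = has_velocity_mul[OF c(3,4,1,2,5)]
  show "tsrc G (mul G g h) (tmul G g v h w) = tsrc G h w" "ttgt G (mul G g h) (tmul G g v h w) = ttgt G g v"
    using has_velocity_src[OF v] has_velocity_tgt[OF v] has_velocity_src[OF c(4,2)] has_velocity_tgt[OF c(3,1)]
      c(1,2,5) has_velocity_unique by auto
qed

lemma tmul_assoc:
  assumes "src G g = tgt G h" "src G h = tgt G k" "tsrc G g v = ttgt G h w" "tsrc G h w = ttgt G k x"
  shows "tmul G (mul G g h) (tmul G g v h w) k x = tmul G g v (mul G h k) (tmul G h w k x)"
proof -
  obtain \<delta> \<epsilon> where c: "\<delta> 0 = h" "\<epsilon> 0 = k" "has_velocity (arrows G) \<delta> w" "has_velocity (arrows G) \<epsilon> x"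
    "\<And>t. src G (\<delta> t) = tgt G (\<epsilon> t)"
    using composable_curves[OF assms(2,4)] by metis
  have "has_velocity (objects G) (\<lambda>t. tgt G (\<delta> t)) (tsrc G g v)"
    using has_velocity_tgt[OF c(3,1)] assms(3) by simp
  then obtain \<gamma> where d: "\<gamma> 0 = g" "has_velocity (arrows G) \<gamma> v" "\<And>t. src G (\<gamma> t) = tgt G (\<delta> t)"
    using lift_src c(1) assms(1) by metis
  have "has_velocity (arrows G) (\<lambda>t. mul G (mul G (\<gamma> t) (\<delta> t)) (\<epsilon> t)) (tmul G (mul G g h) (tmul G g v h w) k x)"
    by (intro has_velocity_mul c d) (simp_all add: c d)
  moreover have "has_velocity (arrows G) (\<lambda>t. mul G (\<gamma> t) (mul G (\<delta> t) (\<epsilon> t))) (tmul G g v (mul G h k) (tmul G h w k x))"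
    by (intro has_velocity_mul c d) (simp_all add: c d)
  ultimately show ?thesis
    using has_velocity_unique by (simp add: mul_assoc c d)
qed

lemma tone_tmul [simp]: "tmul G (one G (tgt G g)) (tone G (tgt G g) (ttgt G g v)) g v = v"
  and tmul_tone [simp]: "tmul G g v (one G (src G g)) (tone G (src G g) (tsrc G g v)) = v"
  and tsrc_tinv [simp]: "tsrc G (ginv G g) (tinv G g v) = ttgt G g v"
  and ttgt_tinv [simp]: "ttgt G (ginv G g) (tinv G g v) = tsrc G g v"
  and tmul_tinv [simp]: "tmul G g v (ginv G g) (tinv G g v) = tone G (tgt G g) (ttgt G g v)"
  and tinv_tmul [simp]: "tmul G (ginv G g) (tinv G g v) g v = tone G (src G g) (tsrc G g v)"
  and tinv_tinv [simp]: "tinv G (ginv G g) (tinv G g v) = v"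
proof -
  obtain \<gamma> where c: "\<gamma> 0 = g" "has_velocity (arrows G) \<gamma> v" using exists_arrow_curve by blast
  note s = has_velocity_src[OF c(2,1)] and t = has_velocity_tgt[OF c(2,1)] and i = has_velocity_ginv[OF c(2,1)]
  have os: "has_velocity (arrows G) (\<lambda>t. one G (src G (\<gamma> t))) (tone G (src G g) (tsrc G g v))"
    by (rule has_velocity_one[OF s]) (simp add: c)
  have ot: "has_velocity (arrows G) (\<lambda>t. one G (tgt G (\<gamma> t))) (tone G (tgt G g) (ttgt G g v))"
    by (rule has_velocity_one[OF t]) (simp add: c)
  show "tmul G (one G (tgt G g)) (tone G (tgt G g) (ttgt G g v)) g v = v"
    using has_velocity_unique[OF has_velocity_mul[OF ot c(2), of "one G (tgt G g)" g]] c by simp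
  show "tmul G g v (one G (src G g)) (tone G (src G g) (tsrc G g v)) = v"
    using has_velocity_unique[OF has_velocity_mul[OF c(2) os, of g "one G (src G g)"]] c by simp
  show "tsrc G (ginv G g) (tinv G g v) = ttgt G g v" "ttgt G (ginv G g) (tinv G g v) = tsrc G g v"
    using has_velocity_src[OF i] has_velocity_tgt[OF i] s t c has_velocity_unique by auto
  show "tmul G g v (ginv G g) (tinv G g v) = tone G (tgt G g) (ttgt G g v)"
    using has_velocity_unique[OF has_velocity_mul[OF c(2) i, of g "ginv G g"]] c ot by simp
  show "tmul G (ginv G g) (tinv G g v) g v = tone G (src G g) (tsrc G g v)"
    using has_velocity_unique[OF has_velocity_mul[OF i c(2), of "ginv G g" g]] c os by simp
  show "tinv G (ginv G g) (tinv G g v) = v"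
    using has_velocity_ginv[OF i] c has_velocity_unique by simp
qed

section \<open>Linearity of the tangent multiplication and its form at units\<close>

lemma tmul_bounded_linear:
  assumes "src G g = tgt G h"
  shows "\<exists>D. bounded_linear D \<and> (\<forall>v w. tsrc G g v = ttgt G h w \<longrightarrow> tmul G g v h w = D (v, w))"
proof -
  have gh: "(g, h) \<in> composable G" using assms by (simp add: composable_def)
  obtain D where D: "bounded_linear D"
    "\<forall>\<gamma> v. \<gamma> 0 = (g, h) \<and> range \<gamma> \<subseteq> composable G \<and> has_velocity (prod_mfd (arrows G) (arrows G)) \<gamma> v \<longrightarrow>
      tmap_on (prod_mfd (arrows G) (arrows G)) (arrows G) (composable G) (\<lambda>(g, h). mul G g h) (g, h) v = D v \<and>
      has_velocity (arrows G) ((\<lambda>(g, h). mul G g h) \<circ> \<gamma>) (D v)"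
    using tmap_on_bounded_linear[OF smooth_mul gh inj_chart_prod manifolds(1)] by (elim exE conjE) (rule that)
  have "tmul G g v h w = D (v, w)" if vw: "tsrc G g v = ttgt G h w" for v w
  proof -
    obtain \<gamma> \<delta> where c: "\<gamma> 0 = g" "\<delta> 0 = h" "has_velocity (arrows G) \<gamma> v" "has_velocity (arrows G) \<delta> w"
      "\<And>t. src G (\<gamma> t) = tgt G (\<delta> t)"
      using composable_curves[OF assms vw] by metis
    have "has_velocity (prod_mfd (arrows G) (arrows G)) (\<lambda>t. (\<gamma> t, \<delta> t)) (v, w)"
      by (rule has_velocity_prod[OF c(3,4)])
    then show ?thesis
      using D(2)[rule_format, of "\<lambda>t. (\<gamma> t, \<delta> t)" "(v, w)"] c(1,2,5)
      by (auto simp: tmul_def composable_def)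
  qed
  then show ?thesis using D(1) by blast
qed

lemma tmul_add:
  assumes "src G g = tgt G h" "tsrc G g v = ttgt G h w" "tsrc G g v' = ttgt G h w'"
  shows "tmul G g (v + v') h (w + w') = tmul G g v h w + tmul G g v' h w'"
proof -
  obtain D where D: "bounded_linear D" "\<And>v w. tsrc G g v = ttgt G h w \<Longrightarrow> tmul G g v h w = D (v, w)"
    using tmul_bounded_linear[OF assms(1)] by blast
  then show ?thesis
    using assms linear_add[OF bounded_linear.linear[OF D(1)], of "(v, w)" "(v', w')"] by simp
qed

lemma tmul_scale:
  assumes "src G g = tgt G h" "tsrc G g v = ttgt G h w"
  shows "tmul G g (r *\<^sub>R v) h (r *\<^sub>R w) = r *\<^sub>R tmul G g v h w"
proof -
  obtain D where D: "bounded_linear D" "\<And>v w. tsrc G g v = ttgt G h w \<Longrightarrow> tmul G g v h w = D (v, w)"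
    using tmul_bounded_linear[OF assms(1)] by blast
  then show ?thesis
    using assms linear_scale[OF bounded_linear.linear[OF D(1)], of r "(v, w)"] by simp
qed

text \<open>By additivity the pair \<open>(x, y)\<close> splits into \<open>x\<close> times a unit
  vector and zero times a vector with target 0. The unit laws evaluate both products.\<close>

lemma unit_tmul:
  assumes "tsrc G (one G m) x = ttgt G (one G m) y"
  shows "tmul G (one G m) x (one G m) y = x + y - tone G m (ttgt G (one G m) y)"
proof -
  let ?e = "one G m" and ?k = "y - tone G m (ttgt G (one G m) y)"
  have "tmul G ?e (x + 0) ?e (tone G m (ttgt G ?e y) + ?k)
      = tmul G ?e x ?e (tone G m (ttgt G ?e y)) + tmul G ?e 0 ?e ?k"
    by (rule tmul_add) (simp_all add: assms)
  moreover have "tmul G ?e x ?e (tone G m (ttgt G ?e y)) = x"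
    using tmul_tone[of ?e x] assms by simp
  moreover have "tmul G ?e 0 ?e ?k = ?k"
    using tone_tmul[of ?e ?k] by simp
  ultimately show ?thesis by (simp add: algebra_simps)
qed

text \<open>Composing \<open>a\<close> with its inverse gives the unit over \<open>ttgt\<close> of
  \<open>a\<close>, which is 0. \<open>unit_tmul\<close> turns this into a linear equation for the
  inverse.\<close>

lemma unit_tinv:
  assumes "ttgt G (one G m) a = 0"
  shows "tinv G (one G m) a = tone G m (tsrc G (one G m) a) - a"
proof -
  have "tmul G (one G m) a (one G m) (tinv G (one G m) a) = 0"
    using tmul_tinv[of "one G m" a] assms by simp
  moreover have "ttgt G (one G m) (tinv G (one G m) a) = tsrc G (one G m) a"
    using ttgt_tinv[of "one G m" a] by simp
  ultimately have "a + tinv G (one G m) a - tone G m (tsrc G (one G m) a) = 0"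
    using unit_tmul[of m a "tinv G (one G m) a"] by simp
  then show ?thesis by (simp add: algebra_simps)
qed

text \<open>Two vectors at \<open>g\<close> with the same target differ by right multiplication with
  \<open>z\<close>, the inverse of \<open>k\<close> composed with \<open>v\<close>, a vector at the
  unit over the source. This compares two factorizations of one tangent vector throughout.\<close>

lemma tgt_difference:
  assumes "ttgt G g k = ttgt G g v"
  defines "z \<equiv> tmul G (ginv G g) (tinv G g k) g v"
  shows "tmul G g k (one G (src G g)) z = v"
    and "ttgt G (one G (src G g)) z = tsrc G g k" and "tsrc G (one G (src G g)) z = tsrc G g v"
proof -
  show "ttgt G (one G (src G g)) z = tsrc G g k" "tsrc G (one G (src G g)) z = tsrc G g v"
    unfolding z_def using assms(1) tsrc_tmul[of "ginv G g" g "tinv G g k" v] ttgt_tmul[of "ginv G g" g "tinv G g k" v]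
    by simp_all
  have "tmul G (mul G g (ginv G g)) (tmul G g k (ginv G g) (tinv G g k)) g v =
      tmul G g k (mul G (ginv G g) g) (tmul G (ginv G g) (tinv G g k) g v)"
    by (rule tmul_assoc) (simp_all add: assms(1))
  then show "tmul G g k (one G (src G g)) z = v"
    by (simp add: z_def assms(1))
qed

lemma finite_dim_models: "finite_dim TYPE('u)" "finite_dim TYPE('v)"
  using manifolds by (simp_all add: manifold_def)

end

section \<open>Covectors and jets\<close>

lemma finite_dim_exists_dual:
  fixes f :: "'a::real_normed_vector \<Rightarrow> real"
  assumes "finite_dim TYPE('a)" "linear f"
  shows "\<exists>\<phi> :: 'a dual. \<forall>v. blinfun_apply \<phi> v = f v"
  using bounded_linear_Blinfun_apply[OF finite_dim_bounded_linear[OF assms]] by metis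

text \<open>\<open>f\<close> restricts to a linear isomorphism on a complement of its kernel;
  \<open>\<rho>\<close> is the inverse of that restriction.\<close>

lemma complementary_section:
  assumes f: "linear f" "surj f" and H: "subspace H" "complementary H {v. f v = 0}"
  shows "\<exists>\<rho>. linear \<rho> \<and> (\<forall>w. \<rho> w \<in> H \<and> f (\<rho> w) = w) \<and> (\<forall>h\<in>H. \<rho> (f h) = h)"
proof -
  have uniq: "h = k" if "h \<in> H" "k \<in> H" "f h = f k" for h k
  proof -
    have "h - k \<in> H \<inter> {v. f v = 0}"
      using that H(1) f(1) by (simp add: subspace_diff linear_diff)
    then have "h - k = 0" using H(2) unfolding complementary_def by blast
    then show ?thesis by simp
  qed
  have "\<forall>w. \<exists>h\<in>H. f h = w"
  proof
    fix w
    obtain x where x: "f x = w" using f(2) by (metis surj_def)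
    obtain h k where "h \<in> H" "f k = 0" "x = h + k" using H(2) unfolding complementary_def by blast
    then show "\<exists>h\<in>H. f h = w" using x f(1) by (auto simp: linear_add)
  qed
  then obtain \<rho> where \<rho>: "\<And>w. \<rho> w \<in> H" "\<And>w. f (\<rho> w) = w" by metis
  have "linear \<rho>"
    using f(1) H(1) by (intro linearI uniq) (auto simp: \<rho> linear_add linear_scale subspace_add subspace_scale)
  then show ?thesis using \<rho> uniq by blast
qed

context tangent_groupoid
begin

lemma linear_tmul:
  assumes "src G g = tgt G h" "linear f" "linear k" "\<And>x. tsrc G g (f x) = ttgt G h (k x)"
  shows "linear (\<lambda>x. tmul G g (f x) h (k x))"
  using assms by (intro linearI) (simp_all add: linear_add linear_scale tmul_add tmul_scale)

lemma linear_lie_class: "linear (lie_class G m)"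
  by (rule linearI) (simp_all add: lie_class_def algebra_simps)

lemma ttgt_lie_class [simp]: "ttgt G (one G m) (lie_class G m v) = 0"
  by (simp add: lie_class_def)

lemma tsrc_lie_class [simp]:
  "tsrc G (one G m) (lie_class G m v) = tsrc G (one G m) v - ttgt G (one G m) v"
  by (simp add: lie_class_def)

lemma lie_class_tone [simp]: "lie_class G m (tone G m w) = 0"
  by (simp add: lie_class_def)

lemma lie_class_in_LieA: "lie_class G m v \<in> LieA G m"
  by (simp add: LieA_def)

lemma lie_class_LieA: "\<xi> \<in> LieA G m \<Longrightarrow> lie_class G m \<xi> = \<xi>"
  by (simp add: lie_class_def LieA_def)

lemma A_dual_lie_class:
  assumes "\<phi> \<in> A_dual G m"
  shows "blinfun_apply \<phi> (lie_class G m v) = blinfun_apply \<phi> v"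
  using assms by (simp add: A_dual_def lie_class_def blinfun.diff_right)

lemma A_dual_tmul:
  assumes "\<phi> \<in> A_dual G m" "tsrc G (one G m) x = ttgt G (one G m) y"
  shows "blinfun_apply \<phi> (tmul G (one G m) x (one G m) y) = blinfun_apply \<phi> x + blinfun_apply \<phi> y"
  using assms by (simp add: unit_tmul A_dual_def blinfun.diff_right blinfun.add_right)

section \<open>The dual of the Lie algebroid and the cotangent groupoid\<close>

lemma A_dual_of_eqI:
  assumes "\<phi> \<in> A_dual G m" "\<And>\<xi>. \<xi> \<in> LieA G m \<Longrightarrow> blinfun_apply \<phi> \<xi> = F \<xi>"
  shows "A_dual_of G m F = \<phi>"
  unfolding A_dual_of_def
proof (rule the_equality)
  show "\<phi> \<in> A_dual G m \<and> (\<forall>\<xi>\<in>LieA G m. blinfun_apply \<phi> \<xi> = F \<xi>)" using assms by blast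
  fix \<psi> assume \<psi>: "\<psi> \<in> A_dual G m \<and> (\<forall>\<xi>\<in>LieA G m. blinfun_apply \<psi> \<xi> = F \<xi>)"
  show "\<psi> = \<phi>"
  proof (rule blinfun_eqI)
    fix v
    have "blinfun_apply \<psi> (lie_class G m v) = blinfun_apply \<phi> (lie_class G m v)"
      using \<psi> assms(2) lie_class_in_LieA by simp
    then show "blinfun_apply \<psi> v = blinfun_apply \<phi> v"
      using \<psi> assms(1) by (simp add: A_dual_lie_class)
  qed
qed

text \<open>\<open>F\<close> is linear only on \<open>LieA G m\<close>. Precomposing with
  \<open>lie_class\<close>, the projection along the unit vectors, extends it to a covector that
  kills the units.\<close>

lemma A_dual_of:
  assumes "\<And>\<xi> \<eta> a b. \<xi> \<in> LieA G m \<Longrightarrow> \<eta> \<in> LieA G m \<Longrightarrow> F (a *\<^sub>R \<xi> + b *\<^sub>R \<eta>) = a * F \<xi> + b * F \<eta>"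
  shows "A_dual_of G m F \<in> A_dual G m"
    and "\<xi> \<in> LieA G m \<Longrightarrow> blinfun_apply (A_dual_of G m F) \<xi> = F \<xi>"
proof -
  note L = linear_lie_class[THEN linear_add] linear_lie_class[THEN linear_scale]
  have F0: "F 0 = 0" using assms[of 0 0 0 0] by (simp add: LieA_def)
  have "linear (\<lambda>v. F (lie_class G m v))"
  proof (rule linearI)
    show "F (lie_class G m (x + y)) = F (lie_class G m x) + F (lie_class G m y)" for x y
      using assms[OF lie_class_in_LieA[of m x] lie_class_in_LieA[of m y], of 1 1] by (simp add: L)
    show "F (lie_class G m (r *\<^sub>R x)) = r *\<^sub>R F (lie_class G m x)" for r x
      using assms[OF lie_class_in_LieA[of m x] lie_class_in_LieA[of m x], of r 0] by (simp add: L)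
  qed
  from finite_dim_exists_dual[OF finite_dim_models(1) this] obtain \<phi> :: "'u dual" where \<phi>: "\<And>v. blinfun_apply \<phi> v = F (lie_class G m v)"
    by blast
  have 1: "\<phi> \<in> A_dual G m" by (simp add: A_dual_def \<phi> F0)
  moreover have 2: "blinfun_apply \<phi> \<xi> = F \<xi>" if "\<xi> \<in> LieA G m" for \<xi>
    using that by (simp add: \<phi> lie_class_LieA)
  ultimately have "A_dual_of G m F = \<phi>" by (rule A_dual_of_eqI)
  then show "A_dual_of G m F \<in> A_dual G m"
    "\<xi> \<in> LieA G m \<Longrightarrow> blinfun_apply (A_dual_of G m F) \<xi> = F \<xi>"
    using 1 2 by auto
qed

lemma csrc_eqI:
  assumes "\<phi> \<in> A_dual G (src G g)"
    and "\<And>v w. tsrc G g v = ttgt G (one G (src G g)) w \<Longrightarrow>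
      blinfun_apply \<mu> (tmul G g v (one G (src G g)) w) = blinfun_apply \<mu> v + blinfun_apply \<phi> w"
  shows "csrc G g \<mu> = \<phi>"
  unfolding csrc_def
proof (rule the_equality)
  fix \<psi> assume \<psi>: "\<psi> \<in> A_dual G (src G g) \<and> (\<forall>v w. tsrc G g v = ttgt G (one G (src G g)) w \<longrightarrow>
      blinfun_apply \<mu> (tmul G g v (one G (src G g)) w) = blinfun_apply \<mu> v + blinfun_apply \<psi> w)"
  show "\<psi> = \<phi>"
  proof (rule blinfun_eqI)
    fix w
    obtain v where "tsrc G g v = ttgt G (one G (src G g)) w" by (metis surj_tsrc surj_def)
    then show "blinfun_apply \<psi> w = blinfun_apply \<phi> w" using \<psi> assms(2) by (metis add_left_cancel)
  qed
qed (use assms in blast)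

text \<open>The zero vector at \<open>g\<close> can be followed by any vector with target 0, so the
  source covector is read off from products of 0 with \<open>lie_class\<close>. A general pair
  splits into a product with a unit vector and such a product.\<close>

lemma csrc: "csrc G g \<mu> \<in> A_dual G (src G g)"
  and csrc_tmul: "tsrc G g v = ttgt G (one G (src G g)) w \<Longrightarrow>
    blinfun_apply \<mu> (tmul G g v (one G (src G g)) w) = blinfun_apply \<mu> v + blinfun_apply (csrc G g \<mu>) w"
proof -
  let ?e = "one G (src G g)"
  have "linear (\<lambda>w. tmul G g 0 ?e (lie_class G (src G g) w))"
    by (rule linear_tmul) (simp_all add: linear_lie_class real_vector.linear_zero)
  then have "linear (\<lambda>w. blinfun_apply \<mu> (tmul G g 0 ?e (lie_class G (src G g) w)))"
    using linear_compose[unfolded o_def] bounded_linear.linear[OF blinfun.bounded_linear_right] by blast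
  from finite_dim_exists_dual[OF finite_dim_models(1) this] obtain \<phi> :: "'u dual" where \<phi>: "\<And>w. blinfun_apply \<phi> w = blinfun_apply \<mu> (tmul G g 0 ?e (lie_class G (src G g) w))"
    by blast
  have "tmul G g 0 ?e 0 = 0" using mul_one[of g] tmul_tone[of g 0] by simp
  then have 1: "\<phi> \<in> A_dual G (src G g)" by (simp add: A_dual_def \<phi> blinfun.zero_right)
  have 2: "blinfun_apply \<mu> (tmul G g v ?e w) = blinfun_apply \<mu> v + blinfun_apply \<phi> w"
    if "tsrc G g v = ttgt G ?e w" for v w
  proof -
    have "tmul G g (v + 0) ?e (tone G (src G g) (tsrc G g v) + lie_class G (src G g) w) =
        tmul G g v ?e (tone G (src G g) (tsrc G g v)) + tmul G g 0 ?e (lie_class G (src G g) w)"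
      by (rule tmul_add) simp_all
    moreover have "tone G (src G g) (tsrc G g v) + lie_class G (src G g) w = w"
      by (simp add: that lie_class_def)
    ultimately show ?thesis by (simp add: \<phi> blinfun.add_right)
  qed
  have eq: "csrc G g \<mu> = \<phi>" using 1 2 by (rule csrc_eqI)
  show "csrc G g \<mu> \<in> A_dual G (src G g)" using 1 eq by simp
  show "tsrc G g v = ttgt G ?e w \<Longrightarrow>
    blinfun_apply \<mu> (tmul G g v ?e w) = blinfun_apply \<mu> v + blinfun_apply (csrc G g \<mu>) w"
    using 2 eq by simp
qed

text \<open>The mirror image of the source covector. The unit vector now stands on the left, so the
  splitting projects onto the kernel of the source map instead of using
  \<open>lie_class\<close>.\<close>

lemma ctgt: "ctgt G g \<mu> \<in> A_dual G (tgt G g)"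
  and ctgt_tmul: "tsrc G (one G (tgt G g)) w = ttgt G g v \<Longrightarrow>
    blinfun_apply \<mu> (tmul G (one G (tgt G g)) w g v) = blinfun_apply (ctgt G g \<mu>) w + blinfun_apply \<mu> v"
proof -
  let ?m = "tgt G g" let ?e = "one G ?m"
  let ?k = "\<lambda>w. w - tone G ?m (tsrc G ?e w)"
  have "linear (\<lambda>w. tmul G ?e (?k w) g 0)"
    by (rule linear_tmul) (auto intro!: linearI simp: algebra_simps)
  then have "linear (\<lambda>w. blinfun_apply \<mu> (tmul G ?e (?k w) g 0))"
    using linear_compose[unfolded o_def] bounded_linear.linear[OF blinfun.bounded_linear_right] by blast
  from finite_dim_exists_dual[OF finite_dim_models(1) this] obtain \<phi> :: "'u dual" where \<phi>: "\<And>w. blinfun_apply \<phi> w = blinfun_apply \<mu> (tmul G ?e (?k w) g 0)"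
    by blast
  have "tmul G ?e 0 g 0 = 0" using tone_tmul[of g 0] by simp
  then have 1: "\<phi> \<in> A_dual G ?m" by (simp add: A_dual_def \<phi> blinfun.zero_right)
  have 2: "blinfun_apply \<mu> (tmul G ?e w g v) = blinfun_apply \<phi> w + blinfun_apply \<mu> v"
    if "tsrc G ?e w = ttgt G g v" for v w
  proof -
    have "tmul G ?e (?k w + tone G ?m (ttgt G g v)) g (0 + v) = tmul G ?e (?k w) g 0 + tmul G ?e (tone G ?m (ttgt G g v)) g v"
      by (rule tmul_add) simp_all
    then show ?thesis by (simp add: that \<phi> blinfun.add_right)
  qed
  have eq: "ctgt G g \<mu> = \<phi>"
    unfolding ctgt_def
  proof (rule the_equality)
    fix \<psi> assume \<psi>: "\<psi> \<in> A_dual G ?m \<and> (\<forall>v w. tsrc G ?e w = ttgt G g v \<longrightarrow>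
        blinfun_apply \<mu> (tmul G ?e w g v) = blinfun_apply \<psi> w + blinfun_apply \<mu> v)"
    show "\<psi> = \<phi>"
    proof (rule blinfun_eqI)
      fix w
      obtain v where "tsrc G ?e w = ttgt G g v" by (metis surj_ttgt surj_def)
      then show "blinfun_apply \<psi> w = blinfun_apply \<phi> w" using \<psi> 2 by (metis add_right_cancel)
    qed
  qed (use 1 2 in blast)
  show "ctgt G g \<mu> \<in> A_dual G ?m" using 1 eq by simp
  show "tsrc G ?e w = ttgt G g v \<Longrightarrow>
    blinfun_apply \<mu> (tmul G ?e w g v) = blinfun_apply (ctgt G g \<mu>) w + blinfun_apply \<mu> v"
    using 2 eq by simp
qed

lemma ttgt_section: "\<exists>\<tau>. linear \<tau> \<and> (\<forall>w. ttgt G g (\<tau> w) = w)"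
proof -
  obtain \<tau> where "linear \<tau>" "ttgt G g \<circ> \<tau> = id"
    using real_vector.linear_surjective_right_inverse[of "ttgt G g"] linear_tangent_maps(2) surj_ttgt
    unfolding linear_def by metis
  then show ?thesis by (metis comp_apply id_apply)
qed

text \<open>Every \<open>u\<close> over the product factors linearly as \<open>f u\<close> composed
  with \<open>k u\<close>, where \<open>f u\<close> is a lift of its target and \<open>k u\<close>
  the quotient; this defines \<open>\<kappa>\<close>. For another factorization with difference
  \<open>z\<close>, the value of \<open>\<mu>\<close> changes by \<open>csrc\<close> and that of
  \<open>\<nu>\<close> by \<open>ctgt\<close>, both at \<open>z\<close>, and these agree by
  assumption.\<close>

lemma cmul_tmul:
  assumes gh: "src G g = tgt G h" and c: "csrc G g \<mu> = ctgt G h \<nu>" and vw: "tsrc G g v = ttgt G h w"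
  shows "blinfun_apply (cmul G g \<mu> h \<nu>) (tmul G g v h w) = blinfun_apply \<mu> v + blinfun_apply \<nu> w"
proof -
  let ?e = "one G (src G g)"
  obtain \<tau> where \<tau>: "linear \<tau>" "\<And>w. ttgt G g (\<tau> w) = w" using ttgt_section by blast
  define f where "f u = \<tau> (ttgt G (mul G g h) u)" for u
  define k where "k u = tmul G (ginv G g) (tinv G g (f u)) (mul G g h) u" for u
  have f: "linear f" unfolding f_def
    using linear_compose[OF linear_tangent_maps(2) \<tau>(1)] by (simp add: o_def)
  have "linear (\<lambda>u. tinv G g (f u))"
    using linear_compose[OF f linear_tangent_maps(4)] by (simp add: o_def)
  then have "linear k" unfolding k_def
    by (intro linear_tmul) (simp_all add: gh f_def \<tau> linear_id[unfolded id_def])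
  with f have "linear (\<lambda>u. blinfun_apply \<mu> (f u) + blinfun_apply \<nu> (k u))"
    by (intro linearI) (simp_all add: linear_add linear_scale blinfun.add_right blinfun.scaleR_right algebra_simps)
  from finite_dim_exists_dual[OF finite_dim_models(1) this] obtain \<kappa> :: "'u dual" where \<kappa>: "\<And>u. blinfun_apply \<kappa> u = blinfun_apply \<mu> (f u) + blinfun_apply \<nu> (k u)"
    by blast
  have 1: "blinfun_apply \<kappa> (tmul G g v h w) = blinfun_apply \<mu> v + blinfun_apply \<nu> w"
    if vw: "tsrc G g v = ttgt G h w" for v w
  proof -
    define v' where "v' = f (tmul G g v h w)"
    have v': "ttgt G g v' = ttgt G g v" using vw gh by (simp add: v'_def f_def \<tau>)
    define z where "z = tmul G (ginv G g) (tinv G g v') g v"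
    note z = tgt_difference[OF v', folded z_def]
    have "tmul G (mul G (ginv G g) g) (tmul G (ginv G g) (tinv G g v') g v) h w = k (tmul G g v h w)"
      unfolding k_def v'_def[symmetric] by (rule tmul_assoc) (use gh v' vw in simp_all)
    then have "tmul G ?e z h w = k (tmul G g v h w)" by (simp add: z_def)
    moreover have "blinfun_apply \<nu> (tmul G ?e z h w) = blinfun_apply (csrc G g \<mu>) z + blinfun_apply \<nu> w"
      using ctgt_tmul[of h z w \<nu>] z(3) vw gh c by simp
    moreover have "blinfun_apply \<mu> v = blinfun_apply \<mu> v' + blinfun_apply (csrc G g \<mu>) z"
      using csrc_tmul[of g v' z \<mu>] z by simp
    ultimately show ?thesis by (simp add: \<kappa> v'_def[symmetric])
  qed
  have "cmul G g \<mu> h \<nu> = \<kappa>"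
    unfolding cmul_def
  proof (rule the_equality)
    fix \<psi> assume \<psi>: "\<forall>v w. tsrc G g v = ttgt G h w \<longrightarrow>
        blinfun_apply \<psi> (tmul G g v h w) = blinfun_apply \<mu> v + blinfun_apply \<nu> w"
    show "\<psi> = \<kappa>"
    proof (rule blinfun_eqI)
      fix u
      have "tmul G (mul G g (ginv G g)) (tmul G g (f u) (ginv G g) (tinv G g (f u))) (mul G g h) u =
          tmul G g (f u) (mul G (ginv G g) (mul G g h)) (k u)"
        unfolding k_def by (rule tmul_assoc) (simp_all add: gh f_def \<tau>)
      moreover have "mul G (ginv G g) (mul G g h) = h"
        using mul_assoc[of "ginv G g" g h] gh by simp
      moreover have "tmul G (one G (tgt G g)) (tone G (tgt G g) (ttgt G (mul G g h) u)) (mul G g h) u = u"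
        using tone_tmul[of "mul G g h" u] gh by simp
      ultimately have u: "u = tmul G g (f u) h (k u)" by (simp add: f_def \<tau>)
      have "ttgt G (mul G (ginv G g) (mul G g h)) (k u) = tsrc G g (f u)"
        unfolding k_def by (subst ttgt_tmul) (simp_all add: gh f_def \<tau>)
      then have "tsrc G g (f u) = ttgt G h (k u)"
        using \<open>mul G (ginv G g) (mul G g h) = h\<close> by simp
      then show "blinfun_apply \<psi> u = blinfun_apply \<kappa> u"
        using \<psi> 1 u by metis
    qed
  qed (use 1 in blast)
  then show ?thesis using 1[OF vw] by simp
qed

section \<open>Jets, their inverses and translation along them\<close>

lemma jet_sections:
  assumes "jet G g H"
  shows "\<exists>\<sigma>. linear \<sigma> \<and> (\<forall>w. \<sigma> w \<in> H \<and> tsrc G g (\<sigma> w) = w) \<and> (\<forall>h\<in>H. \<sigma> (tsrc G g h) = h)"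
    and "\<exists>\<rho>. linear \<rho> \<and> (\<forall>w. \<rho> w \<in> H \<and> ttgt G g (\<rho> w) = w) \<and> (\<forall>h\<in>H. \<rho> (ttgt G g h) = h)"
  using assms complementary_section[OF linear_tangent_maps(1) surj_tsrc]
    complementary_section[OF linear_tangent_maps(2) surj_ttgt]
  by (auto simp: jet_def)

text \<open>Inversion interchanges source and target, hence the two complementarity conditions. The
  fact \<open>compl\<close> transports either of them.\<close>

lemma jet_jinv:
  assumes "jet G g H"
  shows "jet G (ginv G g) (jinv G g H)"
proof -
  have inv: "tinv G g (tinv G (ginv G g) x) = x" for x using tinv_tinv[of "ginv G g" x] by simp
  have compl: "complementary (tinv G g ` H) {v. f v = 0}"
    if H: "complementary H {v. f' v = 0}" and f: "\<And>v. f (tinv G g v) = f' v" for f f' :: "'u \<Rightarrow> 'v"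
    unfolding complementary_def
  proof
    have H': "h = 0" if "h \<in> H" "f' h = 0" for h
      using H that by (auto simp: complementary_def)
    have H0: "0 \<in> H" "f' 0 = 0" using H by (auto simp: complementary_def)
    have 0: "tinv G g 0 = 0" by simp
    show "tinv G g ` H \<inter> {v. f v = 0} = {0}"
    proof (intro equalityI subsetI)
      fix x assume "x \<in> tinv G g ` H \<inter> {v. f v = 0}"
      then obtain h where "h \<in> H" "f' h = 0" "x = tinv G g h" using f by auto
      then show "x \<in> {0}" using H'[of h] 0 by simp
    next
      fix x :: 'u assume "x \<in> {0}"
      then show "x \<in> tinv G g ` H \<inter> {v. f v = 0}"
        using f[of 0] imageI[OF H0(1), of "tinv G g"] H0(2) 0 by simp
    qed
    show "\<forall>x. \<exists>h\<in>tinv G g ` H. \<exists>k\<in>{v. f v = 0}. x = h + k"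
    proof
      fix x
      obtain h k where "h \<in> H" "f' k = 0" "tinv G (ginv G g) x = h + k"
        using H unfolding complementary_def by blast
      then have "x = tinv G g h + tinv G g k" "f (tinv G g k) = 0"
        using inv[of x] f by simp_all
      then show "\<exists>h\<in>tinv G g ` H. \<exists>k\<in>{v. f v = 0}. x = h + k"
        using \<open>h \<in> H\<close> by blast
    qed
  qed
  show ?thesis
    using assms linear_subspace_image[OF linear_tangent_maps(4)]
      compl[of "tsrc G g" "ttgt G (ginv G g)"] compl[of "ttgt G g" "tsrc G (ginv G g)"]
    by (simp add: jet_def jinv_def)
qed

text \<open>An element of \<open>H\<close> is determined by its source, so composable factors from
  \<open>H\<close> and its inverse are mutually inverse, and their product is a unit vector. All
  unit vectors arise because \<open>H\<close> surjects under the target map.\<close>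

lemma jmul_jinv:
  assumes "jet G g H"
  shows "jmul G g H (ginv G g) (jinv G g H) = jone G (tgt G g)"
proof -
  obtain \<sigma> where \<sigma>: "\<And>h. h \<in> H \<Longrightarrow> \<sigma> (tsrc G g h) = h" using jet_sections(1)[OF assms] by blast
  obtain \<rho> where \<rho>: "\<And>w. \<rho> w \<in> H" "\<And>w. ttgt G g (\<rho> w) = w" using jet_sections(2)[OF assms] by blast
  have "tmul G g v (ginv G g) (tinv G g w) \<in> range (tone G (tgt G g))"
    if "v \<in> H" "w \<in> H" "tsrc G g v = tsrc G g w" for v w
  proof -
    have "v = w" using that \<sigma> by metis
    then show ?thesis by simp
  qed
  moreover have "\<exists>v w. tone G (tgt G g) x = tmul G g v (ginv G g) w \<and> v \<in> H \<and> w \<in> tinv G g ` H \<and>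
      tsrc G g v = ttgt G (ginv G g) w" for x
    by (rule exI[of _ "\<rho> x"], rule exI[of _ "tinv G g (\<rho> x)"]) (simp add: \<rho>)
  ultimately show ?thesis
    unfolding jmul_def jone_def jinv_def by auto
qed

lemma jleft_T_jinv:
  assumes H: "jet G g H" and h: "h \<in> H" "ttgt G g h = ttgt G g v"
  shows "jleft_T G (ginv G g) (jinv G g H) g v = tmul G (ginv G g) (tinv G g h) g v"
proof -
  obtain \<rho> where \<rho>: "\<And>h. h \<in> H \<Longrightarrow> \<rho> (ttgt G g h) = h" using jet_sections(2)[OF H] by blast
  have "(THE u. u \<in> jinv G g H \<and> tsrc G (ginv G g) u = ttgt G g v) = tinv G g h"
  proof (rule the_equality)
    show "tinv G g h \<in> jinv G g H \<and> tsrc G (ginv G g) (tinv G g h) = ttgt G g v"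
      using h by (simp add: jinv_def)
    show "u = tinv G g h" if "u \<in> jinv G g H \<and> tsrc G (ginv G g) u = ttgt G g v" for u
      using that \<rho> h by (auto simp: jinv_def) metis
  qed
  then show ?thesis by (simp add: jleft_T_def)
qed

text \<open>Each \<open>v\<close> equals an element of \<open>H\<close> composed with
  \<open>z v\<close>, so a covector killing \<open>H\<close> with source \<open>\<psi>\<close> must
  be \<open>\<psi>\<close> evaluated on \<open>z v\<close>. It has this source because
  \<open>z\<close> commutes with right multiplication at units and \<open>\<psi>\<close> is additive
  there. This justifies the description inside \<open>jleft_C\<close>.\<close>

lemma exists_annihilating_covector:
  assumes H: "jet G g H" and \<psi>: "\<psi> \<in> A_dual G (src G g)"
  shows "\<exists>!\<nu>. \<nu> \<in> ann H \<and> csrc G g \<nu> = \<psi>"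
proof -
  let ?e = "one G (src G g)"
  obtain \<rho> where \<rho>: "linear \<rho>" "\<And>w. \<rho> w \<in> H" "\<And>w. ttgt G g (\<rho> w) = w" "\<And>h. h \<in> H \<Longrightarrow> \<rho> (ttgt G g h) = h"
    using jet_sections(2)[OF H] by blast
  define z where "z v = tmul G (ginv G g) (tinv G g (\<rho> (ttgt G g v))) g v" for v
  have z: "tmul G g (\<rho> (ttgt G g v)) ?e (z v) = v" "ttgt G ?e (z v) = tsrc G g (\<rho> (ttgt G g v))"
      "tsrc G ?e (z v) = tsrc G g v" for v
    unfolding z_def by (rule tgt_difference, simp add: \<rho>)+
  have "linear (\<lambda>v. tinv G g (\<rho> (ttgt G g v)))"
    using linear_compose[OF linear_compose[OF linear_tangent_maps(2) \<rho>(1)] linear_tangent_maps(4)]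
    by (simp add: o_def)
  then have "linear z"
    unfolding z_def by (intro linear_tmul) (simp_all add: \<rho> linear_id[unfolded id_def])
  then have "linear (\<lambda>v. blinfun_apply \<psi> (z v))"
    by (intro linearI) (simp_all add: linear_add linear_scale blinfun.add_right blinfun.scaleR_right)
  from finite_dim_exists_dual[OF finite_dim_models(1) this] obtain \<nu> :: "'u dual" where \<nu>: "\<And>v. blinfun_apply \<nu> v = blinfun_apply \<psi> (z v)"
    by blast
  show ?thesis
  proof (rule ex1I[of _ \<nu>])
    have "blinfun_apply \<nu> h = 0" if "h \<in> H" for h
      using \<psi> that by (simp add: \<nu> z_def \<rho> A_dual_def)
    then have "\<nu> \<in> ann H" by (simp add: ann_def)
    moreover have "csrc G g \<nu> = \<psi>"
    proof (rule csrc_eqI[OF \<psi>])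
      fix v w assume vw: "tsrc G g v = ttgt G ?e w"
      let ?k = "\<rho> (ttgt G g v)"
      have t: "ttgt G g (tmul G g v ?e w) = ttgt G g v"
        using ttgt_tmul[of g ?e v w] vw by simp
      have "tmul G (mul G (ginv G g) g) (tmul G (ginv G g) (tinv G g ?k) g v) ?e w =
          tmul G (ginv G g) (tinv G g ?k) (mul G g ?e) (tmul G g v ?e w)"
        by (rule tmul_assoc) (simp_all add: \<rho> vw)
      then have "z (tmul G g v ?e w) = tmul G ?e (z v) ?e w"
        by (simp add: z_def t)
      then show "blinfun_apply \<nu> (tmul G g v ?e w) = blinfun_apply \<nu> v + blinfun_apply \<psi> w"
        using A_dual_tmul[OF \<psi>, of "z v" w] z(3)[of v] vw by (simp add: \<nu>)
    qed
    ultimately show "\<nu> \<in> ann H \<and> csrc G g \<nu> = \<psi>" by blast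
    fix \<nu>' assume \<nu>': "\<nu>' \<in> ann H \<and> csrc G g \<nu>' = \<psi>"
    show "\<nu>' = \<nu>"
    proof (rule blinfun_eqI)
      fix v
      have "blinfun_apply \<nu>' (\<rho> (ttgt G g v)) = 0" using \<nu>' \<rho>(2) by (simp add: ann_def)
      then show "blinfun_apply \<nu>' v = blinfun_apply \<nu> v"
        using csrc_tmul[of g "\<rho> (ttgt G g v)" "z v" \<nu>'] z \<nu>' by (simp add: \<nu>)
    qed
  qed
qed

text \<open>The unit vector over the source of \<open>h\<close> is the inverse of \<open>h\<close>
  composed with \<open>h\<close>; the annihilating factor vanishes on the inverse, leaving
  \<open>\<mu>\<close>. This computes the covector part of the core class.\<close>

lemma jleft_C_jinv_tone:
  assumes H: "jet G g H" and h: "h \<in> H"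
  shows "blinfun_apply (jleft_C G (ginv G g) (jinv G g H) g \<mu>) (tone G (src G g) (tsrc G g h)) = blinfun_apply \<mu> h"
proof -
  have "ctgt G g \<mu> \<in> A_dual G (src G (ginv G g))" using ctgt by simp
  from theI'[OF exists_annihilating_covector[OF jet_jinv[OF H] this]]
  obtain \<nu> where \<nu>: "\<nu> \<in> ann (jinv G g H)" "csrc G (ginv G g) \<nu> = ctgt G g \<mu>"
    and eq: "jleft_C G (ginv G g) (jinv G g H) g \<mu> = cmul G (ginv G g) \<nu> g \<mu>"
    by (auto simp: jleft_C_def)
  have "blinfun_apply \<nu> (tinv G g h) = 0" using \<nu>(1) h by (auto simp: ann_def jinv_def)
  then show ?thesis
    using cmul_tmul[OF _ \<nu>(2), of "tinv G g h" h] by (simp add: eq)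
qed

end

section \<open>The tangent action\<close>

locale tangent_action = tangent_groupoid G
  for G :: "('g::{t2_space,second_countable_topology}, 'u::banach,
    'm::{t2_space,second_countable_topology}, 'v::banach) groupoid" +
  fixes P :: "('p::{t2_space,second_countable_topology}, 'w::banach, 'g, 'm) gspace"
  assumes groupoid_action: "groupoid_action G P"
begin

lemma manifold_pmfd: "manifold (pmfd P)"
  and smooth_mom: "smooth_map (pmfd P) (objects G) (mom P)"
  and smooth_gact: "smooth_map_on (prod_mfd (arrows G) (pmfd P)) (pmfd P) (act_dom G P) (\<lambda>(g, p). gact P g p)"
  and mom_gact [simp]: "src G g = mom P p \<Longrightarrow> mom P (gact P g p) = tgt G g"
  and gact_one [simp]: "gact P (one G (mom P p)) p = p"
  and gact_mul: "src G g = tgt G h \<Longrightarrow> src G h = mom P p \<Longrightarrow> gact P (mul G g h) p = gact P g (gact P h p)"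
  using groupoid_action unfolding groupoid_action_def by blast+

lemma inj_chart_act: "inj_on (chart (prod_mfd (arrows G) (pmfd P)) x) (cdom (prod_mfd (arrows G) (pmfd P)) x)"
  by (intro inj_on_chart_prod manifold_inj manifolds manifold_pmfd)

lemma has_velocity_mom:
  "has_velocity (pmfd P) \<gamma> w \<Longrightarrow> \<gamma> 0 = p \<Longrightarrow> has_velocity (objects G) (\<lambda>t. mom P (\<gamma> t)) (tmom G P p w)"
  using tmap_on_velocity[OF smooth_mom manifold_inj[OF manifold_pmfd] manifolds(2), of \<gamma> w]
  by (simp add: tmom_def o_def)

lemma has_velocity_gact:
  assumes "has_velocity (arrows G) \<gamma> v" "has_velocity (pmfd P) \<delta> w"
    and "\<gamma> 0 = g" "\<delta> 0 = p" "\<And>t. src G (\<gamma> t) = mom P (\<delta> t)"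
  shows "has_velocity (pmfd P) (\<lambda>t. gact P (\<gamma> t) (\<delta> t)) (tact G P g v p w)"
  using tmap_on_velocity[OF smooth_gact inj_chart_act manifold_pmfd _ has_velocity_prod[OF assms(1,2)]] assms(3-)
  by (auto simp: tact_def o_def act_dom_def)

lemma action_curves:
  assumes "src G g = mom P p" "tsrc G g v = tmom G P p w"
  obtains \<gamma> \<delta> where "\<gamma> 0 = g" "\<delta> 0 = p" "has_velocity (arrows G) \<gamma> v" "has_velocity (pmfd P) \<delta> w"
    "\<And>t. src G (\<gamma> t) = mom P (\<delta> t)"
proof -
  obtain \<delta> where \<delta>: "\<delta> 0 = p" "has_velocity (pmfd P) \<delta> w" using exists_curve[OF manifold_pmfd] by blast
  have "has_velocity (objects G) (\<lambda>t. mom P (\<delta> t)) (tsrc G g v)"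
    using has_velocity_mom[OF \<delta>(2,1)] assms(2) by simp
  then obtain \<gamma> where "\<gamma> 0 = g" "has_velocity (arrows G) \<gamma> v" "\<forall>t. src G (\<gamma> t) = mom P (\<delta> t)"
    using lift_src \<delta>(1) assms(1) by metis
  then show thesis using \<delta> that by blast
qed

lemma linear_tmom: "linear (tmom G P p)"
proof -
  have "tmom G P p = tmap (pmfd P) (objects G) (mom P) p"
    by (simp add: fun_eq_iff tmom_def)
  then show ?thesis
    using tmap_bounded_linear[OF smooth_mom manifold_pmfd manifolds(2)] bounded_linear.linear by metis
qed

lemmas tmom_simps [simp] =
  linear_tmom[THEN linear_add] linear_tmom[THEN linear_diff] linear_tmom[THEN linear_scale] linear_tmom[THEN linear_0]

lemma tmom_tact [simp]:
  assumes "src G g = mom P p" "tsrc G g v = tmom G P p w"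
  shows "tmom G P (gact P g p) (tact G P g v p w) = ttgt G g v"
proof -
  obtain \<gamma> \<delta> where c: "\<gamma> 0 = g" "\<delta> 0 = p" "has_velocity (arrows G) \<gamma> v" "has_velocity (pmfd P) \<delta> w"
    "\<And>t. src G (\<gamma> t) = mom P (\<delta> t)"
    using action_curves[OF assms] by metis
  note v = has_velocity_gact[OF c(3,4,1,2,5)]
  show ?thesis
    using has_velocity_mom[OF v] has_velocity_tgt[OF c(3,1)] c(1,2,5) has_velocity_unique by auto
qed

lemma tact_tmul:
  assumes "src G g = tgt G h" "src G h = mom P p" "tsrc G g v = ttgt G h w" "tsrc G h w = tmom G P p x"
  shows "tact G P (mul G g h) (tmul G g v h w) p x = tact G P g v (gact P h p) (tact G P h w p x)"
proof -
  obtain \<delta> \<epsilon> where c: "\<delta> 0 = h" "\<epsilon> 0 = p" "has_velocity (arrows G) \<delta> w" "has_velocity (pmfd P) \<epsilon> x"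
    "\<And>t. src G (\<delta> t) = mom P (\<epsilon> t)"
    using action_curves[OF assms(2,4)] by metis
  have "has_velocity (objects G) (\<lambda>t. tgt G (\<delta> t)) (tsrc G g v)"
    using has_velocity_tgt[OF c(3,1)] assms(3) by simp
  then obtain \<gamma> where d: "\<gamma> 0 = g" "has_velocity (arrows G) \<gamma> v" "\<And>t. src G (\<gamma> t) = tgt G (\<delta> t)"
    using lift_src c(1) assms(1) by metis
  have "has_velocity (pmfd P) (\<lambda>t. gact P (mul G (\<gamma> t) (\<delta> t)) (\<epsilon> t)) (tact G P (mul G g h) (tmul G g v h w) p x)"
    by (intro has_velocity_gact has_velocity_mul c d) (simp_all add: c d)
  moreover have "has_velocity (pmfd P) (\<lambda>t. gact P (\<gamma> t) (gact P (\<delta> t) (\<epsilon> t))) (tact G P g v (gact P h p) (tact G P h w p x))"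
    by (intro has_velocity_gact c d) (simp_all add: c d)
  ultimately show ?thesis
    using has_velocity_unique by (simp add: gact_mul c d)
qed

lemma tact_tone [simp]: "tact G P (one G (mom P p)) (tone G (mom P p) (tmom G P p w)) p w = w"
proof -
  obtain \<gamma> where c: "\<gamma> 0 = p" "has_velocity (pmfd P) \<gamma> w" using exists_curve[OF manifold_pmfd] by blast
  have o: "has_velocity (arrows G) (\<lambda>t. one G (mom P (\<gamma> t))) (tone G (mom P p) (tmom G P p w))"
    by (rule has_velocity_one[OF has_velocity_mom[OF c(2,1)]]) (simp add: c)
  show ?thesis
    using has_velocity_unique[OF has_velocity_gact[OF o c(2), of "one G (mom P p)" p]] c by simp
qed

lemma tact_bounded_linear:
  assumes "src G g = mom P p"
  shows "\<exists>D. bounded_linear D \<and> (\<forall>v w. tsrc G g v = tmom G P p w \<longrightarrow> tact G P g v p w = D (v, w))"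
proof -
  have gp: "(g, p) \<in> act_dom G P" using assms by (simp add: act_dom_def)
  obtain D where D: "bounded_linear D"
    "\<forall>\<gamma> v. \<gamma> 0 = (g, p) \<and> range \<gamma> \<subseteq> act_dom G P \<and> has_velocity (prod_mfd (arrows G) (pmfd P)) \<gamma> v \<longrightarrow>
      tmap_on (prod_mfd (arrows G) (pmfd P)) (pmfd P) (act_dom G P) (\<lambda>(g, p). gact P g p) (g, p) v = D v \<and>
      has_velocity (pmfd P) ((\<lambda>(g, p). gact P g p) \<circ> \<gamma>) (D v)"
    using tmap_on_bounded_linear[OF smooth_gact gp inj_chart_act manifold_pmfd] by (elim exE conjE) (rule that)
  have "tact G P g v p w = D (v, w)" if vw: "tsrc G g v = tmom G P p w" for v w
  proof -
    obtain \<gamma> \<delta> where c: "\<gamma> 0 = g" "\<delta> 0 = p" "has_velocity (arrows G) \<gamma> v" "has_velocity (pmfd P) \<delta> w"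
      "\<And>t. src G (\<gamma> t) = mom P (\<delta> t)"
      using action_curves[OF assms vw] by metis
    have "has_velocity (prod_mfd (arrows G) (pmfd P)) (\<lambda>t. (\<gamma> t, \<delta> t)) (v, w)"
      by (rule has_velocity_prod[OF c(3,4)])
    then show ?thesis
      using D(2)[rule_format, of "\<lambda>t. (\<gamma> t, \<delta> t)" "(v, w)"] c(1,2,5)
      by (auto simp: tact_def act_dom_def)
  qed
  then show ?thesis using D(1) by blast
qed

lemma tact_add:
  assumes "src G g = mom P p" "tsrc G g v = tmom G P p w" "tsrc G g v' = tmom G P p w'"
  shows "tact G P g (v + v') p (w + w') = tact G P g v p w + tact G P g v' p w'"
proof -
  obtain D where D: "bounded_linear D" "\<And>v w. tsrc G g v = tmom G P p w \<Longrightarrow> tact G P g v p w = D (v, w)"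
    using tact_bounded_linear[OF assms(1)] by blast
  then show ?thesis
    using assms linear_add[OF bounded_linear.linear[OF D(1)], of "(v, w)" "(v', w')"] by simp
qed

lemma tact_scale:
  assumes "src G g = mom P p" "tsrc G g v = tmom G P p w"
  shows "tact G P g (r *\<^sub>R v) p (r *\<^sub>R w) = r *\<^sub>R tact G P g v p w"
proof -
  obtain D where D: "bounded_linear D" "\<And>v w. tsrc G g v = tmom G P p w \<Longrightarrow> tact G P g v p w = D (v, w)"
    using tact_bounded_linear[OF assms(1)] by blast
  then show ?thesis
    using assms linear_scale[OF bounded_linear.linear[OF D(1)], of r "(v, w)"] by simp
qed

lemma linear_tact:
  assumes "src G g = mom P p" "linear f" "linear k" "\<And>x. tsrc G g (f x) = tmom G P p (k x)"
  shows "linear (\<lambda>x. tact G P g (f x) p (k x))"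
  using assms by (intro linearI) (simp_all add: linear_add linear_scale tact_add tact_scale)

section \<open>Infinitesimal generators and the cotangent action\<close>

text \<open>The generator written through the action alone, so that it is available before any
  morphism \<open>L\<close> is given; \<open>generator_L\<close> identifies it with
  \<open>generator\<close>.\<close>

definition inf_gen where
  "inf_gen p \<xi> = tact G P (ginv G (one G (mom P p))) (tinv G (one G (mom P p)) \<xi>) p 0"

lemma tmom_inf_gen:
  assumes "\<xi> \<in> LieA G (mom P p)"
  shows "tmom G P p (inf_gen p \<xi>) = tsrc G (one G (mom P p)) \<xi>"
proof -
  let ?e = "one G (mom P p)"
  have "tsrc G ?e (tinv G ?e \<xi>) = 0" "ttgt G ?e (tinv G ?e \<xi>) = tsrc G ?e \<xi>"
    using tsrc_tinv[of ?e \<xi>] ttgt_tinv[of ?e \<xi>] assms by (simp_all add: LieA_def)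
  then show ?thesis using tmom_tact[of ?e p "tinv G ?e \<xi>" 0] by (simp add: inf_gen_def)
qed

text \<open>\<open>z\<close> is the unit vector over its source minus the inverse of its Lie class.
  The first part fixes \<open>w\<close>, and the second acts on the zero vector by the definition of
  \<open>inf_gen\<close>.\<close>

lemma unit_tact:
  assumes "tsrc G (one G (mom P p)) z = tmom G P p w"
  shows "tact G P (one G (mom P p)) z p w = w - inf_gen p (lie_class G (mom P p) z)"
proof -
  let ?m = "mom P p" let ?e = "one G ?m" and ?a = "lie_class G ?m z"
  have a: "tinv G ?e ?a = tone G ?m (tsrc G ?e ?a) - ?a"
    by (rule unit_tinv) simp
  have z: "z = tone G ?m (tmom G P p w) - tinv G ?e ?a"
    unfolding a using assms by (simp add: lie_class_def)
  have s: "tsrc G ?e (tinv G ?e ?a) = 0" unfolding a by simp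
  have "tact G P ?e (tone G ?m (tmom G P p w) + (- 1) *\<^sub>R tinv G ?e ?a) p (w + (- 1) *\<^sub>R 0) =
      tact G P ?e (tone G ?m (tmom G P p w)) p w + tact G P ?e ((- 1) *\<^sub>R tinv G ?e ?a) p ((- 1) *\<^sub>R 0)"
    using s by (intro tact_add) simp_all
  also have "tact G P ?e ((- 1) *\<^sub>R tinv G ?e ?a) p ((- 1) *\<^sub>R 0) = (- 1) *\<^sub>R inf_gen p ?a"
    unfolding inf_gen_def ginv_one using s by (intro tact_scale) simp_all
  finally have "tact G P ?e (tone G ?m (tmom G P p w) - tinv G ?e ?a) p w = w - inf_gen p ?a"
    by simp
  with z show ?thesis by simp
qed

text \<open>The pairing \<open>\<langle>\<mu>, v\<rangle> + \<langle>\<nu>, w\<rangle>\<close> only depends on \<open>v \<cdot> w\<close>: composable pairs with the same product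
  differ by \<open>(k \<circ> z, w) \<leadsto> (k, z \<cdot> w)\<close> with \<open>z\<close> a tangent vector at a unit.\<close>

lemma cact_tact:
  assumes gp: "src G g = mom P p"
    and c: "\<And>\<xi>. \<xi> \<in> LieA G (mom P p) \<Longrightarrow> blinfun_apply (csrc G g \<mu>) \<xi> = - blinfun_apply \<nu> (inf_gen p \<xi>)"
    and vw: "tsrc G g v = tmom G P p w"
  shows "blinfun_apply (cact G P g \<mu> p \<nu>) (tact G P g v p w) = blinfun_apply \<mu> v + blinfun_apply \<nu> w"
proof -
  let ?e = "one G (src G g)" and ?q = "gact P g p"
  obtain \<tau> where \<tau>: "linear \<tau>" "\<And>w. ttgt G g (\<tau> w) = w" using ttgt_section by blast
  \<comment> \<open>A linear choice of factors: \<open>f u\<close> lifts the moment component of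
    \<open>u\<close> through the target map, and \<open>k u\<close> is \<open>u\<close> moved back
    by the inverse of \<open>f u\<close>.\<close>
  define f where "f u = \<tau> (tmom G P ?q u)" for u
  define k where "k u = tact G P (ginv G g) (tinv G g (f u)) ?q u" for u
  have f: "linear f" unfolding f_def
    using linear_compose[OF linear_tmom \<tau>(1)] by (simp add: o_def)
  have "linear (\<lambda>u. tinv G g (f u))"
    using linear_compose[OF f linear_tangent_maps(4)] by (simp add: o_def)
  then have "linear k" unfolding k_def
    by (intro linear_tact) (simp_all add: gp f_def \<tau> linear_id[unfolded id_def])
  with f have "linear (\<lambda>u. blinfun_apply \<mu> (f u) + blinfun_apply \<nu> (k u))"
    by (intro linearI) (simp_all add: linear_add linear_scale blinfun.add_right blinfun.scaleR_right algebra_simps)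
  from finite_dim_exists_dual[OF _ this]
  obtain \<kappa> :: "'w dual" where \<kappa>: "\<And>u. blinfun_apply \<kappa> u = blinfun_apply \<mu> (f u) + blinfun_apply \<nu> (k u)"
    using manifold_pmfd by (auto simp: manifold_def)
  have inv: "gact P (ginv G g) ?q = p"
    using gact_mul[of "ginv G g" g p] gp by simp
  have 1: "blinfun_apply \<kappa> (tact G P g v p w) = blinfun_apply \<mu> v + blinfun_apply \<nu> w"
    if vw: "tsrc G g v = tmom G P p w" for v w
  proof -
    define v' where "v' = f (tact G P g v p w)"
    have v': "ttgt G g v' = ttgt G g v" using vw gp by (simp add: v'_def f_def \<tau>)
    define z where "z = tmul G (ginv G g) (tinv G g v') g v"
    note z = tgt_difference[OF v', folded z_def]
    have "tact G P (mul G (ginv G g) g) (tmul G (ginv G g) (tinv G g v') g v) p w = k (tact G P g v p w)"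
      unfolding k_def v'_def[symmetric] by (rule tact_tmul) (use gp v' vw in simp_all)
    then have "tact G P ?e z p w = k (tact G P g v p w)" by (simp add: z_def)
    then have "k (tact G P g v p w) = w - inf_gen p (lie_class G (mom P p) z)"
      using unit_tact[of p z w] z(3) vw gp by simp
    then have "blinfun_apply \<nu> (k (tact G P g v p w)) =
        blinfun_apply \<nu> w - blinfun_apply \<nu> (inf_gen p (lie_class G (mom P p) z))"
      by (simp only: blinfun.diff_right)
    moreover have "blinfun_apply (csrc G g \<mu>) z = - blinfun_apply \<nu> (inf_gen p (lie_class G (mom P p) z))"
      using c[OF lie_class_in_LieA, of z] A_dual_lie_class[OF csrc[of g \<mu>], of z] gp by simp
    moreover have "blinfun_apply \<mu> v = blinfun_apply \<mu> v' + blinfun_apply (csrc G g \<mu>) z"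
      using csrc_tmul[of g v' z \<mu>] z by simp
    ultimately show ?thesis by (simp add: \<kappa> v'_def[symmetric])
  qed
  have "cact G P g \<mu> p \<nu> = \<kappa>"
    unfolding cact_def
  proof (rule the_equality)
    fix \<psi> assume \<psi>: "\<forall>v w. tsrc G g v = tmom G P p w \<longrightarrow>
        blinfun_apply \<psi> (tact G P g v p w) = blinfun_apply \<mu> v + blinfun_apply \<nu> w"
    show "\<psi> = \<kappa>"
    proof (rule blinfun_eqI)
      fix u
      have "tact G P (mul G g (ginv G g)) (tmul G g (f u) (ginv G g) (tinv G g (f u))) ?q u =
          tact G P g (f u) (gact P (ginv G g) ?q) (k u)"
        unfolding k_def by (rule tact_tmul) (simp_all add: gp f_def \<tau>)
      then have u: "u = tact G P g (f u) p (k u)"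
        using tact_tone[of ?q u] gp by (simp add: inv f_def \<tau>)
      have "tmom G P (gact P (ginv G g) ?q) (k u) = tsrc G g (f u)"
        unfolding k_def by (subst tmom_tact) (simp_all add: gp f_def \<tau>)
      then have "tsrc G g (f u) = tmom G P p (k u)" by (simp add: inv)
      then show "blinfun_apply \<psi> u = blinfun_apply \<kappa> u"
        using \<psi> 1 u by metis
    qed
  qed (use 1 in blast)
  then show ?thesis using 1[OF vw] by simp
qed

lemma jact_T_section:
  assumes H: "jet G g H"
    and \<sigma>: "\<And>w. \<sigma> w \<in> H" "\<And>w. tsrc G g (\<sigma> w) = w" "\<And>h. h \<in> H \<Longrightarrow> \<sigma> (tsrc G g h) = h"
  shows "jact_T G P g H p w = tact G P g (\<sigma> (tmom G P p w)) p w"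
proof -
  have "(THE v. v \<in> H \<and> tsrc G g v = tmom G P p w) = \<sigma> (tmom G P p w)"
    using \<sigma> by (intro the_equality) (simp, metis)
  then show ?thesis by (simp add: jact_T_def)
qed

text \<open>A preimage of \<open>u\<close> is obtained by acting with the inverse of the element of
  \<open>H\<close> whose target is the moment component of \<open>u\<close>. Surjectivity is what
  makes the description in \<open>cov_push\<close> unique.\<close>

lemma surj_jact_T:
  assumes H: "jet G g H" and gp: "src G g = mom P p"
  shows "surj (jact_T G P g H p)"
proof -
  let ?q = "gact P g p"
  obtain \<sigma> where \<sigma>: "\<And>w. \<sigma> w \<in> H" "\<And>w. tsrc G g (\<sigma> w) = w" "\<And>h. h \<in> H \<Longrightarrow> \<sigma> (tsrc G g h) = h"
    using jet_sections(1)[OF H] by blast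
  obtain \<rho> where \<rho>: "\<And>w. \<rho> w \<in> H" "\<And>w. ttgt G g (\<rho> w) = w"
    using jet_sections(2)[OF H] by blast
  have inv: "gact P (ginv G g) ?q = p"
    using gact_mul[of "ginv G g" g p] gp by simp
  have "\<exists>w. u = jact_T G P g H p w" for u
  proof -
    let ?k = "\<rho> (tmom G P ?q u)"
    define w where "w = tact G P (ginv G g) (tinv G g ?k) ?q u"
    have "tact G P (mul G g (ginv G g)) (tmul G g ?k (ginv G g) (tinv G g ?k)) ?q u =
        tact G P g ?k (gact P (ginv G g) ?q) w"
      unfolding w_def by (rule tact_tmul) (simp_all add: gp \<rho>)
    then have u: "u = tact G P g ?k p w"
      using tact_tone[of ?q u] gp by (simp add: inv \<rho>)
    have "tmom G P (gact P (ginv G g) ?q) w = tsrc G g ?k"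
      unfolding w_def by (subst tmom_tact) (simp_all add: gp \<rho>)
    then have "\<sigma> (tmom G P p w) = ?k" by (simp add: inv \<sigma>(3) \<rho>(1))
    then show ?thesis using u jact_T_section[OF H \<sigma>] by metis
  qed
  then show ?thesis by (simp add: surj_def)
qed

end

lemma cov_push_eqI:
  assumes "surj T" "\<And>w. blinfun_apply \<kappa> (T w) = blinfun_apply \<mu> w"
  shows "cov_push T \<mu> = \<kappa>"
  unfolding cov_push_def
proof (rule the_equality)
  fix \<psi> assume \<psi>: "\<forall>v. blinfun_apply \<psi> (T v) = blinfun_apply \<mu> v"
  show "\<psi> = \<kappa>"
  proof (rule blinfun_eqI)
    fix u
    obtain w where "u = T w" using assms(1) by (metis surj_def)
    then show "blinfun_apply \<psi> u = blinfun_apply \<kappa> u" using \<psi> assms(2) by simp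
  qed
qed (use assms(2) in blast)

section \<open>Hamiltonian spaces\<close>

locale hamiltonian_action =
  fixes E :: "('m::{t2_space,second_countable_topology}, 'v::banach, 'e::banach) courant"
    and A :: "'m \<Rightarrow> 'e set"
    and G :: "('g::{t2_space,second_countable_topology}, 'u::banach, 'm, 'v) groupoid"
    and \<iota> :: "'m \<Rightarrow> 'u \<Rightarrow> 'e"
    and Ad :: "'g \<Rightarrow> 'u set \<Rightarrow> 'e \<Rightarrow> 'e"
    and P :: "('p::{t2_space,second_countable_topology}, 'w::banach, 'g, 'm) gspace"
    and L :: "'p \<Rightarrow> ('e \<times> ('w \<times> 'w dual)) set"
  assumes equivariant: "equivariant_manin_pair E A G \<iota> Ad"
    and hamiltonian: "hamiltonian_space E A G \<iota> Ad P L"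
begin

sublocale tangent_action G P
proof
  show "lie_groupoid G" using equivariant by (simp add: equivariant_manin_pair_def)
  show "groupoid_action G P" using hamiltonian by (simp add: hamiltonian_space_def)
qed

section \<open>Consequences of the axioms for the pair and for the morphism\<close>

lemma courant: "courant_algebroid E"
  using equivariant by (simp add: equivariant_manin_pair_def manin_pair_def)

lemma cmetric_bilinear: "bilinear (cmetric E m)"
  and cmetric_nondegenerate: "(\<And>y. cmetric E m x y = 0) \<Longrightarrow> x = 0"
  and linear_canchor: "linear (canchor E m)"
  and finite_dim_fibre: "finite_dim TYPE('e)"
  using courant unfolding courant_algebroid_def vector_bundle_def by blast+

lemma integrates: "integrates E A G \<iota>"
  using equivariant by (simp add: equivariant_manin_pair_def)

lemma base_eq: "base E = objects G"
  and iota_in: "\<xi> \<in> LieA G m \<Longrightarrow> \<iota> m \<xi> \<in> A m"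
  and iota_linear: "\<xi> \<in> LieA G m \<Longrightarrow> \<eta> \<in> LieA G m \<Longrightarrow> \<iota> m (a *\<^sub>R \<xi> + b *\<^sub>R \<eta>) = a *\<^sub>R \<iota> m \<xi> + b *\<^sub>R \<iota> m \<eta>"
  using integrates unfolding integrates_def by (simp, metis bij_betwE, blast)

lemma cmetric_coanchor:
  assumes "linear \<theta>"
  shows "cmetric E m (coanchor E m \<theta>) \<zeta> = \<theta> (canchor E m \<zeta>)"
proof -
  have "linear (\<lambda>\<zeta>. \<theta> (canchor E m \<zeta>))"
    using linear_compose[OF linear_canchor assms] by (simp add: o_def)
  then have "\<exists>!e. \<forall>e'. cmetric E m e e' = \<theta> (canchor E m e')"
    by (intro nondegenerate_representation[OF finite_dim_fibre cmetric_bilinear cmetric_nondegenerate])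
  from theI'[OF this] show ?thesis by (simp add: coanchor_def)
qed

lemma Ad_Ad_inverse:
  assumes H: "jet G g H"
  shows "Ad g H (Ad (ginv G g) (jinv G g H) \<zeta>) = \<zeta>"
proof -
  have "jet_action E G Ad" using equivariant by (simp add: equivariant_manin_pair_def)
  then have "Ad (mul G g (ginv G g)) (jmul G g H (ginv G g) (jinv G g H)) \<zeta> = Ad g H (Ad (ginv G g) (jinv G g H) \<zeta>)"
    and "Ad (one G (tgt G g)) (jone G (tgt G g)) \<zeta> = \<zeta>"
    using H jet_jinv[OF H] tgt_ginv[of g, symmetric] unfolding jet_action_def by blast+
  then show ?thesis by (simp add: jmul_jinv[OF H])
qed

lemma manin: "manin_morphism (std_courant (pmfd P)) (\<lambda>_. {(v, \<mu>). \<mu> = 0}) E A (mom P) L"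
  using hamiltonian by (simp add: hamiltonian_space_def)

lemma L_subspace: "subspace (L p)"
  and L_eq: "L p = {x. \<forall>y\<in>L p. cmetric (courant_prod E (courant_opp (std_courant (pmfd P)))) (mom P p, p) x y = 0}"
  and L_tangent: "x \<in> L p \<Longrightarrow> \<exists>v. canchor (courant_prod E (courant_opp (std_courant (pmfd P)))) (mom P p, p) x =
      (tmap (base (std_courant (pmfd P))) (base E) (mom P) p v, v)"
  using manin unfolding manin_morphism_def courant_morphism_def lagrangian_def Let_def by blast+

lemma cmetric_L:
  "cmetric (courant_prod E (courant_opp (std_courant (pmfd P)))) (mom P p, p) (\<zeta>, (w, \<nu>)) (\<zeta>', (w', \<nu>')) =
     cmetric E (mom P p) \<zeta> \<zeta>' - (blinfun_apply \<nu> w' + blinfun_apply \<nu>' w)"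
  by (simp add: courant_prod_def courant_opp_def std_courant_def)

lemma L_isotropic:
  assumes "(\<zeta>, (w, \<nu>)) \<in> L p" "(\<zeta>', (w', \<nu>')) \<in> L p"
  shows "cmetric E (mom P p) \<zeta> \<zeta>' = blinfun_apply \<nu> w' + blinfun_apply \<nu>' w"
proof -
  have "cmetric (courant_prod E (courant_opp (std_courant (pmfd P)))) (mom P p, p) (\<zeta>, (w, \<nu>)) (\<zeta>', (w', \<nu>')) = 0"
    using assms L_eq[of p] by blast
  then show ?thesis unfolding cmetric_L by simp
qed

lemma L_maximal:
  assumes "\<And>\<zeta>' w' \<nu>'. (\<zeta>', (w', \<nu>')) \<in> L p \<Longrightarrow>
    cmetric E (mom P p) \<zeta> \<zeta>' = blinfun_apply \<nu> w' + blinfun_apply \<nu>' w"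
  shows "(\<zeta>, (w, \<nu>)) \<in> L p"
proof -
  have "\<forall>y\<in>L p. cmetric (courant_prod E (courant_opp (std_courant (pmfd P)))) (mom P p, p) (\<zeta>, (w, \<nu>)) y = 0"
    using assms cmetric_L by fastforce
  then show ?thesis using L_eq[of p] by blast
qed

lemma L_anchor: "(\<zeta>, (w, \<nu>)) \<in> L p \<Longrightarrow> canchor E (mom P p) \<zeta> = tmom G P p w"
  using L_tangent[of "(\<zeta>, (w, \<nu>))" p]
  by (auto simp: courant_prod_def courant_opp_def std_courant_def tmom_def base_eq)

text \<open>The Manin morphism condition gives exactly one \<open>v\<close> with
  \<open>(v, 0)\<close> related to a given element of \<open>A\<close>, so the description in
  \<open>generator\<close> is proper. The Hamiltonian condition then equates it with
  \<open>inf_gen\<close>.\<close>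

lemma generator_L:
  assumes "\<xi> \<in> LieA G (mom P p)"
  shows "generator \<iota> P L p \<xi> = inf_gen p \<xi>" "(\<iota> (mom P p) \<xi>, (inf_gen p \<xi>, 0)) \<in> L p"
proof -
  show eq: "generator \<iota> P L p \<xi> = inf_gen p \<xi>"
    using hamiltonian assms by (simp add: hamiltonian_space_def inf_gen_def)
  have "\<exists>!a. a \<in> {(v, \<mu>). \<mu> = 0} \<and> (\<iota> (mom P p) \<xi>, a) \<in> L p"
    using manin iota_in[OF assms] unfolding manin_morphism_def by blast
  then have "\<exists>!v. (\<iota> (mom P p) \<xi>, (v, 0)) \<in> L p" by auto
  from theI'[OF this] show "(\<iota> (mom P p) \<xi>, (inf_gen p \<xi>, 0)) \<in> L p"
    by (simp add: eq[symmetric] generator_def)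
qed

text \<open>Against any element of \<open>L p\<close> the two sides of the pairing are
  \<open>\<theta>\<close> of its anchor and of its moment component, equal by
  \<open>L_anchor\<close>. Maximality of \<open>L p\<close> gives membership.\<close>

lemma coanchor_L:
  assumes \<theta>: "linear \<theta>" and \<kappa>: "\<And>w. blinfun_apply \<kappa> w = \<theta> (tmom G P p w)"
  shows "(coanchor E (mom P p) \<theta>, (0, \<kappa>)) \<in> L p"
  by (rule L_maximal) (simp add: cmetric_coanchor[OF \<theta>] L_anchor \<kappa> blinfun.zero_right)

lemma pr_A_dual:
  "pr_A_dual E G \<iota> m \<zeta> \<in> A_dual G m"
  "\<xi> \<in> LieA G m \<Longrightarrow> blinfun_apply (pr_A_dual E G \<iota> m \<zeta>) \<xi> = cmetric E m \<zeta> (\<iota> m \<xi>)"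
proof -
  have "cmetric E m \<zeta> (\<iota> m (a *\<^sub>R \<xi> + b *\<^sub>R \<eta>)) = a * cmetric E m \<zeta> (\<iota> m \<xi>) + b * cmetric E m \<zeta> (\<iota> m \<eta>)"
    if "\<xi> \<in> LieA G m" "\<eta> \<in> LieA G m" for \<xi> \<eta> a b
    using cmetric_bilinear by (simp add: iota_linear[OF that] bilinear_radd bilinear_rmul)
  from A_dual_of[of m "\<lambda>\<xi>. cmetric E m \<zeta> (\<iota> m \<xi>)", OF this]
  show "pr_A_dual E G \<iota> m \<zeta> \<in> A_dual G m"
    "\<xi> \<in> LieA G m \<Longrightarrow> blinfun_apply (pr_A_dual E G \<iota> m \<zeta>) \<xi> = cmetric E m \<zeta> (\<iota> m \<xi>)"
    by (simp_all add: pr_A_dual_def)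
qed

lemma cmom_pr_A_dual:
  assumes "(\<zeta>, (w, \<nu>)) \<in> L p"
  shows "cmom G \<iota> P L p \<nu> = - pr_A_dual E G \<iota> (mom P p) \<zeta>"
    and "\<xi> \<in> LieA G (mom P p) \<Longrightarrow> blinfun_apply (cmom G \<iota> P L p \<nu>) \<xi> = - blinfun_apply \<nu> (inf_gen p \<xi>)"
proof -
  let ?\<phi> = "pr_A_dual E G \<iota> (mom P p) \<zeta>"
  have iso: "cmetric E (mom P p) \<zeta> (\<iota> (mom P p) \<xi>) = blinfun_apply \<nu> (inf_gen p \<xi>)"
    if "\<xi> \<in> LieA G (mom P p)" for \<xi>
    using L_isotropic[OF assms generator_L(2)[OF that]] by simp
  show eq: "cmom G \<iota> P L p \<nu> = - ?\<phi>"
    unfolding cmom_def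
  proof (rule A_dual_of_eqI)
    show "- ?\<phi> \<in> A_dual G (mom P p)" using pr_A_dual(1) by (simp add: A_dual_def blinfun.minus_left)
    show "blinfun_apply (- ?\<phi>) \<xi> = - blinfun_apply \<nu> (generator \<iota> P L p \<xi>)" if "\<xi> \<in> LieA G (mom P p)" for \<xi>
      using pr_A_dual(2)[OF that] iso[OF that] generator_L(1)[OF that] by (simp add: blinfun.minus_left)
  qed
  show "blinfun_apply (cmom G \<iota> P L p \<nu>) \<xi> = - blinfun_apply \<nu> (inf_gen p \<xi>)" if "\<xi> \<in> LieA G (mom P p)"
    using pr_A_dual(2)[OF that] iso[OF that] by (simp add: eq blinfun.minus_left)
qed

section \<open>The moment map condition and the module property\<close>

lemma TTmom_eq_alpha:
  assumes "(\<zeta>, y) \<in> L p"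
  shows "TTmom G \<iota> P L p y = alpha E G \<iota> (mom P p) \<zeta>"
proof (cases y)
  case (Pair w \<nu>)
  then show ?thesis
    using assms L_anchor[of \<zeta> w \<nu> p] cmom_pr_A_dual(1)[of \<zeta> w \<nu> p] by (simp add: TTmom_def alpha_def)
qed

lemma module_property:
  assumes gp: "src G g = mom P p" and ss: "TTsrc G g x = TTmom G \<iota> P L p y"
    and R: "rel_R E G \<iota> Ad g x \<zeta>' \<zeta>" and L: "(\<zeta>, y) \<in> L p"
  shows "(\<zeta>', TTact G P g x p y) \<in> L (gact P g p)"
proof -
  obtain v \<mu> where x: "x = (v, \<mu>)" by fastforce
  obtain w \<nu> where y: "y = (w, \<nu>)" by fastforce
  have vw: "tsrc G g v = tmom G P p w" and c: "csrc G g \<mu> = cmom G \<iota> P L p \<nu>"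
    using ss by (simp_all add: x y TTsrc_def TTmom_def)
  obtain H where H: "jet G g H" and b: "beta E \<iota> (src G g)
      (core_class G (src G g) (jleft_TT G (ginv G g) (jinv G g H) g x)) = \<zeta> - Ad (ginv G g) (jinv G g H) \<zeta>'"
    using R unfolding rel_R_def by blast
  obtain \<sigma> where \<sigma>: "linear \<sigma>" "\<And>w. \<sigma> w \<in> H" "\<And>w. tsrc G g (\<sigma> w) = w" "\<And>h. h \<in> H \<Longrightarrow> \<sigma> (tsrc G g h) = h"
    using jet_sections(1)[OF H] by blast
  \<comment> \<open>The element of \<open>H\<close> with the target of \<open>v\<close>, so that
    \<open>v\<close> becomes \<open>h\<close> composed with the vector \<open>z\<close> at a
    unit.\<close>
  obtain h where h: "h \<in> H" "ttgt G g h = ttgt G g v" using jet_sections(2)[OF H] by blast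
  let ?m = "mom P p" and ?e = "one G (mom P p)"
  define z where "z = tmul G (ginv G g) (tinv G g h) g v"
  note z = tgt_difference[OF h(2), folded z_def, unfolded gp]
  define a where "a = lie_class G ?m z"
  have a: "a \<in> LieA G ?m" by (simp add: a_def lie_class_in_LieA)
  \<comment> \<open>This is the restriction to \<open>TM\<close> of \<open>\<mu>\<close> moved back
    along \<open>H\<close>: a vector of \<open>TM\<close> lifts uniquely to \<open>H\<close> by
    \<open>\<sigma>\<close>.\<close>
  define \<theta> where "\<theta> u = blinfun_apply \<mu> (\<sigma> u)" for u
  have \<theta>: "linear \<theta>" unfolding \<theta>_def
    using linear_compose[OF \<sigma>(1) bounded_linear.linear[OF blinfun.bounded_linear_right]] by (simp add: o_def)
  have "linear (\<lambda>u. \<theta> (tmom G P p u))"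
    using linear_compose[OF linear_tmom \<theta>] by (simp add: o_def)
  from finite_dim_exists_dual[OF _ this]
  obtain \<kappa> :: "'w dual" where \<kappa>: "\<And>u. blinfun_apply \<kappa> u = \<theta> (tmom G P p u)"
    using manifold_pmfd by (auto simp: manifold_def)
  have "blinfun_apply (jleft_C G (ginv G g) (jinv G g H) g \<mu>) (tone G ?m u) = \<theta> u" for u
    using jleft_C_jinv_tone[OF H \<sigma>(2)[of u], of \<mu>] \<sigma>(3) gp by (simp add: \<theta>_def)
  then have "core_class G ?m (jleft_TT G (ginv G g) (jinv G g H) g x) = (a, \<theta>)"
    using jleft_T_jinv[OF H h] by (simp add: core_class_def jleft_TT_def x a_def z_def)
  then have \<zeta>': "Ad (ginv G g) (jinv G g H) \<zeta>' = \<zeta> - \<iota> ?m a + coanchor E ?m \<theta>"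
    using b by (simp add: gp beta_def algebra_simps)
  have "(\<zeta>, (w, \<nu>)) - (\<iota> ?m a, (inf_gen p a, 0)) + (coanchor E ?m \<theta>, (0, \<kappa>)) \<in> L p"
    using L[unfolded y] generator_L(2)[OF a] coanchor_L[OF \<theta> \<kappa>] L_subspace
    by (intro subspace_add subspace_diff) auto
  then have "(Ad (ginv G g) (jinv G g H) \<zeta>', (w - inf_gen p a, \<nu> + \<kappa>)) \<in> L p"
    by (simp add: \<zeta>')
  then have "(Ad g H (Ad (ginv G g) (jinv G g H) \<zeta>'), jact_TT G P g H p (w - inf_gen p a, \<nu> + \<kappa>)) \<in> L (gact P g p)"
    using hamiltonian H gp unfolding hamiltonian_space_def by blast
  moreover have "jact_T G P g H p (w - inf_gen p a) = tact G P g v p w"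
  proof -
    \<comment> \<open>After subtracting the generator, the moment component is the source of
      \<open>h\<close>, so \<open>h\<close> is the element of \<open>H\<close> selected by the jet
      action.\<close>
    have "tmom G P p (w - inf_gen p a) = tsrc G g h"
      using tmom_inf_gen[OF a] z(2,3) vw by (simp add: a_def)
    then have "jact_T G P g H p (w - inf_gen p a) = tact G P g h p (w - inf_gen p a)"
      by (simp add: jact_T_section[OF H \<sigma>(2-4)] \<sigma>(4)[OF h(1)])
    also have "\<dots> = tact G P g h p (tact G P ?e z p w)"
      using unit_tact[of p z w] z(3) vw by (simp add: a_def)
    also have "\<dots> = tact G P (mul G g ?e) (tmul G g h ?e z) p w"
      using tact_tmul[of g ?e p h z w] z(2,3) vw gp by simp
    also have "\<dots> = tact G P g v p w"
      using z(1) mul_one[of g] gp by simp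
    finally show ?thesis .
  qed
  moreover have "cov_push (jact_T G P g H p) (\<nu> + \<kappa>) = cact G P g \<mu> p \<nu>"
  proof (rule cov_push_eqI[OF surj_jact_T[OF H gp]])
    fix u
    \<comment> \<open>Composability of the covectors, in the form required by
      \<open>cact_tact\<close>. Evaluating on \<open>\<sigma>\<close> of the moment component of
      \<open>u\<close> then gives \<open>\<nu>\<close> plus the pullback \<open>\<kappa>\<close> of
      \<open>\<theta>\<close>.\<close>
    have "blinfun_apply (csrc G g \<mu>) \<xi> = - blinfun_apply \<nu> (inf_gen p \<xi>)" if "\<xi> \<in> LieA G (mom P p)" for \<xi>
      using cmom_pr_A_dual(2)[OF L[unfolded y] that] c by simp
    from cact_tact[OF gp this, of "\<sigma> (tmom G P p u)" u]
    show "blinfun_apply (cact G P g \<mu> p \<nu>) (jact_T G P g H p u) = blinfun_apply (\<nu> + \<kappa>) u"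
      by (simp add: jact_T_section[OF H \<sigma>(2-4)] \<sigma>(3) \<kappa> \<theta>_def blinfun.add_left)
  qed
  ultimately show ?thesis
    by (simp add: Ad_Ad_inverse[OF H] jact_TT_def TTact_def x y)
qed

end

theorem proposition5p4:
  fixes E :: "('m::{t2_space,second_countable_topology}, 'v::banach, 'e::banach) courant"
    and A :: "'m \<Rightarrow> 'e set"
    and G :: "('g::{t2_space,second_countable_topology}, 'u::banach, 'm, 'v) groupoid"
    and \<iota> :: "'m \<Rightarrow> 'u \<Rightarrow> 'e"
    and Ad :: "'g \<Rightarrow> 'u set \<Rightarrow> 'e \<Rightarrow> 'e"
    and P :: "('p::{t2_space,second_countable_topology}, 'w::banach, 'g, 'm) gspace"
    and L :: "'p \<Rightarrow> ('e \<times> ('w \<times> 'w dual)) set"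
  assumes "equivariant_manin_pair E A G \<iota> Ad"
    and "hamiltonian_space E A G \<iota> Ad P L"
  shows "(\<forall>p y \<zeta>. (\<zeta>, y) \<in> L p \<longrightarrow> TTmom G \<iota> P L p y = alpha E G \<iota> (mom P p) \<zeta>) \<and>
    (\<forall>g x p y \<zeta>' \<zeta>. src G g = mom P p \<and> TTsrc G g x = TTmom G \<iota> P L p y \<longrightarrow>
        rel_R E G \<iota> Ad g x \<zeta>' \<zeta> \<and> (\<zeta>, y) \<in> L p \<longrightarrow>
        (\<zeta>', TTact G P g x p y) \<in> L (gact P g p))"
proof -
  interpret hamiltonian_action E A G \<iota> Ad P L
    using assms by unfold_locales
  show ?thesis using TTmom_eq_alpha module_property by blast
qed

end
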